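(* Let $\Lambda$ be a lattice in $\mathbb{R}^d\times\widehat{\mathbb{R}}^d$ with adjoint lattice $\Lambda^0$, and let $\mathcal{A}_0$ be the algebra $\ell^1(\Lambda^0)$ with twisted convolution for the cocycle $\overline{\beta}$, regarded as a dense $*$-subalgebra of $C^*(\Lambda^0,\overline{\beta})$. Then $S_0(\mathbb{R}^d)$, with the right action $g\mathbf b=\sum_{\lambda^0\in\Lambda^0}b(\lambda^0)\pi(\lambda^0)^*g$ for $g\in S_0(\mathbb{R}^d)$, $\mathbf b\in\mathcal{A}_0$, is a finitely generated projective right $\mathcal{A}_0$-module.
   Context: Time-frequency shifts on $L^2(\mathbb{R}^d)$: $T_xf(t)=f(t-x)$, $M_\omega f(t)=e^{2\pi i\omega\cdot t}f(t)$, $\pi(x,\omega)=M_\omega T_x$. The cocycle $\beta$ is defined by $\pi(X)\pi(Y)=\beta(X,Y)\pi(X+Y)$. A lattice is a discrete cocompact subgroup of $\mathbb{R}^d\times\widehat{\mathbb{R}}^d$. The adjoint lattice is $\Lambda^0=\{Y:\pi(\lambda)\pi(Y)=\pi(Y)\pi(\lambda)\ \text{for all }\lambda\in\Lambda\}$. The product in $\mathcal{A}_0$ is $(\mathbf b_1\natural\mathbf b_2)(\lambda^0)=\sum_{\mu^0\in\Lambda^0}b_1(\mu^0)b_2(\lambda^0-\mu^0)\overline{\beta(\mu^0,\lambda^0-\mu^0)}$. $C^*(\Lambda^0,\overline\beta)$ is the twisted group $C^*$-algebra generated by unitaries $U_{\lambda^0}$ with $U_{\lambda^0}U_{\mu^0}=\overline{\beta(\lambda^0,\mu^0)}U_{\lambda^0+\mu^0}$,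 and $\mathbf b\in\ell^1(\Lambda^0)$ corresponds to $\sum_{\lambda^0} b(\lambda^0)U_{\lambda^0}$. Feichtinger's algebra is $S_0(\mathbb{R}^d)=\{f\in L^2(\mathbb{R}^d):\iint|\langle f,\pi(x,\omega)\varphi\rangle|\,dx\,d\omega<\infty\}$ with $\varphi(x)=2^{-d/4}e^{-\pi x\cdot x}$. *)

theory Defs
  imports
    "HOL-Probability.Distributions"
    "HOL-Algebra.AbelCoset"
begin

section \<open>The Hilbert space $L^2(\mathbb{R}^d)$\<close>

definition sq_integrable :: "(real^'n \<Rightarrow> complex) \<Rightarrow> bool" where
  "sq_integrable f \<longleftrightarrow>
     f \<in> borel_measurable lborel \<and> integrable lborel (\<lambda>t. (cmod (f t))\<^sup>2)"

definition sq_integrable_eq :: "(real^'n \<Rightarrow> complex) \<Rightarrow> (real^'n \<Rightarrow> complex) \<Rightarrow> bool" where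
  "sq_integrable_eq f g \<longleftrightarrow>
     sq_integrable f \<and> sq_integrable g \<and> (AE t in lborel. f t = g t)"

lemma sq_integrable_zero: "sq_integrable (\<lambda>_. 0)"
  by (simp add: sq_integrable_def)

lemma measurable_mult_cnj:
  assumes "sq_integrable f" "sq_integrable g"
  shows "(\<lambda>t. f t * cnj (g t)) \<in> borel_measurable lborel"
proof -
  have "(\<lambda>t. cnj (g t)) \<in> borel_measurable lborel"
    using assms(2) by (intro borel_measurable_continuous_on[of cnj g] continuous_intros)
      (simp add: sq_integrable_def)
  moreover have "f \<in> borel_measurable lborel"
    using assms(1) by (simp add: sq_integrable_def)
  ultimately show ?thesis
    by (intro borel_measurable_times)
qed

lemma sq_integrable_mult_cnj:
  assumes "sq_integrable f" "sq_integrable g"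
  shows "integrable lborel (\<lambda>t. f t * cnj (g t))"
proof (rule Bochner_Integration.integrable_bound)
  show "integrable lborel (\<lambda>t. (cmod (f t))\<^sup>2 + (cmod (g t))\<^sup>2)"
    using assms by (simp add: sq_integrable_def)
  show "(\<lambda>t. f t * cnj (g t)) \<in> borel_measurable lborel"
    using assms by (rule measurable_mult_cnj)
  have "norm (a * cnj b) \<le> norm ((cmod a)\<^sup>2 + (cmod b)\<^sup>2)" for a b :: complex
  proof -
    have "2 * (cmod a * cmod b) \<le> (cmod a)\<^sup>2 + (cmod b)\<^sup>2"
      using sum_squares_bound[of "cmod a" "cmod b"] by simp
    moreover have "0 \<le> cmod a * cmod b" by simp
    ultimately have "cmod a * cmod b \<le> (cmod a)\<^sup>2 + (cmod b)\<^sup>2" by linarith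
    then show ?thesis by (simp add: norm_mult)
  qed
  then show "AE t in lborel. norm (f t * cnj (g t)) \<le> norm ((cmod (f t))\<^sup>2 + (cmod (g t))\<^sup>2)"
    by simp
qed

lemma sq_integrable_add:
  assumes "sq_integrable f" "sq_integrable g"
  shows "sq_integrable (\<lambda>t. f t + g t)"
  unfolding sq_integrable_def
proof
  show m: "(\<lambda>t. f t + g t) \<in> borel_measurable lborel"
    using assms by (auto simp: sq_integrable_def)
  show "integrable lborel (\<lambda>t. (cmod (f t + g t))\<^sup>2)"
  proof (rule Bochner_Integration.integrable_bound)
    show "integrable lborel (\<lambda>t. 2 * (cmod (f t))\<^sup>2 + 2 * (cmod (g t))\<^sup>2)"
      using assms by (simp add: sq_integrable_def)
    show "(\<lambda>t. (cmod (f t + g t))\<^sup>2) \<in> borel_measurable lborel"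
      using m by measurable
    have "norm ((cmod (a + b))\<^sup>2) \<le> norm (2 * (cmod a)\<^sup>2 + 2 * (cmod b)\<^sup>2)" for a b :: complex
    proof -
      have "(cmod (a + b))\<^sup>2 \<le> (cmod a + cmod b)\<^sup>2"
        by (simp add: norm_triangle_ineq power_mono)
      also have "\<dots> \<le> 2 * (cmod a)\<^sup>2 + 2 * (cmod b)\<^sup>2"
        using sum_squares_bound[of "cmod a" "cmod b"] by (simp add: power2_sum)
      finally show ?thesis by simp
    qed
    then show "AE t in lborel. norm ((cmod (f t + g t))\<^sup>2)
        \<le> norm (2 * (cmod (f t))\<^sup>2 + 2 * (cmod (g t))\<^sup>2)"
      by simp
  qed
qed

lemma sq_integrable_cmult:
  assumes "sq_integrable f"
  shows "sq_integrable (\<lambda>t. c * f t)"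
  using assms by (auto simp: sq_integrable_def norm_mult power_mult_distrib)

lemma sq_integrable_translate:
  fixes f :: "real^'n \<Rightarrow> complex"
  assumes "sq_integrable f"
  shows "sq_integrable (\<lambda>t. f (t - x))"
proof -
  have D: "distr lborel borel (\<lambda>t. t - x) = (lborel :: (real^'n) measure)"
  proof -
    have "(\<lambda>t. t - x) = (+) (- x)" by (simp add: fun_eq_iff)
    then show ?thesis using lborel_distr_plus[of "- x"] by simp
  qed
  have m: "(\<lambda>t. t - x) \<in> measurable lborel (borel :: (real^'n) measure)" by simp
  have "integrable (distr lborel borel (\<lambda>t. t - x)) (\<lambda>t. (cmod (f t))\<^sup>2)"
    using assms by (simp add: D sq_integrable_def)
  then have "integrable lborel (\<lambda>t. (cmod (f (t - x)))\<^sup>2)"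
    using assms by (subst (asm) integrable_distr_eq[OF m]) (auto simp: sq_integrable_def)
  moreover have "(\<lambda>t. f (t - x)) \<in> borel_measurable lborel"
    using assms by (auto simp: sq_integrable_def)
  ultimately show ?thesis by (simp add: sq_integrable_def)
qed

lemma AE_lborel_translate:
  fixes x :: "real^'n"
  assumes "AE t in lborel. P t"
  shows "AE t in lborel. P (t - x)"
proof -
  have D: "distr lborel borel (\<lambda>t. t - x) = (lborel :: (real^'n) measure)"
  proof -
    have "(\<lambda>t. t - x) = (+) (- x)" by (simp add: fun_eq_iff)
    then show ?thesis using lborel_distr_plus[of "- x"] by simp
  qed
  have m: "(\<lambda>t. t - x) \<in> measurable lborel (borel :: (real^'n) measure)" by simp
  show ?thesis
    by (rule AE_distrD[OF m, of P, unfolded D, OF assms])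
qed

lemma sq_integrable_modulate:
  assumes "sq_integrable f"
  shows "sq_integrable (\<lambda>t. exp (2 * pi * \<i> * complex_of_real (\<omega> \<bullet> t)) * f t)"
proof -
  have "cmod (exp (2 * pi * \<i> * complex_of_real (\<omega> \<bullet> t))) = 1" for t
    by simp
  moreover have "(\<lambda>t. exp (2 * pi * \<i> * complex_of_real (\<omega> \<bullet> t)) * f t) \<in> borel_measurable lborel"
  proof -
    have [measurable]: "f \<in> borel_measurable borel"
      using assms by (simp add: sq_integrable_def)
    have [measurable]: "(\<lambda>t. exp (2 * pi * \<i> * complex_of_real (\<omega> \<bullet> t))) \<in> borel_measurable borel"
      by (intro borel_measurable_continuous_onI continuous_intros)
    show ?thesis by simp
  qed
  ultimately show ?thesis
    using assms by (simp add: sq_integrable_def norm_mult)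
qed

lemma sq_integrable_gaussian:
  "sq_integrable (\<lambda>x :: real^'n. complex_of_real (2 powr (- real CARD('n) / 4) * exp (- pi * (x \<bullet> x))))"
proof -
  let ?g = "\<lambda>x :: real. exp (- (2 * pi) * x\<^sup>2)"
  have 1: "integrable lborel ?g"
  proof -
    define s where "s = 1 / (2 * sqrt pi)"
    have s: "s > 0" "2 * s\<^sup>2 = 1 / (2 * pi)"
      by (simp_all add: s_def power_mult_distrib power_divide)
    have "?g x = sqrt (2 * pi * s\<^sup>2) * normal_density 0 s x" for x
      using s by (simp add: normal_density_def)
    moreover have "integrable lborel (\<lambda>x. sqrt (2 * pi * s\<^sup>2) * normal_density 0 s x)"
      using s integrable_normal_density[of s 0] by simp
    ultimately show ?thesis by presburger
  qed
  have "integrable lborel (\<lambda>x :: real^'n. \<Prod>b\<in>Basis. ?g (x \<bullet> b))"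
  proof (rule integrableI_nonneg)
    show "(\<lambda>x :: real^'n. \<Prod>b\<in>Basis. ?g (x \<bullet> b)) \<in> borel_measurable lborel"
      by measurable
    show "AE x :: real^'n in lborel. 0 \<le> (\<Prod>b\<in>Basis. ?g (x \<bullet> b))"
      by (simp add: prod_nonneg)
    have "(\<integral>\<^sup>+ (x :: real^'n). ennreal (\<Prod>b\<in>Basis. ?g (x \<bullet> b)) \<partial>lborel)
        = (\<integral>\<^sup>+ (x :: real^'n). (\<Prod>b\<in>Basis. ennreal (?g (x \<bullet> b))) \<partial>lborel)"
      by (simp add: prod_ennreal)
    also have "\<dots> = (\<Prod>b\<in>(Basis :: (real^'n) set). \<integral>\<^sup>+ x. ennreal (?g x) \<partial>lborel)"
      by (rule nn_integral_lborel_prod) auto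
    also have "\<dots> < \<infinity>"
      using 1 by (simp add: integrable_iff_bounded power_less_top_ennreal top.not_eq_extremum)
    finally show "(\<integral>\<^sup>+ (x :: real^'n). ennreal (\<Prod>b\<in>Basis. ?g (x \<bullet> b)) \<partial>lborel) < \<infinity>" .
  qed
  moreover have "(\<Prod>b\<in>Basis. ?g (x \<bullet> b)) = (exp (- pi * (x \<bullet> x)))\<^sup>2" for x :: "real^'n"
  proof -
    have "(\<Prod>b\<in>Basis. ?g (x \<bullet> b)) = exp (\<Sum>b\<in>Basis. - (2 * pi) * (x \<bullet> b)\<^sup>2)"
      by (simp only: exp_sum finite_Basis)
    also have "(\<Sum>b\<in>Basis. - (2 * pi) * (x \<bullet> b)\<^sup>2) = - (2 * pi) * (x \<bullet> x)"
      by (simp only: sum_distrib_left[symmetric] euclidean_inner[of x x] power2_eq_square)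
    also have "exp \<dots> = (exp (- pi * (x \<bullet> x)))\<^sup>2"
      by (simp add: exp_double[symmetric])
    finally show ?thesis .
  qed
  ultimately have "integrable lborel (\<lambda>x :: real^'n. (exp (- pi * (x \<bullet> x)))\<^sup>2)"
    by simp
  then have "integrable lborel
      (\<lambda>x :: real^'n. (2 powr (- real CARD('n) / 4))\<^sup>2 * (exp (- pi * (x \<bullet> x)))\<^sup>2)"
    by (rule integrable_mult_right)
  then show ?thesis
    unfolding sq_integrable_def
    by (auto simp: norm_mult power_mult_distrib)
qed

text \<open>Every Lebesgue measurable function agrees almost everywhere with a Borel measurable one,
  so Borel representatives yield the usual $L^2$ space.\<close>

quotient_type (overloaded) 'n L2 = "real^('n::finite) \<Rightarrow> complex" / partial: sq_integrable_eq
proof (rule part_equivpI)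
  show "\<exists>f :: real^'n \<Rightarrow> complex. sq_integrable_eq f f"
    using sq_integrable_zero by (auto simp: sq_integrable_eq_def)
  show "symp sq_integrable_eq"
    by (rule sympI) (auto simp: sq_integrable_eq_def)
  show "transp sq_integrable_eq"
    by (rule transpI) (auto simp: sq_integrable_eq_def)
qed

lift_definition cscale :: "complex \<Rightarrow> 'n::finite L2 \<Rightarrow> 'n L2" is "\<lambda>c f t. c * f t"
  by (auto simp: sq_integrable_eq_def sq_integrable_cmult)

lift_definition cinner :: "'n::finite L2 \<Rightarrow> 'n L2 \<Rightarrow> complex"
  is "\<lambda>f g. LINT t|lborel. f t * cnj (g t)"
  by (rule integral_cong_AE; (rule measurable_mult_cnj)?) (auto simp: sq_integrable_eq_def)

instantiation L2 :: (finite) real_vector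
begin

lift_definition zero_L2 :: "'a L2" is "\<lambda>_. 0"
  by (simp add: sq_integrable_eq_def sq_integrable_zero)

lift_definition plus_L2 :: "'a L2 \<Rightarrow> 'a L2 \<Rightarrow> 'a L2" is "\<lambda>f g t. f t + g t"
  by (auto simp: sq_integrable_eq_def sq_integrable_add)

definition "scaleR_L2 r f = cscale (complex_of_real r) (f :: 'a L2)"

definition "uminus_L2 f = cscale (- 1) (f :: 'a L2)"

definition "minus_L2 f g = f + - (g :: 'a L2)"

instance
proof
  fix f g h :: "'a L2" and r s :: real
  show "f + g + h = f + (g + h)"
    by transfer (auto simp: sq_integrable_eq_def add.assoc intro!: sq_integrable_add)
  show "f + g = g + f"
    by transfer (auto simp: sq_integrable_eq_def add.commute intro!: sq_integrable_add)
  show "0 + f = f"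
    by transfer (auto simp: sq_integrable_eq_def)
  show "- f + f = 0"
    unfolding uminus_L2_def
    by transfer (auto simp: sq_integrable_eq_def sq_integrable_zero)
  show "f - g = f + - g"
    by (rule minus_L2_def)
  show "r *\<^sub>R (f + g) = r *\<^sub>R f + r *\<^sub>R g"
    unfolding scaleR_L2_def
    by transfer (auto simp: sq_integrable_eq_def distrib_left
        intro!: sq_integrable_add sq_integrable_cmult)
  show "(r + s) *\<^sub>R f = r *\<^sub>R f + s *\<^sub>R f"
    unfolding scaleR_L2_def
    by transfer (auto simp: sq_integrable_eq_def distrib_right
        intro!: sq_integrable_add sq_integrable_cmult)
  show "r *\<^sub>R s *\<^sub>R f = (r * s) *\<^sub>R f"
    unfolding scaleR_L2_def
    by transfer (auto simp: sq_integrable_eq_def mult.assoc intro!: sq_integrable_cmult)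
  show "1 *\<^sub>R f = f"
    unfolding scaleR_L2_def
    by transfer (auto simp: sq_integrable_eq_def)
qed

end

lemma cinner_add_left: "cinner (f + g) h = cinner f h + cinner g h"
proof transfer
  fix f g h :: "real^'a \<Rightarrow> complex"
  assume "sq_integrable_eq f f" "sq_integrable_eq g g" "sq_integrable_eq h h"
  then have "integrable lborel (\<lambda>t. f t * cnj (h t))" "integrable lborel (\<lambda>t. g t * cnj (h t))"
    by (auto simp: sq_integrable_eq_def sq_integrable_mult_cnj)
  then show "(LINT t|lborel. (f t + g t) * cnj (h t))
      = (LINT t|lborel. f t * cnj (h t)) + (LINT t|lborel. g t * cnj (h t))"
    by (simp add: distrib_right)
qed

lemma cinner_cscale_left: "cinner (cscale c f) g = c * cinner f g"
  by transfer (simp add: mult.assoc)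

lemma cinner_commute: "cinner f g = cnj (cinner g f)"
proof transfer
  fix f g :: "real^'a \<Rightarrow> complex"
  assume "sq_integrable_eq f f" "sq_integrable_eq g g"
  show "(LINT t|lborel. f t * cnj (g t)) = cnj (LINT t|lborel. g t * cnj (f t))"
    by (subst Bochner_Integration.integral_cnj[symmetric]) (simp add: mult.commute)
qed

lemma cinner_self: "cinner f f = complex_of_real (Re (cinner f f))"
  using cinner_commute[of f f] by (simp add: complex_eq_iff)

lemma Re_cinner_self_nonneg: "0 \<le> Re (cinner f f)"
proof transfer
  fix f :: "real^'a \<Rightarrow> complex"
  have "(LINT t|lborel. f t * cnj (f t)) = complex_of_real (LINT t|lborel. (cmod (f t))\<^sup>2)"
    by (simp add: complex_norm_square[symmetric] flip: of_real_power)
  then show "0 \<le> Re (LINT t|lborel. f t * cnj (f t))"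
    by simp
qed

lemma Re_cinner_self_eq_0: "Re (cinner f f) = 0 \<longleftrightarrow> f = 0"
proof transfer
  fix f :: "real^'a \<Rightarrow> complex"
  assume f: "sq_integrable_eq f f"
  have "(LINT t|lborel. f t * cnj (f t)) = complex_of_real (LINT t|lborel. (cmod (f t))\<^sup>2)"
    by (simp add: complex_norm_square[symmetric] flip: of_real_power)
  then have "Re (LINT t|lborel. f t * cnj (f t)) = 0 \<longleftrightarrow> (LINT t|lborel. (cmod (f t))\<^sup>2) = 0"
    by simp
  also have "\<dots> \<longleftrightarrow> (AE t in lborel. (cmod (f t))\<^sup>2 = 0)"
    using f by (intro integral_nonneg_eq_0_iff_AE) (auto simp: sq_integrable_eq_def sq_integrable_def)
  also have "\<dots> \<longleftrightarrow> sq_integrable_eq f (\<lambda>_. 0)"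
    using f by (simp add: sq_integrable_eq_def sq_integrable_zero)
  finally show "Re (LINT t|lborel. f t * cnj (f t)) = 0 \<longleftrightarrow> sq_integrable_eq f (\<lambda>_. 0)" .
qed

instantiation L2 :: (finite) real_inner
begin

definition "inner_L2 f g = Re (cinner f (g :: 'a L2))"

definition "norm_L2 f = sqrt (Re (cinner f (f :: 'a L2)))"

definition "sgn_L2 f = inverse (norm f) *\<^sub>R (f :: 'a L2)"

definition "dist_L2 f g = norm (f - (g :: 'a L2))"

definition "uniformity_L2 = (INF e\<in>{0 <..}. principal {(f :: 'a L2, g). dist f g < e})"

definition "open_L2 U \<longleftrightarrow> (\<forall>f\<in>U. \<forall>\<^sub>F (f', g) in uniformity. f' = f \<longrightarrow> (g :: 'a L2) \<in> U)"

instance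
proof
  fix f g h :: "'a L2" and r :: real
  show "inner f g = inner g f"
    unfolding inner_L2_def by (subst cinner_commute) simp
  show "inner (f + g) h = inner f h + inner g h"
    by (simp add: inner_L2_def cinner_add_left)
  show "inner (r *\<^sub>R f) g = r * inner f g"
    by (simp add: inner_L2_def scaleR_L2_def cinner_cscale_left)
  show "0 \<le> inner f f"
    by (simp add: inner_L2_def Re_cinner_self_nonneg)
  show "inner f f = 0 \<longleftrightarrow> f = 0"
    by (simp add: inner_L2_def Re_cinner_self_eq_0)
  show "norm f = sqrt (inner f f)"
    by (simp add: norm_L2_def inner_L2_def)
qed (simp_all only: sgn_L2_def dist_L2_def uniformity_L2_def open_L2_def)

end

text \<open>The defining property determines the adjoint uniquely since the inner product is
  nondegenerate; it exists for all time-frequency shifts, which are unitary.\<close>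

definition cadjoint :: "('n::finite L2 \<Rightarrow> 'n L2) \<Rightarrow> 'n L2 \<Rightarrow> 'n L2" where
  "cadjoint T = (THE S. \<forall>f g. cinner (T f) g = cinner f (S g))"


section \<open>Time-frequency shifts\<close>

type_synonym 'n phase_space = "(real, 'n) vec \<times> (real, 'n) vec"

lift_definition translation :: "real^'n \<Rightarrow> 'n L2 \<Rightarrow> 'n::finite L2"
  is "\<lambda>x f t. f (t - x)"
  subgoal for x f g
    using AE_lborel_translate[of "\<lambda>t. f t = g t" x]
    by (simp only: sq_integrable_eq_def sq_integrable_translate simp_thms)
  done

lift_definition modulation :: "real^'n \<Rightarrow> 'n L2 \<Rightarrow> 'n::finite L2"
  is "\<lambda>\<omega> f t. exp (2 * pi * \<i> * complex_of_real (\<omega> \<bullet> t)) * f t"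
  subgoal for \<omega> f g
    using sq_integrable_modulate[of f \<omega>] sq_integrable_modulate[of g \<omega>]
    by (auto simp: sq_integrable_eq_def)
  done

definition tf_shift :: "'n::finite phase_space \<Rightarrow> 'n L2 \<Rightarrow> 'n L2" where
  "tf_shift = (\<lambda>(x, \<omega>). modulation \<omega> \<circ> translation x)"

definition cocycle :: "'n::finite phase_space \<Rightarrow> 'n phase_space \<Rightarrow> complex" where
  "cocycle X Y = (THE c. \<forall>f. tf_shift X (tf_shift Y f) = cscale c (tf_shift (X + Y) f))"


section \<open>Lattices\<close>

definition add_coset :: "'a::ab_group_add set \<Rightarrow> 'a \<Rightarrow> 'a set" where
  "add_coset \<Lambda> x = {x + l |l. l \<in> \<Lambda>}"

definition quotient_space :: "'a::{ab_group_add, topological_space} set \<Rightarrow> 'a set topology" where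
  "quotient_space \<Lambda> =
     topology (\<lambda>U. U \<subseteq> range (add_coset \<Lambda>) \<and> open (add_coset \<Lambda> -` U))"

lemma openin_quotient_space:
  "openin (quotient_space \<Lambda>) U \<longleftrightarrow> U \<subseteq> range (add_coset \<Lambda>) \<and> open (add_coset \<Lambda> -` U)"
proof -
  have "istopology (\<lambda>U. U \<subseteq> range (add_coset \<Lambda>) \<and> open (add_coset \<Lambda> -` U))"
    unfolding istopology_def by (auto simp: vimage_Union)
  then show ?thesis
    by (simp add: quotient_space_def topology_inverse')
qed

definition cocompact :: "'a::{ab_group_add, topological_space} set \<Rightarrow> bool" where
  "cocompact \<Lambda> \<longleftrightarrow> compact_space (quotient_space \<Lambda>)"

definition tf_lattice :: "'n::finite phase_space set \<Rightarrow> bool" where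
  "tf_lattice \<Lambda> \<longleftrightarrow>
     0 \<in> \<Lambda> \<and> (\<forall>X\<in>\<Lambda>. \<forall>Y\<in>\<Lambda>. X + Y \<in> \<Lambda>) \<and> (\<forall>X\<in>\<Lambda>. - X \<in> \<Lambda>) \<and> discrete \<Lambda> \<and> cocompact \<Lambda>"

definition adjoint_lattice :: "'n::finite phase_space set \<Rightarrow> 'n phase_space set" where
  "adjoint_lattice \<Lambda> = {Y. \<forall>X\<in>\<Lambda>. tf_shift X \<circ> tf_shift Y = tf_shift Y \<circ> tf_shift X}"


section \<open>Right modules over a possibly noncommutative ring\<close>

record ('a, 'b) right_module = "'b ring" +
  ract :: "'b \<Rightarrow> 'a \<Rightarrow> 'b"

locale right_module = R?: ring R + M?: abelian_group M
  for R (structure) and M :: "('a, 'b, 'm) right_module_scheme" (structure) +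
  assumes ract_closed:
      "\<lbrakk>x \<in> carrier M; a \<in> carrier R\<rbrakk> \<Longrightarrow> ract M x a \<in> carrier M"
    and ract_add_left:
      "\<lbrakk>x \<in> carrier M; y \<in> carrier M; a \<in> carrier R\<rbrakk>
        \<Longrightarrow> ract M (x \<oplus>\<^bsub>M\<^esub> y) a = ract M x a \<oplus>\<^bsub>M\<^esub> ract M y a"
    and ract_add_right:
      "\<lbrakk>x \<in> carrier M; a \<in> carrier R; b \<in> carrier R\<rbrakk>
        \<Longrightarrow> ract M x (a \<oplus>\<^bsub>R\<^esub> b) = ract M x a \<oplus>\<^bsub>M\<^esub> ract M x b"
    and ract_assoc:
      "\<lbrakk>x \<in> carrier M; a \<in> carrier R; b \<in> carrier R\<rbrakk>
        \<Longrightarrow> ract M x (a \<otimes>\<^bsub>R\<^esub> b) = ract M (ract M x a) b"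
    and ract_one:
      "x \<in> carrier M \<Longrightarrow> ract M x \<one>\<^bsub>R\<^esub> = x"

text \<open>The multiplicative fields that a module record inherits from \<open>ring\<close> carry no meaning and
  are left undefined.\<close>

definition free_right_module ::
  "('a, 'r) ring_scheme \<Rightarrow> nat \<Rightarrow> ('a, nat \<Rightarrow> 'a) right_module" where
  "free_right_module R n =
     \<lparr>carrier = {..<n} \<rightarrow>\<^sub>E carrier R,
      monoid.mult = undefined, one = undefined,
      zero = (\<lambda>i\<in>{..<n}. \<zero>\<^bsub>R\<^esub>),
      add = (\<lambda>v w. \<lambda>i\<in>{..<n}. v i \<oplus>\<^bsub>R\<^esub> w i),
      ract = (\<lambda>v a. \<lambda>i\<in>{..<n}. v i \<otimes>\<^bsub>R\<^esub> a)\<rparr>"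

definition submodule_of ::
  "('a, 'r) ring_scheme \<Rightarrow> ('a, 'b, 'm) right_module_scheme \<Rightarrow> 'b set \<Rightarrow> bool" where
  "submodule_of R M P \<longleftrightarrow>
     P \<subseteq> carrier M \<and> \<zero>\<^bsub>M\<^esub> \<in> P \<and>
     (\<forall>x\<in>P. \<forall>y\<in>P. x \<oplus>\<^bsub>M\<^esub> y \<in> P) \<and> (\<forall>x\<in>P. \<ominus>\<^bsub>M\<^esub> x \<in> P) \<and>
     (\<forall>x\<in>P. \<forall>a\<in>carrier R. ract M x a \<in> P)"

definition direct_summand ::
  "('a, 'r) ring_scheme \<Rightarrow> ('a, 'b, 'm) right_module_scheme \<Rightarrow> 'b set \<Rightarrow> bool" where
  "direct_summand R M P \<longleftrightarrow>
     submodule_of R M P \<and>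
     (\<exists>Q. submodule_of R M Q \<and> P <+>\<^bsub>M\<^esub> Q = carrier M \<and> P \<inter> Q = {\<zero>\<^bsub>M\<^esub>})"

definition right_module_iso ::
  "('a, 'r) ring_scheme \<Rightarrow> ('a, 'b, 'm) right_module_scheme \<Rightarrow>
   ('a, 'c, 'k) right_module_scheme \<Rightarrow> ('b \<Rightarrow> 'c) \<Rightarrow> bool" where
  "right_module_iso R M N h \<longleftrightarrow>
     bij_betw h (carrier M) (carrier N) \<and>
     (\<forall>x\<in>carrier M. \<forall>y\<in>carrier M. h (x \<oplus>\<^bsub>M\<^esub> y) = h x \<oplus>\<^bsub>N\<^esub> h y) \<and>
     (\<forall>x\<in>carrier M. \<forall>a\<in>carrier R. h (ract M x a) = ract N (h x) a)"

text \<open>A right module is finitely generated projective if it is isomorphic to a direct summand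
  of a free right module of finite rank.\<close>

definition fin_gen_projective ::
  "('a, 'r) ring_scheme \<Rightarrow> ('a, 'b, 'm) right_module_scheme \<Rightarrow> bool" where
  "fin_gen_projective R M \<longleftrightarrow>
     right_module R M \<and>
     (\<exists>n P h. direct_summand R (free_right_module R n) P \<and>
        right_module_iso R M ((free_right_module R n)\<lparr>carrier := P\<rparr>) h)"


section \<open>The twisted convolution algebra and Feichtinger's algebra\<close>

text \<open>Elements of $\ell^1(\Gamma)$ are functions on the whole phase space vanishing off \<open>\<Gamma>\<close>.
  In the twisted convolution, the sum over \<open>\<Gamma>\<close> converges absolutely.\<close>

definition twisted_l1 :: "'n::finite phase_space set \<Rightarrow> ('n phase_space \<Rightarrow> complex) ring" where
  "twisted_l1 \<Gamma> =
     \<lparr>carrier = {b. (\<forall>X. X \<notin> \<Gamma> \<longrightarrow> b X = 0) \<and> (\<lambda>X. cmod (b X)) summable_on \<Gamma>},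
      monoid.mult = (\<lambda>b\<^sub>1 b\<^sub>2 X. if X \<in> \<Gamma>
         then (\<Sum>\<^sub>\<infinity>Y\<in>\<Gamma>. b\<^sub>1 Y * b\<^sub>2 (X - Y) * cnj (cocycle Y (X - Y))) else 0),
      one = (\<lambda>X. if X = 0 then 1 else 0),
      zero = (\<lambda>X. 0),
      add = (\<lambda>b\<^sub>1 b\<^sub>2 X. b\<^sub>1 X + b\<^sub>2 X)\<rparr>"

lift_definition gaussian :: "'n::finite L2"
  is "\<lambda>x. complex_of_real (2 powr (- real CARD('n) / 4) * exp (- pi * (x \<bullet> x)))"
  unfolding sq_integrable_eq_def using sq_integrable_gaussian by simp

definition feichtinger :: "'n::finite L2 set" where
  "feichtinger =
     {f. (\<integral>\<^sup>+x. \<integral>\<^sup>+\<omega>. ennreal (cmod (cinner f (tf_shift (x, \<omega>) gaussian))) \<partial>lborel \<partial>lborel) < \<infinity>}"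

text \<open>The series defining the action converges unconditionally in the norm of $L^2$.\<close>

definition feichtinger_module ::
  "'n::finite phase_space set \<Rightarrow> ('n phase_space \<Rightarrow> complex, 'n L2) right_module" where
  "feichtinger_module \<Gamma> =
     \<lparr>carrier = feichtinger,
      monoid.mult = undefined, one = undefined,
      zero = 0,
      add = (+),
      ract = (\<lambda>g b. \<Sum>\<^sub>\<infinity>X\<in>\<Gamma>. cscale (b X) (cadjoint (tf_shift X) g))\<rparr>"

end

theory Submission
  imports
    Defs
    "HOL-Probability.Characteristic_Functions"
    "HOL-Real_Asymp.Real_Asymp"
begin

text \<open>Write \<open>\<phi>\<close> for the Gaussian, \<open>V f z = \<langle>f, \<pi>(z)\<phi>\<rangle>\<close>, \<open>c = \<parallel>\<phi>\<parallel>\<^sup>2\<close>, and \<open>\<Gamma>\<close> for the adjoint lattice,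
  which is again discrete and relatively dense. Every \<open>f\<close> in Feichtinger's algebra satisfies
  \<open>c f = \<integral> V f(z) \<pi>(z)\<phi> dz\<close>. Cut a fundamental domain of \<open>\<Gamma>\<close> into finitely many cells \<open>D i\<close> of
  diameter about \<open>\<delta>\<close> around points \<open>X i\<close> and consider the Riemann sum
  \<open>S f = \<Sum>i. \<bar>D i\<bar> (\<Sum>Y\<in>\<Gamma>. V f(X i - Y) \<pi>(X i - Y)\<phi>)\<close>. It factors as \<open>S = E \<circ> C\<close> through the free module of
  finite rank, with \<open>C f = (\<langle>\<pi>(Y) f, \<pi>(X i)\<phi>\<rangle>)\<close> and \<open>E b = \<Sum>i. \<bar>D i\<bar> (\<pi>(X i)\<phi>) b i\<close>, and both factors
  are module maps. By the reproducing formula for \<open>V f\<close> and the Lipschitz continuity of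
  \<open>z \<mapsto> \<langle>\<pi>(u)\<phi>, \<pi>(z)\<phi>\<rangle>\<langle>\<pi>(z)\<phi>, \<pi>(w)\<phi>\<rangle>\<close>, with Gaussian decay in \<open>u - z\<close> and \<open>w - z\<close>,
  the norm of \<open>S - c\<close> for \<open>\<parallel>f\<parallel> = \<parallel>V f\<parallel>\<^sub>1\<close> is \<open>O(\<delta>)\<close>. So for small \<open>\<delta>\<close> the Neumann series shows that \<open>S\<close> is
  bijective, and the module is isomorphic to the image of \<open>C\<close>, a direct summand with complement
  the kernel of \<open>E\<close>.\<close>

section \<open>Fourier analysis on Euclidean spaces\<close>

text \<open>The inverse of \<open>S\<close> has to be found inside Feichtinger's algebra and not
  only on the Hilbert space, since only there are the coefficients \<open>C f\<close> guaranteed to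
  be absolutely summable. Contraction in the L^1 norm of V f settles this directly, without any
  spectral invariance of the twisted algebra. The obstacle is phase: the kernel
  \<langle>\<pi>(u)\<phi>, \<pi>(z)\<phi>\<rangle> oscillates in z at a rate that grows with the
  position of z, so no Lipschitz estimate for it alone is uniform over phase space. Replacing V f by
  its reproducing integral produces a product of two kernels, in which the part of the phase
  quadratic in z cancels. What remains is linear in z with slope u - w, hence controlled by u - z
  and w - z, and the Gaussian decay absorbs it. The same decay bounds V f near a point by a local
  average, which makes the samples of V f along \<open>\<Gamma>\<close> absolutely summable. Since
  only elements with integrable V f occur, Fourier inversion for integrable functions with
  integrable transform suffices for the reproducing formula.\<close>

lemma lborel_integral_prod_Basis:
  fixes f :: "'a::euclidean_space \<Rightarrow> real \<Rightarrow> 'b::{real_normed_field, banach, second_countable_topology}"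
  assumes f: "\<And>b. b \<in> Basis \<Longrightarrow> integrable lborel (f b)"
  shows "integrable lborel (\<lambda>x::'a. \<Prod>b\<in>Basis. f b (x \<bullet> b))"
    and "(\<integral>x. (\<Prod>b\<in>Basis. f b ((x::'a) \<bullet> b)) \<partial>lborel) = (\<Prod>b\<in>Basis. \<integral>x. f b x \<partial>lborel)"
proof -
  interpret product_sigma_finite "\<lambda>_::'a. lborel :: real measure" ..
  have m[measurable]: "b \<in> Basis \<Longrightarrow> f b \<in> borel_measurable borel" for b
    using borel_measurable_integrable[OF f, of b] by simp
  have T: "(\<lambda>f. \<Sum>b\<in>Basis. f b *\<^sub>R b) \<in> measurable (\<Pi>\<^sub>M b\<in>Basis. lborel :: real measure) (borel :: 'a measure)"
    by simp
  have eq: "(\<Prod>b\<in>Basis. f b ((\<Sum>b\<in>Basis. g b *\<^sub>R b) \<bullet> b)) = (\<Prod>b\<in>Basis. f b (g b))" for g :: "'a \<Rightarrow> real"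
    by (intro prod.cong) (auto simp: inner_sum_left inner_Basis if_distrib cong: if_cong)
  have mf: "(\<lambda>x::'a. \<Prod>b\<in>Basis. f b (x \<bullet> b)) \<in> borel_measurable borel"
    by measurable
  have "integrable (\<Pi>\<^sub>M b\<in>Basis. lborel) (\<lambda>x. \<Prod>b\<in>Basis. f b (x b))"
    using f by (intro product_integrable_prod) auto
  then show "integrable lborel (\<lambda>x::'a. \<Prod>b\<in>Basis. f b (x \<bullet> b))"
    by (subst lborel_eq, subst integrable_distr_eq[OF T mf]) (simp only: eq)
  show "(\<integral>x. (\<Prod>b\<in>Basis. f b ((x::'a) \<bullet> b)) \<partial>lborel) = (\<Prod>b\<in>Basis. \<integral>x. f b x \<partial>lborel)"
    using product_integral_prod[OF finite_Basis, of f] f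
    by (subst lborel_eq, subst integral_distr[OF T mf]) (simp only: eq)
qed

text \<open>Stretching t by \<open>s\<close> = sqrt(2 \<pi> a) turns the integrand into a standard
  normal density times a character, so the value is read off from the characteristic function of the
  normal distribution.\<close>

lemma gaussian_fourier_real:
  fixes a \<xi> :: real
  assumes "a > 0"
  shows "integrable lborel (\<lambda>t. exp (complex_of_real (- pi * a * t\<^sup>2) + 2 * pi * \<i> * complex_of_real (\<xi> * t)))"
      (is "integrable lborel ?f")
    and "(\<integral>t. exp (complex_of_real (- pi * a * t\<^sup>2) + 2 * pi * \<i> * complex_of_real (\<xi> * t)) \<partial>lborel)
      = complex_of_real (exp (- pi * \<xi>\<^sup>2 / a) / sqrt a)"
      (is "_ = ?r")
proof -
  define s where "s = sqrt (2 * pi * a)"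
  have s: "s > 0" "s\<^sup>2 = 2 * pi * a" using assms by (auto simp: s_def)
  define F where "F = (\<lambda>y. std_normal_density y *\<^sub>R iexp (2 * pi * \<xi> / s * y))"
  have iF: "integrable lborel F"
    unfolding F_def
    by (rule Bochner_Integration.integrable_bound[OF integrable_normal_density[of 1 0]]) auto
  have "char std_normal_distribution (2 * pi * \<xi> / s) = (\<integral>y. F y \<partial>lborel)"
    unfolding char_def F_def by (subst integral_density) (auto simp: normal_density_nonneg)
  then have vF: "(\<integral>y. F y \<partial>lborel) = complex_of_real (exp (- (2 * pi * \<xi> / s)\<^sup>2 / 2))"
    by (simp add: char_std_normal_distribution)
  have eq: "exp (complex_of_real (- pi * a * t\<^sup>2) + 2 * pi * \<i> * complex_of_real (\<xi> * t))
      = complex_of_real (sqrt (2 * pi)) * F (0 + s * t)" for t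
  proof -
    have "(s * t)\<^sup>2 / 2 = pi * a * t\<^sup>2" using s by (simp add: power_mult_distrib)
    moreover have "2 * pi * \<xi> / s * (s * t) = 2 * pi * (\<xi> * t)" using s by simp
    ultimately show ?thesis
      unfolding F_def normal_density_def exp_add exp_of_real
      by (simp add: scaleR_conv_of_real mult_ac)
  qed
  show "integrable lborel ?f"
    unfolding eq using lborel_integrable_real_affine[OF iF, of s 0] s by (intro integrable_mult_right) auto
  have "(\<integral>y. F y \<partial>lborel) = s *\<^sub>R (\<integral>t. F (0 + s * t) \<partial>lborel)"
    using lborel_integral_real_affine[of s F 0] s by simp
  then have "(\<integral>t. F (0 + s * t) \<partial>lborel) = complex_of_real (exp (- (2 * pi * \<xi> / s)\<^sup>2 / 2) / s)"
    using s vF by (simp add: scaleR_conv_of_real field_simps)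
  moreover have "(2 * pi * \<xi> / s)\<^sup>2 / 2 = pi * \<xi>\<^sup>2 / a"
    using s assms by (simp add: power_divide power_mult_distrib field_simps power2_eq_square)
  moreover have "sqrt (2 * pi) * (x / s) = x / sqrt a" for x
    using assms by (simp add: s_def real_sqrt_mult)
  ultimately show "integral\<^sup>L lborel ?f = ?r"
    unfolding eq by (simp flip: of_real_mult of_real_divide)
qed

text \<open>Both the quadratic form and the pairing are sums over coordinates, so the integrand is a
  product of one-dimensional ones.\<close>

lemma gaussian_fourier:
  fixes \<xi> :: "'a::euclidean_space" and a :: real
  assumes "a > 0"
  shows "integrable lborel (\<lambda>t::'a. exp (complex_of_real (- pi * a * (t \<bullet> t)) + 2 * pi * \<i> * complex_of_real (\<xi> \<bullet> t)))"
      (is "integrable lborel ?f")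
    and "(\<integral>t. exp (complex_of_real (- pi * a * (t \<bullet> t)) + 2 * pi * \<i> * complex_of_real (\<xi> \<bullet> t)) \<partial>lborel)
      = complex_of_real (exp (- pi * (\<xi> \<bullet> \<xi>) / a) / sqrt a ^ DIM('a))"
      (is "_ = ?r")
proof -
  let ?h = "\<lambda>b t. exp (complex_of_real (- pi * a * t\<^sup>2) + 2 * pi * \<i> * complex_of_real ((\<xi> \<bullet> b) * t))"
  have eq: "?f = (\<lambda>t. \<Prod>b\<in>Basis. ?h b (t \<bullet> b))"
  proof
    fix t :: 'a
    have "t \<bullet> t = (\<Sum>b\<in>Basis. (t \<bullet> b)\<^sup>2)" "\<xi> \<bullet> t = (\<Sum>b\<in>Basis. (\<xi> \<bullet> b) * (t \<bullet> b))"
      by (simp_all add: euclidean_inner[of t t] euclidean_inner[of \<xi> t] power2_eq_square)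
    then show "?f t = (\<Prod>b\<in>Basis. ?h b (t \<bullet> b))"
      by (simp add: exp_sum[symmetric] sum.distrib sum_distrib_left sum_negf sum_subtractf)
  qed
  note G = lborel_integral_prod_Basis[of ?h, OF gaussian_fourier_real(1)[OF assms]]
  show "integrable lborel ?f"
    unfolding eq by (rule G)
  have "(\<Prod>b\<in>(Basis::'a set). exp (- pi * (\<xi> \<bullet> b)\<^sup>2 / a) / sqrt a) = exp (- pi * (\<xi> \<bullet> \<xi>) / a) / sqrt a ^ DIM('a)"
  proof -
    have x: "\<xi> \<bullet> \<xi> = (\<Sum>b\<in>Basis. (\<xi> \<bullet> b)\<^sup>2)"
      by (simp add: euclidean_inner[of \<xi> \<xi>] power2_eq_square)
    show ?thesis
      unfolding x by (simp add: prod_dividef exp_sum[symmetric] sum_distrib_left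
        sum_divide_distrib sum_negf)
  qed
  then show "integral\<^sup>L lborel ?f = ?r"
    unfolding eq G(2) gaussian_fourier_real(2)[OF assms]
    by (simp only: of_real_prod[symmetric])
qed

lemma integrable_gaussian:
  fixes a :: real
  assumes "a > 0"
  shows "integrable lborel (\<lambda>t::'a::euclidean_space. exp (- a * (t \<bullet> t)))"
proof -
  have "integrable lborel (\<lambda>t::'a. norm (exp (complex_of_real (- pi * (a / pi) * (t \<bullet> t)) + 2 * pi * \<i> * complex_of_real (0 \<bullet> t))))"
    using assms by (intro integrable_norm gaussian_fourier) auto
  then show ?thesis by (simp add: norm_exp)
qed


lemma mem_centered_box: "norm x < r \<Longrightarrow> x \<in> box (- (r *\<^sub>R One)) (r *\<^sub>R (One :: 'a::euclidean_space))"
  unfolding mem_box using Basis_le_norm[of _ x] by (force simp: abs_less_iff)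

text \<open>Open boxes are stable under intersection and generate the Borel sets, so it remains to
  see that vanishing passes to complements and disjoint unions. Complements require the integral
  over the whole space, which is the limit over growing centred boxes.\<close>

lemma set_integral_eq_zero_if_boxes:
  fixes u :: "'a::euclidean_space \<Rightarrow> 'b::{second_countable_topology, banach}"
  assumes u: "integrable lborel u"
    and box: "\<And>a b. (LINT x|lborel. indicator (box a b) x *\<^sub>R u x) = 0"
    and A: "A \<in> sets borel"
  shows "(LINT x|lborel. indicator A x *\<^sub>R u x) = 0"
proof -
  let ?I = "\<lambda>A. LINT x|lborel. indicator A x *\<^sub>R u x"
  have int: "integrable lborel (\<lambda>x. indicator A x *\<^sub>R u x)" if "A \<in> sets borel" for A
    using that u by (intro integrable_mult_indicator) auto
  have univ: "?I UNIV = 0"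
  proof -
    define B where "B k = box (- (real k *\<^sub>R One)) (real k *\<^sub>R (One :: 'a))" for k :: nat
    have "(\<lambda>k. ?I (B k)) \<longlonglongrightarrow> ?I UNIV"
    proof (rule integral_dominated_convergence[where w = "\<lambda>x. norm (u x)"])
      show "AE x in lborel. (\<lambda>k. indicator (B k) x *\<^sub>R u x) \<longlonglongrightarrow> indicator UNIV x *\<^sub>R u x"
      proof (rule AE_I2)
        fix x :: 'a
        obtain N :: nat where N: "norm x < N" using reals_Archimedean2 by blast
        have "x \<in> B k" if "k \<ge> N" for k
          unfolding B_def using N that by (intro mem_centered_box) linarith
        then have "\<forall>\<^sub>F k in sequentially. indicator (B k) x *\<^sub>R u x = indicator UNIV x *\<^sub>R u x"
          unfolding eventually_sequentially by (intro exI[of _ N]) auto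
        then show "(\<lambda>k. indicator (B k) x *\<^sub>R u x) \<longlonglongrightarrow> indicator UNIV x *\<^sub>R u x"
          by (rule tendsto_eventually)
      qed
    qed (use u in \<open>auto simp: B_def split: split_indicator\<close>)
    moreover have "?I (B k) = 0" for k unfolding B_def by (rule box)
    ultimately have "(\<lambda>k. 0) \<longlonglongrightarrow> ?I UNIV" by simp
    then show ?thesis by (simp add: LIMSEQ_const_iff)
  qed
  have "Int_stable (range (\<lambda>(a, b). box a b :: 'a set))"
    by (auto simp: Int_stable_def box_Int_box)
  moreover have "range (\<lambda>(a, b). box a b :: 'a set) \<subseteq> Pow UNIV" by simp
  moreover have "A \<in> sigma_sets UNIV (range (\<lambda>(a, b). box a b :: 'a set))"
    using A by (simp add: borel_eq_box sets_measure_of)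
  ultimately show ?thesis
  proof (induct rule: sigma_sets_induct_disjoint)
    case (basic A)
    then show ?case using box by auto
  next
    case empty
    show ?case by simp
  next
    case (compl A)
    then have A: "A \<in> sets borel" by (simp add: borel_eq_box sets_measure_of)
    have "?I (UNIV - A) = (LINT x|lborel. u x - indicator A x *\<^sub>R u x)"
      by (intro Bochner_Integration.integral_cong) (auto split: split_indicator)
    also have "\<dots> = ?I UNIV - ?I A"
      using int[OF A] u by simp
    finally have "?I (UNIV - A) = ?I UNIV - ?I A" .
    then show ?case using univ compl by simp
  next
    case (union A)
    then have A: "A i \<in> sets borel" for i by (auto simp: borel_eq_box sets_measure_of)
    have "(LINT x:(\<Union>i. A i)|lborel. u x) = (\<Sum>i. LINT x:A i|lborel. u x)"
      using A u union(1) by (intro lebesgue_integral_countable_add)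
        (auto simp: disjoint_family_on_def set_integrable_def intro!: int)
    then show ?case using union by (simp add: set_lebesgue_integral_def)
  qed
qed


section \<open>Affine substitutions and product integrands\<close>

lemma lborel_integral_affine:
  fixes f :: "'a::euclidean_space \<Rightarrow> 'b::{banach, second_countable_topology}"
  assumes c: "c \<noteq> 0" and [measurable]: "f \<in> borel_measurable borel"
  shows "(LINT x|lborel. f x) = \<bar>c\<bar> ^ DIM('a) *\<^sub>R (LINT x|lborel. f (a + c *\<^sub>R x))"
  by (subst lborel_affine[OF c, of a]) (simp add: integral_density integral_distr)

lemma lborel_nn_integral_affine:
  fixes f :: "'a::euclidean_space \<Rightarrow> ennreal"
  assumes c: "c \<noteq> 0" and [measurable]: "f \<in> borel_measurable borel"
  shows "(\<integral>\<^sup>+x. f x \<partial>lborel) = ennreal (\<bar>c\<bar> ^ DIM('a)) * (\<integral>\<^sup>+x. f (a + c *\<^sub>R x) \<partial>lborel)"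
  by (subst lborel_affine[OF c, of a]) (simp add: nn_integral_density nn_integral_distr nn_integral_cmult)

lemma lborel_integrable_affine:
  fixes f :: "'a::euclidean_space \<Rightarrow> 'b::{banach, second_countable_topology}"
  assumes c: "c \<noteq> 0" and f: "integrable lborel f"
  shows "integrable lborel (\<lambda>x. f (a + c *\<^sub>R x))"
proof -
  have [measurable]: "f \<in> borel_measurable borel" using borel_measurable_integrable[OF f] by simp
  have "(\<integral>\<^sup>+x. norm (f x) \<partial>lborel) < \<infinity>" using f by (simp add: integrable_iff_bounded)
  then show ?thesis
    using c by (subst (asm) lborel_nn_integral_affine[OF c, of _ a])
      (auto simp: integrable_iff_bounded ennreal_mult_less_top)
qed

lemma (in pair_sigma_finite) integrable_pair_mult:
  fixes f :: "'a \<Rightarrow> 'c::{real_normed_algebra, banach, second_countable_topology}"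
  assumes f: "integrable M1 f" and g: "integrable M2 g"
  shows "integrable (M1 \<Otimes>\<^sub>M M2) (\<lambda>(x, y). f x * g y)"
proof -
  have [measurable]: "f \<in> borel_measurable M1" "g \<in> borel_measurable M2" using f g by auto
  have "integrable (M1 \<Otimes>\<^sub>M M2) (\<lambda>(x, y). norm (f x) * norm (g y))"
  proof (rule Fubini_integrable)
    show "integrable M1 (\<lambda>x. \<integral>y. norm (case (x, y) of (x, y) \<Rightarrow> norm (f x) * norm (g y)) \<partial>M2)"
      using f by simp
    show "AE x in M1. integrable M2 (\<lambda>y. case (x, y) of (x, y) \<Rightarrow> norm (f x) * norm (g y))"
      using g by simp
  qed simp
  then show ?thesis
    by (rule Bochner_Integration.integrable_bound) (auto simp: norm_mult_ineq)
qed

section \<open>Characters and Fourier inversion\<close>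

definition character :: "'a::euclidean_space \<Rightarrow> 'a \<Rightarrow> complex" where
  "character \<omega> t = exp (2 * pi * \<i> * complex_of_real (\<omega> \<bullet> t))"

lemma norm_character [simp]: "cmod (character \<omega> t) = 1"
  by (simp add: character_def)

lemma measurable_character [measurable]:
  "(\<lambda>x. character (f x) (g x)) \<in> borel_measurable M"
  if [measurable]: "f \<in> borel_measurable M" "g \<in> borel_measurable M"
proof -
  have [measurable]: "exp \<in> borel_measurable (borel :: complex measure)"
    by (intro borel_measurable_continuous_onI continuous_intros)
  show ?thesis unfolding character_def by measurable
qed

lemma measurable_cnj [measurable (raw)]:
  "f \<in> borel_measurable M \<Longrightarrow> (\<lambda>x. cnj (f x)) \<in> borel_measurable M"
  by (rule borel_measurable_continuous_on[of cnj f]) (auto intro: continuous_intros)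

lemma character_mult: "character \<omega> t * character \<omega> s = character \<omega> (t + s)"
  by (simp add: character_def exp_add[symmetric] distrib_left inner_add_right)

lemma character_commute: "character \<omega> t = character t \<omega>"
  by (simp add: character_def inner_commute)

lemma cnj_character_mult: "cnj (character \<omega> s) * character \<omega> t = character (t - s) \<omega>"
  unfolding character_def exp_cnj exp_add[symmetric]
  by (rule arg_cong[of _ _ exp]) (simp add: inner_diff_left inner_commute algebra_simps)

definition fourier :: "('a::euclidean_space \<Rightarrow> complex) \<Rightarrow> 'a \<Rightarrow> complex" where
  "fourier F \<omega> = (LINT t|lborel. cnj (character \<omega> t) * F t)"

text \<open>The Gaussian factor makes the integrand absolutely integrable in (\<omega>, s); without
  it the modulus is constant in \<omega>. After exchanging the integrals the inner one is the
  Fourier transform of a Gaussian, so the regularised inversion integral is \<open>F\<close>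
  convolved with an approximate identity.\<close>

lemma fourier_gaussian_regularised:
  fixes F :: "'a::euclidean_space \<Rightarrow> complex"
  assumes F: "integrable lborel F" and a: "a > 0"
  shows "(LINT \<omega>|lborel. fourier F \<omega> * complex_of_real (exp (- pi * a * (\<omega> \<bullet> \<omega>))) * character \<omega> t)
    = (LINT s|lborel. F s * complex_of_real (exp (- pi * ((t - s) \<bullet> (t - s)) / a) / sqrt a ^ DIM('a)))"
proof -
  let ?g = "\<lambda>\<omega>. complex_of_real (exp (- pi * a * (\<omega> \<bullet> \<omega>)))"
  have [measurable]: "F \<in> borel_measurable borel" using borel_measurable_integrable[OF F] by simp
  have g: "integrable lborel (\<lambda>\<omega>::'a. ?g \<omega>)"
    using integrable_gaussian[of "pi * a", where 'a='a] a by (intro integrable_of_real) (simp add: mult.assoc)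
  let ?h = "\<lambda>\<omega> s. cnj (character \<omega> s) * F s * ?g \<omega> * character \<omega> t"
  have "integrable (lborel \<Otimes>\<^sub>M lborel) (\<lambda>(\<omega> :: 'a, s). ?g \<omega> * F s)"
    by (rule lborel_pair.integrable_pair_mult[OF g F])
  then have int: "integrable (lborel \<Otimes>\<^sub>M lborel) (\<lambda>(\<omega> :: 'a, s). ?h \<omega> s)"
    by (rule Bochner_Integration.integrable_bound) (auto simp: norm_mult)
  have "(LINT \<omega>|lborel. fourier F \<omega> * ?g \<omega> * character \<omega> t) = (LINT \<omega>|lborel. LINT s|lborel. ?h \<omega> s)"
    unfolding fourier_def by (simp flip: integral_mult_left_zero add: mult.assoc)
  also have "\<dots> = (LINT s|lborel. LINT \<omega>|lborel. ?h \<omega> s)"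
    using lborel_pair.Fubini_integral[OF int] by simp
  also have "\<dots> = (LINT s|lborel. F s * complex_of_real (exp (- pi * ((t - s) \<bullet> (t - s)) / a) / sqrt a ^ DIM('a)))"
  proof (rule Bochner_Integration.integral_cong)
    fix s :: 'a
    have "?h \<omega> s = F s * exp (complex_of_real (- pi * a * (\<omega> \<bullet> \<omega>)) + 2 * pi * \<i> * complex_of_real ((t - s) \<bullet> \<omega>))" for \<omega>
      unfolding exp_add exp_of_real character_def[symmetric] cnj_character_mult[symmetric]
      by (simp add: mult_ac)
    then show "(LINT \<omega>|lborel. ?h \<omega> s) = F s * complex_of_real (exp (- pi * ((t - s) \<bullet> (t - s)) / a) / sqrt a ^ DIM('a))"
      by (simp only: integral_mult_right_zero gaussian_fourier(2)[OF a, of "t - s"])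
  qed simp
  finally show ?thesis .
qed


lemma AE_not_in_box_boundary: "AE x in lborel. x \<in> box a b \<or> x \<notin> cbox a (b::'a::euclidean_space)"
proof (rule AE_I)
  show "emeasure lborel (cbox a b - box a b) = 0"
    by (subst emeasure_Diff) (auto simp: emeasure_lborel_box_eq emeasure_lborel_cbox_eq box_subset_cbox)
qed auto

lemma integrable_indicator_box: "integrable lborel (indicat_real (box l (u::'a::euclidean_space)))"
  by (intro integrable_real_indicator) (auto simp: emeasure_lborel_box_eq)

text \<open>The regularised integrals \<open>J n\<close> have two limits: pointwise they tend to
  \<open>I\<close> by dominated convergence, since the transform is integrable; tested on boxes they
  tend to \<open>F\<close>, since they are convolutions with shrinking Gaussians. Weak convergence
  on boxes is enough to identify the two limits and avoids Lebesgue points.\<close>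

lemma fourier_inversion:
  fixes F :: "'a::euclidean_space \<Rightarrow> complex"
  assumes F: "integrable lborel F" and FF: "integrable lborel (fourier F)"
  shows "AE t in lborel. F t = (LINT \<omega>|lborel. fourier F \<omega> * character \<omega> t)"
proof -
  have [measurable]: "F \<in> borel_measurable borel" "fourier F \<in> borel_measurable borel"
    using borel_measurable_integrable[OF F] borel_measurable_integrable[OF FF] by simp_all
  \<comment> \<open>The square makes sqrt (\<open>a n\<close>) equal to 1/(n+1), the width of the
    n-th Gaussian kernel.\<close>
  define a where "a n = 1 / (real (Suc n))\<^sup>2" for n
  have a: "a n > 0" "sqrt (a n) = 1 / real (Suc n)" for n
    by (simp_all add: a_def real_sqrt_divide)
  have alim: "a \<longlonglongrightarrow> 0" unfolding a_def by real_asymp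
  let ?e = "\<lambda>t \<omega>. fourier F \<omega> * character \<omega> t"
  let ?d = "\<lambda>n t \<omega>. fourier F \<omega> * complex_of_real (exp (- pi * a n * (\<omega> \<bullet> \<omega>))) * character \<omega> t"
  define J where "J n t = (LINT \<omega>|lborel. ?d n t \<omega>)" for n t
  define I where "I t = (LINT \<omega>|lborel. ?e t \<omega>)" for t
  have [measurable]: "J n \<in> borel_measurable borel" "I \<in> borel_measurable borel" for n
    unfolding J_def[abs_def] I_def[abs_def] by measurable
  define L where "L = (LINT \<omega>|lborel. cmod (fourier F \<omega>))"
  have damped: "cmod (?d n t \<omega>) \<le> cmod (fourier F \<omega>)" for n \<omega> t
  proof -
    have "exp (- pi * a n * (\<omega> \<bullet> \<omega>)) \<le> 1" using a(1)[of n] by simp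
    then show ?thesis by (simp add: norm_mult mult_left_le)
  qed
  have Ib: "cmod (I t) \<le> L" for t
  proof -
    have "cmod (I t) \<le> (LINT \<omega>|lborel. cmod (?e t \<omega>))"
      unfolding I_def by (rule integral_norm_bound)
    then show ?thesis by (simp add: norm_mult L_def)
  qed
  have Jb: "cmod (J n t) \<le> L" for n t
  proof -
    have "cmod (J n t) \<le> (LINT \<omega>|lborel. cmod (?d n t \<omega>))"
      unfolding J_def by (rule integral_norm_bound)
    also have "\<dots> \<le> L"
      unfolding L_def by (rule integral_mono') (use FF damped in auto)
    finally show ?thesis .
  qed
  have Jlim: "(\<lambda>n. J n t) \<longlonglongrightarrow> I t" for t
    unfolding J_def I_def
  proof (rule integral_dominated_convergence[where w = "\<lambda>\<omega>. cmod (fourier F \<omega>)"])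
    show "AE \<omega> in lborel. (\<lambda>n. ?d n t \<omega>)
        \<longlonglongrightarrow> ?e t \<omega>"
    proof (rule AE_I2)
      fix \<omega> :: 'a
      have "(\<lambda>n. ?d n t \<omega>)
        \<longlonglongrightarrow> fourier F \<omega> * complex_of_real (exp (- pi * 0 * (\<omega> \<bullet> \<omega>))) * character \<omega> t"
        by (intro tendsto_intros alim)
      then show "(\<lambda>n. ?d n t \<omega>)
        \<longlonglongrightarrow> ?e t \<omega>" by simp
    qed
  qed (use FF damped in auto)
  define K where "K n x = exp (- pi * (x \<bullet> x) / a n) / sqrt (a n) ^ DIM('a)" for n and x :: 'a
  have [measurable]: "K n \<in> borel_measurable borel" for n unfolding K_def by measurable
  have Jeq: "J n t = (LINT s|lborel. F s * complex_of_real (K n (t - s)))" for n t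
    unfolding J_def K_def by (rule fourier_gaussian_regularised[OF F a(1)])
  define k where "k x = exp (- pi * (x \<bullet> x))" for x :: 'a
  have k: "integrable lborel k"
    unfolding k_def using integrable_gaussian[of pi] by simp
  have k1: "(LINT x|lborel. k x) = 1"
  proof -
    have "complex_of_real (LINT x|lborel. k x) = 1"
      using gaussian_fourier(2)[of 1 "0::'a"] unfolding k_def
      by (simp add: exp_of_real[symmetric] flip: integral_complex_of_real)
    then show ?thesis by simp
  qed
  have knn: "k x \<ge> 0" for x by (simp add: k_def)
  have [measurable]: "k \<in> borel_measurable borel" unfolding k_def by measurable
  \<comment> \<open>Fubini moves the convolution from \<open>F\<close> to the indicator of the box.
    The smoothed indicators \<open>A n\<close> are bounded by 1 and converge off the boundary of the
    box, which is a null set.\<close>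
  have main: "(LINT t|lborel. indicator (box l u) t *\<^sub>R I t) = (LINT t|lborel. indicator (box l u) t *\<^sub>R F t)" for l u :: 'a
  proof -
    let ?B = "box l u"
    have iB: "integrable lborel (indicat_real ?B)" by (rule integrable_indicator_box)
    let ?q = "\<lambda>n s x. indicat_real ?B (s + (1 / real (Suc n)) *\<^sub>R x) * k x"
    define A where "A n s = (LINT x|lborel. ?q n s x)" for n s
    have [measurable]: "A n \<in> borel_measurable borel" for n unfolding A_def by measurable
    have Ab: "\<bar>A n s\<bar> \<le> 1" for n s
    proof -
      have "\<bar>A n s\<bar> \<le> (LINT x|lborel. norm (?q n s x))"
        unfolding A_def real_norm_def[symmetric] by (rule integral_norm_bound)
      also have "\<dots> \<le> (LINT x|lborel. k x)"
        by (rule integral_mono') (use k knn in \<open>auto simp: abs_mult split: split_indicator\<close>)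
      finally show ?thesis using k1 by simp
    qed
    have Alim: "AE s in lborel. (\<lambda>n. A n s) \<longlonglongrightarrow> indicator ?B s"
      using AE_not_in_box_boundary[of l u]
    proof eventually_elim
      case (elim s)
      have "(\<lambda>n. A n s) \<longlonglongrightarrow> (LINT x|lborel. indicat_real ?B s * k x)"
        unfolding A_def
      proof (rule integral_dominated_convergence[where w = k])
        show "AE x in lborel. (\<lambda>n. ?q n s x) \<longlonglongrightarrow> indicat_real ?B s * k x"
        proof (rule AE_I2)
          fix x :: 'a
          have "(\<lambda>n. 1 / real (Suc n)) \<longlonglongrightarrow> 0" by real_asymp
          then have "(\<lambda>n. s + (1 / real (Suc n)) *\<^sub>R x) \<longlonglongrightarrow> s + 0 *\<^sub>R x"
            by (intro tendsto_intros)
          then have lim: "(\<lambda>n. s + (1 / real (Suc n)) *\<^sub>R x) \<longlonglongrightarrow> s" by simp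
          have "\<forall>\<^sub>F n in sequentially. indicat_real ?B (s + (1 / real (Suc n)) *\<^sub>R x) = indicat_real ?B s"
            using elim
          proof
            assume "s \<in> ?B"
            then have "\<forall>\<^sub>F n in sequentially. s + (1 / real (Suc n)) *\<^sub>R x \<in> ?B"
              using topological_tendstoD[OF lim open_box] by blast
            then show ?thesis by eventually_elim (use \<open>s \<in> ?B\<close> in simp)
          next
            assume s: "s \<notin> cbox l u"
            then have "\<forall>\<^sub>F n in sequentially. s + (1 / real (Suc n)) *\<^sub>R x \<in> - cbox l u"
              using topological_tendstoD[OF lim, of "- cbox l u"] closed_cbox by (auto simp: open_Compl)
            then show ?thesis by eventually_elim (use s box_subset_cbox[of l u] in \<open>auto simp: indicator_def\<close>)
          qed
          then show "(\<lambda>n. ?q n s x) \<longlonglongrightarrow> indicat_real ?B s * k x"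
            by (intro tendsto_mult tendsto_const tendsto_eventually)
        qed
      qed (use k knn in \<open>auto split: split_indicator\<close>)
      then show ?case using k1 by simp
    qed
    have JA: "(LINT t|lborel. indicator ?B t *\<^sub>R J n t) = (LINT s|lborel. F s * complex_of_real (A n s))" for n
    proof -
      \<comment> \<open>Substituting t = s + x/(n+1) replaces the narrow kernel by the fixed kernel
        \<open>k\<close> and moves the scale into the argument of the indicator.\<close>
      have KA: "(LINT t|lborel. indicat_real ?B t * K n (t - s)) = A n s" for s
      proof -
        have "K n (s + (1 / real (Suc n)) *\<^sub>R x - s) = real (Suc n) ^ DIM('a) * k x" for x
        proof -
          have "(1 / real (Suc n)) * (1 / real (Suc n)) / a n = 1"
            by (simp add: a_def power2_eq_square)
          then have "- pi * ((1 / real (Suc n)) *\<^sub>R x \<bullet> (1 / real (Suc n)) *\<^sub>R x) / a n = - pi * (x \<bullet> x)"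
            by (simp add: a_def power2_eq_square)
          then show ?thesis unfolding K_def k_def a(2) add_diff_cancel_left' by (simp add: power_divide del: of_nat_Suc)
        qed
        then show ?thesis
          unfolding A_def
          by (subst lborel_integral_affine[of "1 / real (Suc n)" _ s])
             (simp_all add: mult.left_commute[of _ "real (Suc n) ^ DIM('a)"] power_divide del: of_nat_Suc)
      qed
      let ?h = "\<lambda>t s. complex_of_real (indicator ?B t) * (F s * complex_of_real (K n (t - s)))"
      have "integrable (lborel \<Otimes>\<^sub>M lborel) (\<lambda>(t::'a, s). (complex_of_real (indicator ?B t * (1 / sqrt (a n) ^ DIM('a)))) * F s)"
        by (rule lborel_pair.integrable_pair_mult[OF _ F]) (intro integrable_of_real integrable_mult_left iB)
      then have int: "integrable (lborel \<Otimes>\<^sub>M lborel) (\<lambda>(t, s). ?h t s)"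
      proof (rule Bochner_Integration.integrable_bound)
        have "cmod (?h t s) \<le> cmod (complex_of_real (indicator ?B t * (1 / sqrt (a n) ^ DIM('a))) * F s)" for t s
        proof -
          have "exp (- pi * ((t - s) \<bullet> (t - s)) / a n) \<le> 1" using a(1)[of n] by (simp add: divide_nonpos_pos)
          then have "\<bar>K n (t - s)\<bar> \<le> 1 / sqrt (a n) ^ DIM('a)"
            unfolding K_def using a(1)[of n] by (simp add: divide_right_mono)
          then show ?thesis
            using a(1)[of n] by (auto simp: norm_mult norm_divide norm_power split: split_indicator intro: mult_right_mono)
              (metis mult.commute mult_right_mono norm_ge_zero times_divide_eq_left mult_1)
        qed
        then show "AE x in lborel \<Otimes>\<^sub>M lborel. cmod (case x of (t, s) \<Rightarrow> ?h t s)
          \<le> cmod (case x of (t, s) \<Rightarrow> complex_of_real (indicator ?B t * (1 / sqrt (a n) ^ DIM('a))) * F s)"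
          by auto
      qed measurable
      have "(LINT t|lborel. indicator ?B t *\<^sub>R J n t) = (LINT t|lborel. LINT s|lborel. ?h t s)"
        unfolding Jeq by (simp add: scaleR_conv_of_real)
      also have "\<dots> = (LINT s|lborel. LINT t|lborel. ?h t s)"
        using lborel_pair.Fubini_integral[OF int] by simp
      also have "\<dots> = (LINT s|lborel. F s * complex_of_real (A n s))"
      proof (rule Bochner_Integration.integral_cong)
        fix s :: 'a
        have "(LINT t|lborel. ?h t s) = (LINT t|lborel. F s * complex_of_real (indicat_real ?B t * K n (t - s)))"
          by (intro Bochner_Integration.integral_cong) (auto simp: mult_ac)
        then show "(LINT t|lborel. ?h t s) = F s * complex_of_real (A n s)"
          by (simp add: KA flip: of_real_mult)
      qed simp
      finally show ?thesis .
    qed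
    have "(\<lambda>n. LINT t|lborel. indicator ?B t *\<^sub>R J n t) \<longlonglongrightarrow> (LINT t|lborel. indicator ?B t *\<^sub>R I t)"
    proof (rule integral_dominated_convergence[where w = "\<lambda>t. indicator ?B t * L"])
      show "AE t in lborel. (\<lambda>n. indicator ?B t *\<^sub>R J n t) \<longlonglongrightarrow> indicator ?B t *\<^sub>R I t"
        by (intro AE_I2 tendsto_intros Jlim)
    qed (use Jb iB in \<open>auto split: split_indicator\<close>)
    moreover have "(\<lambda>n. LINT t|lborel. indicator ?B t *\<^sub>R J n t) \<longlonglongrightarrow> (LINT t|lborel. indicator ?B t *\<^sub>R F t)"
      unfolding JA
    proof (rule integral_dominated_convergence[where w = "\<lambda>t. cmod (F t)"])
      show "AE s in lborel. (\<lambda>n. F s * complex_of_real (A n s)) \<longlonglongrightarrow> indicat_real ?B s *\<^sub>R F s"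
        using Alim
      proof eventually_elim
        case (elim s)
        then have "(\<lambda>n. F s * complex_of_real (A n s)) \<longlonglongrightarrow> F s * complex_of_real (indicat_real ?B s)"
          by (intro tendsto_intros)
        then show ?case by (simp add: scaleR_conv_of_real mult.commute)
      qed
    qed (use F Ab in \<open>auto simp: norm_mult intro!: AE_I2 mult_left_le\<close>)
    ultimately show ?thesis by (rule LIMSEQ_unique)
  qed
  let ?D = "\<lambda>N. box (- (real N *\<^sub>R One)) (real N *\<^sub>R (One :: 'a))"
  \<comment> \<open>\<open>I\<close> is bounded but not known to be integrable, so the difference is
    cut off to a bounded box before it is compared with zero.\<close>
  have local: "AE t in lborel. indicat_real (?D N) t *\<^sub>R (F t - I t) = 0" for N :: nat
  proof (rule sigma_finite_measure.density_zero[OF sigma_finite_lborel])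
    have iD: "integrable lborel (\<lambda>t. indicat_real B t *\<^sub>R I t)" if "B = box l u" for B l u
    proof (rule Bochner_Integration.integrable_bound[where f = "\<lambda>t. indicator B t * L"])
      show "AE t in lborel. norm (indicat_real B t *\<^sub>R I t) \<le> norm (indicator B t * L)"
        using Ib by (auto split: split_indicator intro: order_trans[OF _ abs_ge_self])
    qed (use that integrable_indicator_box[of l u] in auto)
    have iF: "integrable lborel (\<lambda>t. indicat_real B t *\<^sub>R F t)" if "B = box l u" for B l u
      using F that by (intro integrable_mult_indicator) auto
    show int: "integrable lborel (\<lambda>t. indicat_real (?D N) t *\<^sub>R (F t - I t))"
      using iD iF by (simp add: scaleR_diff_right)
    fix A :: "'a set" assume A: "A \<in> sets lborel"
    show "(LINT t:A|lborel. indicat_real (?D N) t *\<^sub>R (F t - I t)) = 0"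
      unfolding set_lebesgue_integral_def
    proof (rule set_integral_eq_zero_if_boxes[OF int])
      fix l u :: 'a
      obtain l' u' where B: "box l u \<inter> ?D N = box l' u'" using box_Int_box by blast
      have "indicat_real (box l u) x *\<^sub>R indicat_real (?D N) x *\<^sub>R (F x - I x)
          = indicat_real (box l' u') x *\<^sub>R F x - indicat_real (box l' u') x *\<^sub>R I x" for x
        by (simp add: B[symmetric] indicator_inter_arith algebra_simps)
      then show "(LINT x|lborel. indicat_real (box l u) x *\<^sub>R indicat_real (?D N) x *\<^sub>R (F x - I x)) = 0"
        using iD iF main by simp
    qed (use A in simp)
  qed
  have "AE t in lborel. \<forall>N::nat. indicat_real (?D N) t *\<^sub>R (F t - I t) = 0"
    using local by (subst AE_all_countable) blast
  then show ?thesis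
  proof eventually_elim
    case (elim t)
    obtain N :: nat where N: "norm t < N" using reals_Archimedean2 by blast
    then have "t \<in> ?D N" by (rule mem_centered_box)
    then show ?case using elim[rule_format, of N] by (simp add: I_def)
  qed
qed

section \<open>The Hilbert space and time-frequency shifts\<close>

lemma sq_integrable_rep: "sq_integrable (rep_L2 f)"
  and abs_rep_L2: "abs_L2 (rep_L2 f) = f"
  using Quotient3_rep_reflp[OF Quotient3_L2, of f] Quotient3_abs_rep[OF Quotient3_L2, of f]
  by (simp_all add: sq_integrable_eq_def)

lemma sq_integrable_eq_refl: "sq_integrable f \<Longrightarrow> sq_integrable_eq f f"
  by (simp add: sq_integrable_eq_def)

lemma measurable_rep_L2 [measurable]: "rep_L2 f \<in> borel_measurable borel"
  using sq_integrable_rep[of f] by (simp add: sq_integrable_def)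

lemma rep_abs_L2_AE: "sq_integrable f \<Longrightarrow> AE t in lborel. rep_L2 (abs_L2 f) t = f t"
  using Quotient3_rep_abs[OF Quotient3_L2, of f] by (simp add: sq_integrable_eq_def)

lemma cinner_rep: "cinner f g = (LINT t|lborel. rep_L2 f t * cnj (rep_L2 g t))"
  using cinner.abs_eq[of "rep_L2 f" "rep_L2 g"]
  by (simp add: abs_rep_L2 sq_integrable_eq_refl sq_integrable_rep)

lemma cinner_abs_right:
  assumes "sq_integrable g"
  shows "cinner f (abs_L2 g) = (LINT t|lborel. rep_L2 f t * cnj (g t))"
  using cinner.abs_eq[of "rep_L2 f" g] assms
  by (simp add: abs_rep_L2 sq_integrable_eq_refl sq_integrable_rep)

lemma cscale_add_right: "cscale c (f + g) = cscale c f + cscale c g"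
  by transfer (auto simp: sq_integrable_eq_def distrib_left intro!: sq_integrable_add sq_integrable_cmult)

lemma cscale_add_left: "cscale (c + d) f = cscale c f + cscale d f"
  by transfer (auto simp: sq_integrable_eq_def distrib_right intro!: sq_integrable_add sq_integrable_cmult)

lemma cscale_cscale [simp]: "cscale c (cscale d f) = cscale (c * d) f"
  by transfer (auto simp: sq_integrable_eq_def mult.assoc intro!: sq_integrable_cmult)

lemma cscale_one [simp]: "cscale 1 f = f"
  by transfer (simp add: sq_integrable_eq_def)

lemma cscale_zero_left [simp]: "cscale 0 f = 0"
  using scaleR_L2_def[of 0 f] by simp

lemma cscale_zero_right [simp]: "cscale c 0 = 0"
  using cscale_add_right[of c 0 0] by simp

lemma scaleR_cscale: "r *\<^sub>R f = cscale (complex_of_real r) f" for f :: "'n::finite L2"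
  by (rule scaleR_L2_def)

lemma cscale_uminus: "cscale c (- f) = - cscale c f"
  by (simp add: uminus_L2_def mult.commute)

lemma cscale_diff_right: "cscale c (f - g) = cscale c f - cscale c g"
  using cscale_add_right[of c f "- g"] by (simp add: cscale_uminus)

lemma cinner_cscale_right [simp]: "cinner f (cscale c g) = cnj c * cinner f g"
  by (metis cinner_commute cinner_cscale_left complex_cnj_cnj complex_cnj_mult)

lemma cinner_uminus_left: "cinner (- f) g = - cinner f g"
  by (simp add: uminus_L2_def cinner_cscale_left)

lemma cinner_diff_left: "cinner (f - g) h = cinner f h - cinner g h"
  using cinner_add_left[of f "- g" h] by (simp add: cinner_uminus_left)

lemma cinner_diff_right: "cinner f (g - h) = cinner f g - cinner f h"
  by (metis cinner_diff_left cinner_commute complex_cnj_diff)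

lemma norm_L2_squared: "cinner f f = complex_of_real ((norm f)\<^sup>2)"
  using cinner_self[of f] Re_cinner_self_nonneg[of f] by (simp add: norm_L2_def)

lemma norm_cscale [simp]: "norm (cscale c f) = cmod c * norm f"
proof -
  have "cinner (cscale c f) (cscale c f) = c * cnj c * cinner f f"
    by (simp add: cinner_cscale_left mult_ac)
  then have "complex_of_real ((norm (cscale c f))\<^sup>2) = complex_of_real ((cmod c * norm f)\<^sup>2)"
    unfolding norm_L2_squared complex_norm_square[symmetric] by (simp add: power_mult_distrib)
  then have "(norm (cscale c f))\<^sup>2 = (cmod c * norm f)\<^sup>2" by (simp only: of_real_eq_iff)
  then show ?thesis by (simp add: power2_eq_iff_nonneg)
qed

text \<open>The real inner product only sees the real part; rotating \<open>f\<close> by the phase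
  \<open>u\<close> makes \<open>cinner f g\<close> real and nonnegative, and the real Cauchy-Schwarz
  inequality applies.\<close>

lemma cmod_cinner_le: "cmod (cinner f g) \<le> norm f * norm g"
proof (cases "cinner f g = 0")
  case False
  define u where "u = cnj (cinner f g) / cmod (cinner f g)"
  have "cmod u = 1" using False by (simp add: u_def norm_divide)
  have "u * cinner f g = cmod (cinner f g)"
    using False by (simp add: u_def field_simps complex_norm_square[symmetric] power2_eq_square)
  then have "cmod (cinner f g) = inner (cscale u f) g"
    by (simp add: inner_L2_def cinner_cscale_left)
  also have "\<dots> \<le> norm (cscale u f) * norm g" by (rule norm_cauchy_schwarz)
  finally show ?thesis using \<open>cmod u = 1\<close> by simp
qed simp

lemma cinner_eqI: "(\<And>g. cinner g f = cinner g f') \<Longrightarrow> f = f'"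
  using Re_cinner_self_eq_0[of "f - f'"] by (simp add: cinner_diff_right)

lemma bounded_linear_cinner_left: "bounded_linear (\<lambda>f. cinner f g)"
  by (rule bounded_linear_intro[of _ "norm g"])
    (auto simp: cinner_add_left scaleR_cscale cinner_cscale_left cmod_cinner_le scaleR_conv_of_real)

lemma bounded_linear_cscale: "bounded_linear (cscale c)"
  by (rule bounded_linear_intro[of _ "cmod c"])
    (auto simp: cscale_add_right scaleR_cscale mult.commute)

text \<open>Distances in the quotient type become integrals over the chosen representatives, so that
  the completeness proof can work with functions pointwise.\<close>

lemma nn_integral_rep_diff:
  "(\<integral>\<^sup>+t. ennreal ((cmod (rep_L2 f t - rep_L2 g t))\<^sup>2) \<partial>lborel) = ennreal ((norm (f - g))\<^sup>2)"
proof -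
  have sq: "sq_integrable (\<lambda>t. rep_L2 f t - rep_L2 g t)"
    using sq_integrable_add[OF sq_integrable_rep sq_integrable_cmult[OF sq_integrable_rep, of "-1"], of f g] by simp
  have "f - g = abs_L2 (\<lambda>t. rep_L2 f t + (- 1) * rep_L2 g t)"
    unfolding minus_L2_def uminus_L2_def
    using plus_L2.abs_eq[of "rep_L2 f" "\<lambda>t. (-1) * rep_L2 g t"] cscale.abs_eq[of "rep_L2 g" "-1"]
      sq_integrable_cmult[OF sq_integrable_rep, of "-1" g]
    by (simp add: abs_rep_L2 sq_integrable_eq_refl sq_integrable_rep)
  then have "f - g = abs_L2 (\<lambda>t. rep_L2 f t - rep_L2 g t)" by simp
  then have "cinner (f - g) (f - g) = (LINT t|lborel. (rep_L2 f t - rep_L2 g t) * cnj (rep_L2 f t - rep_L2 g t))"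
    using cinner.abs_eq[OF sq_integrable_eq_refl sq_integrable_eq_refl, OF sq sq] by simp
  also have "\<dots> = complex_of_real (LINT t|lborel. (cmod (rep_L2 f t - rep_L2 g t))\<^sup>2)"
    by (simp only: complex_norm_square[symmetric] of_real_power[symmetric] integral_complex_of_real)
  finally have "(norm (f - g))\<^sup>2 = (LINT t|lborel. (cmod (rep_L2 f t - rep_L2 g t))\<^sup>2)"
    by (simp only: norm_L2_squared of_real_eq_iff)
  then show ?thesis
    using sq by (simp add: nn_integral_eq_integral sq_integrable_def)
qed

lemma ennreal_suminf_single_le: "f k \<le> (\<Sum>k. f k :: ennreal)"
  using sum_le_suminf[of f "{k}"] by (simp add: summableI)

text \<open>Riesz--Fischer: along a subsequence with \<open>\<parallel>Y (k+1) - Y k\<parallel> \<le> 2^-k\<close> the weighted sum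
  \<open>W = \<Sum>k. 2^k |Y (k+1) - Y k|\<^sup>2\<close> is integrable, and it dominates the tails pointwise.\<close>

instance L2 :: (finite) banach
proof
  fix X :: "nat \<Rightarrow> 'a L2"
  assume "Cauchy X"
  then have "\<exists>N. \<forall>m\<ge>N. \<forall>n\<ge>N. norm (X m - X n) < (1/2) ^ k" for k
    by (auto simp: Cauchy_def dist_norm)
  then obtain N where N: "\<And>k m n. m \<ge> N k \<Longrightarrow> n \<ge> N k \<Longrightarrow> norm (X m - X n) < (1/2) ^ k"
    by metis
  \<comment> \<open>The sum of all \<open>N i\<close> up to k keeps \<open>r k\<close> above
    \<open>N k\<close>, and the summand k makes it strictly increasing.\<close>
  define r where "r k = k + (\<Sum>i\<le>k. N i)" for k
  have r: "strict_mono r" by (rule strict_mono_Suc_iff[THEN iffD2]) (simp add: r_def)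
  have rN: "N k \<le> r k" for k
    by (simp add: r_def trans_le_add2 member_le_sum)
  define Y where "Y k = X (r k)" for k
  have YY: "norm (Y (Suc k) - Y k) < (1/2) ^ k" for k
    unfolding Y_def using strict_mono_leD[OF r, of k "Suc k"] rN[of k] by (intro N) auto
  define x where "x k = rep_L2 (Y k)" for k
  have [measurable]: "x k \<in> borel_measurable borel" for k by (simp add: x_def)
  let ?u = "\<lambda>k t. cmod (x (Suc k) t - x k t)"
  let ?w = "\<lambda>k t. ennreal (2 ^ k * (?u k t)\<^sup>2)"
  define W where "W t = (\<Sum>k. ?w k t)" for t
  have [measurable]: "W \<in> borel_measurable borel" unfolding W_def by measurable
  have "(\<integral>\<^sup>+t. W t \<partial>lborel) = (\<Sum>k. \<integral>\<^sup>+t. ?w k t \<partial>lborel)"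
    unfolding W_def by (rule nn_integral_suminf) measurable
  also have "\<dots> \<le> (\<Sum>k. ennreal ((1/2) ^ k))"
  proof (rule suminf_le)
    fix k
    have "(\<integral>\<^sup>+t. ?w k t \<partial>lborel) = ennreal (2 ^ k) * ennreal ((norm (Y (Suc k) - Y k))\<^sup>2)"
      unfolding nn_integral_rep_diff[symmetric] x_def
      by (simp add: ennreal_mult nn_integral_cmult)
    also have "\<dots> \<le> ennreal (2 ^ k) * ennreal (((1/2) ^ k)\<^sup>2)"
      using YY[of k] by (intro mult_left_mono ennreal_leI power_mono) auto
    also have "\<dots> = ennreal ((1/2) ^ k)"
      by (simp add: ennreal_mult[symmetric] power2_eq_square power_divide)
    finally show "(\<integral>\<^sup>+t. ?w k t \<partial>lborel) \<le> ennreal ((1/2) ^ k)" .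
  qed auto
  also have "\<dots> < \<infinity>"
    by (subst suminf_ennreal2) (auto simp: less_top[symmetric])
  finally have Wint: "(\<integral>\<^sup>+t. W t \<partial>lborel) < \<infinity>" .
  then have "AE t in lborel. W t \<noteq> \<infinity>" by (intro nn_integral_PInf_AE) auto
  then have Wfin: "AE t in lborel. W t < \<infinity>" by (simp add: less_top)
  \<comment> \<open>\<open>q ^ k\<close> is the square root of 2^-k, the rate at which the pointwise
    differences decay once \<open>W t\<close> is finite.\<close>
  define q :: real where "q = 1 / sqrt 2"
  have "q\<^sup>2 = 1 / 2" by (simp add: q_def power_divide)
  then have "(q ^ k)\<^sup>2 = (1/2) ^ k" for k
    by (metis power_mult mult.commute)
  moreover have "0 < q" "q < 1" by (auto simp: q_def)
  ultimately have q: "0 < q" "q < 1" "(q ^ k)\<^sup>2 = (1/2) ^ k" for k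
    by auto
  define g where "g t = lim (\<lambda>k. x k t)" for t
  have [measurable]: "g \<in> borel_measurable borel" unfolding g_def by measurable
  have tail: "AE t in lborel. \<forall>k. (cmod (x k t - g t))\<^sup>2 \<le> enn2real (W t) * (1 / (1 - q))\<^sup>2 * (1/2) ^ k"
    using Wfin
  proof eventually_elim
    case (elim t)
    define w where "w = enn2real (W t)"
    have w: "w \<ge> 0" "W t = ennreal w" using elim by (auto simp: w_def)
    have step: "?u k t \<le> sqrt w * q ^ k" for k
    proof -
      have "?w k t \<le> W t"
        unfolding W_def by (rule ennreal_suminf_single_le)
      then have "2 ^ k * (?u k t)\<^sup>2 \<le> w"
        using w(1) unfolding w(2) by (simp only: ennreal_le_iff)
      then have "(?u k t)\<^sup>2 \<le> w * (1/2) ^ k"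
        by (simp add: power_one_over field_simps)
      also have "\<dots> = (sqrt w * q ^ k)\<^sup>2"
        using w by (simp only: power_mult_distrib q(3) real_sqrt_pow2)
      finally show ?thesis
        by (rule power2_le_imp_le) (use w(1) q(1) in simp)
    qed
    have S: "summable (\<lambda>k. sqrt w * q ^ k)" using q by (intro summable_mult summable_geometric) auto
    then have S': "summable (\<lambda>k. x (Suc k) t - x k t)"
      by (rule summable_comparison_test'[of _ 0]) (use step in auto)
    have part: "(\<Sum>j<m. x (Suc (j + k)) t - x (j + k) t) = x (m + k) t - x k t" for m k
      using sum_lessThan_telescope[of "\<lambda>j. x (j + k) t" m] by simp
    have "(\<lambda>m. (\<Sum>j<m. x (Suc j) t - x j t) + x 0 t) \<longlonglongrightarrow> (\<Sum>j. x (Suc j) t - x j t) + x 0 t"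
      using S' by (intro tendsto_intros summable_LIMSEQ)
    moreover have "(\<Sum>j<m. x (Suc j) t - x j t) + x 0 t = x m t" for m using part[of 0 m] by simp
    ultimately have "convergent (\<lambda>m. x m t)" by (auto simp: convergent_def)
    then have lim: "(\<lambda>m. x m t) \<longlonglongrightarrow> g t" unfolding g_def by (simp add: convergent_LIMSEQ_iff)
    show ?case
    proof
      fix k
      have "cmod (x (m + k) t - x k t) \<le> sqrt w * q ^ k * (1 / (1 - q))" for m
      proof -
        have "cmod (x (m + k) t - x k t) \<le> (\<Sum>j<m. cmod (x (Suc (j + k)) t - x (j + k) t))"
          unfolding part[symmetric] by (rule norm_sum)
        also have "\<dots> \<le> (\<Sum>j<m. sqrt w * q ^ k * q ^ j)"
          using step[of "_ + k"] by (intro sum_mono) (simp only: power_add mult_ac)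
        also have "\<dots> = sqrt w * q ^ k * (\<Sum>j<m. q ^ j)" by (simp add: sum_distrib_left)
        also have "\<dots> \<le> sqrt w * q ^ k * (\<Sum>j. q ^ j)"
          by (intro mult_left_mono sum_le_suminf summable_geometric) (use w(1) q(1,2) in auto)
        finally show ?thesis using q by (simp add: suminf_geometric)
      qed
      moreover have "(\<lambda>m. cmod (x (m + k) t - x k t)) \<longlonglongrightarrow> cmod (g t - x k t)"
        using LIMSEQ_ignore_initial_segment[OF lim, of k] by (intro tendsto_intros)
      ultimately have "cmod (g t - x k t) \<le> sqrt w * q ^ k * (1 / (1 - q))"
        by (intro LIMSEQ_le_const2) auto
      then have "(cmod (g t - x k t))\<^sup>2 \<le> (sqrt w * q ^ k * (1 / (1 - q)))\<^sup>2"
        by (intro power_mono) auto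
      then show "(cmod (x k t - g t))\<^sup>2 \<le> enn2real (W t) * (1 / (1 - q))\<^sup>2 * (1/2) ^ k"
        unfolding w_def[symmetric] power_mult_distrib q(3) using w by (simp add: norm_minus_commute mult_ac)
    qed
  qed
  define C where "C = (1 / (1 - q))\<^sup>2"
  have "(\<integral>\<^sup>+t. ennreal (enn2real (W t)) \<partial>lborel) = (\<integral>\<^sup>+t. W t \<partial>lborel)"
    using Wfin by (intro nn_integral_cong_AE) (auto simp: less_top)
  then have Wi: "integrable lborel (\<lambda>t. enn2real (W t))"
    using Wint by (intro integrableI_nonneg) auto
  have sqd: "sq_integrable (\<lambda>t. x k t - g t)" for k
    unfolding sq_integrable_def
  proof
    show "integrable lborel (\<lambda>t. (cmod (x k t - g t))\<^sup>2)"
      by (rule Bochner_Integration.integrable_bound[where f = "\<lambda>t. enn2real (W t) * C * (1/2) ^ k"])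
        (use Wi tail in \<open>auto simp: C_def elim!: eventually_mono\<close>)
  qed simp
  \<comment> \<open>Square integrability of \<open>g\<close> itself comes from writing g = x 0 - (x
    0 - g).\<close>
  have "sq_integrable (\<lambda>t. x 0 t + (- 1) * (x 0 t - g t))"
    by (intro sq_integrable_add sq_integrable_cmult sqd) (simp add: x_def sq_integrable_rep)
  then have g: "sq_integrable g" by simp
  define M where "M = (LINT t|lborel. enn2real (W t)) * C"
  have bound: "(norm (Y k - abs_L2 g))\<^sup>2 \<le> M * (1/2) ^ k" for k
  proof -
    have "ennreal ((norm (Y k - abs_L2 g))\<^sup>2) = (\<integral>\<^sup>+t. ennreal ((cmod (x k t - g t))\<^sup>2) \<partial>lborel)"
      unfolding nn_integral_rep_diff[symmetric] x_def
      using rep_abs_L2_AE[OF g] by (intro nn_integral_cong_AE) auto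
    also have "\<dots> \<le> (\<integral>\<^sup>+t. ennreal (enn2real (W t) * C * (1/2) ^ k) \<partial>lborel)"
      using tail by (intro nn_integral_mono_AE) (auto simp: C_def elim!: eventually_mono intro!: ennreal_leI)
    also have "\<dots> = ennreal (M * (1/2) ^ k)"
      unfolding M_def using Wi by (subst nn_integral_eq_integral) (auto simp: C_def)
    finally show ?thesis by (subst (asm) ennreal_le_iff) (auto simp: M_def C_def)
  qed
  have "(\<lambda>k. (norm (Y k - abs_L2 g))\<^sup>2) \<longlonglongrightarrow> 0"
  proof (rule tendsto_sandwich[OF _ _ tendsto_const])
    have "(\<lambda>k. M * (1/2) ^ k) \<longlonglongrightarrow> M * 0"
      by (intro tendsto_intros LIMSEQ_power_zero) auto
    then show "(\<lambda>k. M * (1/2) ^ k) \<longlonglongrightarrow> 0" by simp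
  qed (use bound in auto)
  then have "(\<lambda>k. sqrt ((norm (Y k - abs_L2 g))\<^sup>2)) \<longlonglongrightarrow> sqrt 0"
    by (intro tendsto_intros)
  then have "Y \<longlonglongrightarrow> abs_L2 g"
    by (simp add: tendsto_norm_zero_iff LIM_zero_iff)
  then have "(X \<circ> r) \<longlonglongrightarrow> abs_L2 g"
    by (simp add: Y_def[abs_def] comp_def)
  then show "convergent X"
    using Cauchy_converges_subseq[OF \<open>Cauchy X\<close> r] by (auto simp: convergent_def)
qed

section \<open>Time-frequency shifts as unitary operators with a cocycle\<close>

lemma bounded_linear_tf_intro: "(\<And>f g. T (f + g) = T f + T g) \<Longrightarrow> (\<And>c f. T (cscale c f) = cscale c (T f)) \<Longrightarrow>
    (\<And>f. norm (T f) = norm f) \<Longrightarrow> bounded_linear (T :: 'n::finite L2 \<Rightarrow> 'n L2)"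
  by (rule bounded_linear_intro[of _ 1]) (auto simp: scaleR_cscale)

lemma tf_shift_abs:
  assumes "sq_integrable f"
  shows "sq_integrable (\<lambda>t. character \<omega> t * f (t - x))"
    and "tf_shift (x, \<omega>) (abs_L2 f) = abs_L2 (\<lambda>t. character \<omega> t * f (t - x))"
  using sq_integrable_modulate[OF sq_integrable_translate[OF assms, of x], of \<omega>]
    translation.abs_eq[OF sq_integrable_eq_refl[OF assms], of x]
    modulation.abs_eq[OF sq_integrable_eq_refl[OF sq_integrable_translate[OF assms, of x]], of \<omega>]
  by (simp_all add: tf_shift_def character_def)

lemma L2_cases: obtains f' where "sq_integrable f'" "f = abs_L2 f'"
  using sq_integrable_rep abs_rep_L2 by metis

lemma abs_L2_add: "sq_integrable f \<Longrightarrow> sq_integrable g \<Longrightarrow> abs_L2 f + abs_L2 g = abs_L2 (\<lambda>t. f t + g t)"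
  and abs_L2_cscale: "sq_integrable f \<Longrightarrow> cscale c (abs_L2 f) = abs_L2 (\<lambda>t. c * f t)"
  and abs_L2_cinner: "sq_integrable f \<Longrightarrow> sq_integrable g \<Longrightarrow> cinner (abs_L2 f) (abs_L2 g) = (LINT t|lborel. f t * cnj (g t))"
  by (simp_all add: plus_L2.abs_eq cscale.abs_eq cinner.abs_eq sq_integrable_eq_refl)

lemma tf_shift_add: "tf_shift X (f + g) = tf_shift X f + tf_shift X g"
proof (cases X)
  case (Pair x \<omega>)
  obtain f' g' where "sq_integrable f'" "f = abs_L2 f'" "sq_integrable g'" "g = abs_L2 g'"
    by (metis L2_cases)
  then show ?thesis
    unfolding Pair by (simp add: abs_L2_add tf_shift_abs sq_integrable_add distrib_left)
qed

lemma tf_shift_cscale: "tf_shift X (cscale c f) = cscale c (tf_shift X f)"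
proof (cases X)
  case (Pair x \<omega>)
  obtain f' where "sq_integrable f'" "f = abs_L2 f'"
    by (metis L2_cases)
  then show ?thesis
    unfolding Pair by (simp add: abs_L2_cscale tf_shift_abs sq_integrable_cmult mult.left_commute)
qed

lemma lborel_integral_translate:
  fixes f :: "'a::euclidean_space \<Rightarrow> 'b::{banach, second_countable_topology}"
  assumes "f \<in> borel_measurable borel"
  shows "(LINT t|lborel. f (t - x)) = (LINT t|lborel. f t)"
  using lborel_integral_affine[OF _ assms, of 1 "- x"] by (simp add: algebra_simps)

lemma cinner_tf_shift [simp]: "cinner (tf_shift X f) (tf_shift X g) = cinner f g"
proof (cases X)
  case (Pair x \<omega>)
  obtain f' g' where fg: "sq_integrable f'" "f = abs_L2 f'" "sq_integrable g'" "g = abs_L2 g'"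
    by (metis L2_cases)
  then have [measurable]: "f' \<in> borel_measurable borel" "g' \<in> borel_measurable borel"
    by (simp_all add: sq_integrable_def)
  have c: "character \<omega> t * u * cnj (character \<omega> t * v) = u * cnj v" for t :: "real^'a" and u v
    using complex_norm_square[of "character \<omega> t"] by (simp add: mult_ac)
  then show ?thesis
    using fg lborel_integral_translate[of "\<lambda>t. f' t * cnj (g' t)" x]
    unfolding Pair by (simp add: tf_shift_abs abs_L2_cinner c del: complex_cnj_mult)
qed

lemma norm_tf_shift [simp]: "norm (tf_shift X f) = norm f"
  by (simp add: norm_L2_def)

lemma bounded_linear_tf_shift: "bounded_linear (tf_shift X)"
  by (rule bounded_linear_tf_intro) (simp_all add: tf_shift_add tf_shift_cscale)

lemma tf_shift_zero [simp]: "tf_shift 0 f = f"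
proof -
  obtain f' where "sq_integrable f'" "f = abs_L2 f'" by (metis L2_cases)
  then show ?thesis
    by (simp add: zero_prod_def tf_shift_abs) (simp add: character_def)
qed

text \<open>The value of the cocycle in closed form: exp(-2 \<pi> \<i> \<eta> \<bullet> x) for X =
  (x, \<omega>) and Y = (y, \<eta>). It is multiplicative in each argument, which yields the cocycle
  identities; \<open>cocycle\<close> itself is given by a definite description, identified in
  \<open>cocycle_eq_beta\<close>.\<close>

definition beta :: "'n::finite phase_space \<Rightarrow> 'n phase_space \<Rightarrow> complex" where
  "beta X Y = character (- snd Y) (fst X)"

lemma norm_beta [simp]: "cmod (beta X Y) = 1"
  by (simp add: beta_def)

lemma beta_cnj_mult [simp]: "beta X Y * cnj (beta X Y) = 1" "cnj (beta X Y) * beta X Y = 1"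
  using complex_norm_square[of "beta X Y"] by (simp_all add: mult.commute)

lemma beta_add_left: "beta (X + Y) Z = beta X Z * beta Y Z"
  by (simp add: beta_def character_mult)

lemma beta_add_right: "beta X (Y + Z) = beta X Y * beta X Z"
  by (simp add: beta_def character_commute[of _ "fst X"] character_mult)

lemma beta_zero [simp]: "beta 0 X = 1" "beta X 0 = 1"
  by (simp_all add: beta_def character_def)

lemma tf_shift_tf_shift: "tf_shift X (tf_shift Y f) = cscale (beta X Y) (tf_shift (X + Y) f)"
proof -
  obtain x \<omega> where X: "X = (x, \<omega>)" by (cases X)
  obtain y \<eta> where Y: "Y = (y, \<eta>)" by (cases Y)
  obtain f' where f: "sq_integrable f'" "f = abs_L2 f'" by (metis L2_cases)
  have c: "character \<omega> t * character \<eta> (t - x) = character (- \<eta>) x * character (\<omega> + \<eta>) t" for t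
    unfolding character_def exp_add[symmetric]
    by (rule arg_cong[of _ _ exp]) (simp add: inner_diff_right inner_add_left algebra_simps)
  show ?thesis
    unfolding X Y f(2) beta_def
    using f(1) by (simp add: tf_shift_abs abs_L2_cscale mult.assoc[symmetric] c diff_diff_eq)
qed

lemma gaussian_nonzero: "gaussian \<noteq> (0 :: 'n::finite L2)"
proof
  assume "gaussian = (0 :: 'n L2)"
  then have "AE x :: real^'n in lborel. complex_of_real (2 powr (- real CARD('n) / 4) * exp (- pi * (x \<bullet> x))) = 0"
    by transfer (simp add: sq_integrable_eq_def)
  then have "AE x :: real^'n in lborel. False" by (auto elim: eventually_mono)
  then have "emeasure (lborel :: (real^'n) measure) UNIV = 0"
    by (simp add: AE_iff_measurable[OF _ refl])
  then show False by (simp add: emeasure_lborel_UNIV)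
qed

lemma cscale_cancel: "cscale c f = cscale d f \<Longrightarrow> f \<noteq> 0 \<Longrightarrow> c = d"
  by (metis cscale_add_left[of "c - d" d f] add_diff_cancel_right' diff_add_cancel norm_cscale norm_eq_zero mult_eq_0_iff
      right_minus_eq add_cancel_left_left)

lemma tf_shift_gaussian_nonzero: "tf_shift X gaussian \<noteq> 0"
  using norm_tf_shift[of X gaussian] gaussian_nonzero by (metis norm_eq_zero)

text \<open>Uniqueness of the scalar needs one vector that no shift annihilates; the Gaussian
  serves.\<close>

lemma cocycle_eq_beta: "cocycle X Y = beta X Y"
  unfolding cocycle_def
proof (rule the_equality)
  fix c assume "\<forall>f. tf_shift X (tf_shift Y f) = cscale c (tf_shift (X + Y) f)"
  then have "cscale (beta X Y) (tf_shift (X + Y) gaussian) = cscale c (tf_shift (X + Y) gaussian)"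
    by (simp add: tf_shift_tf_shift)
  then show "c = beta X Y"
    using cscale_cancel tf_shift_gaussian_nonzero by blast
qed (simp add: tf_shift_tf_shift)

text \<open>Shifts are unitary, so the adjoint is the inverse; \<pi>(X) \<pi>(-X) is the scalar
  \<open>beta X (- X)\<close>, whose conjugate is its reciprocal.\<close>

lemma cadjoint_tf_shift: "cadjoint (tf_shift X) = (\<lambda>g. cscale (cnj (beta X (- X))) (tf_shift (- X) g))"
  unfolding cadjoint_def
proof (rule the_equality)
  have adj: "cinner (tf_shift X f) g = cinner f (cscale (cnj (beta X (- X))) (tf_shift (- X) g))" for f g
  proof -
    have "cinner f (cscale (cnj (beta X (- X))) (tf_shift (- X) g))
        = cinner (tf_shift X f) (tf_shift X (cscale (cnj (beta X (- X))) (tf_shift (- X) g)))"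
      by simp
    then show ?thesis by (simp add: tf_shift_cscale tf_shift_tf_shift)
  qed
  then show "\<forall>f g. cinner (tf_shift X f) g = cinner f (cscale (cnj (beta X (- X))) (tf_shift (- X) g))"
    by blast
  fix S assume "\<forall>f g. cinner (tf_shift X f) g = cinner f (S g)"
  then show "S = (\<lambda>g. cscale (cnj (beta X (- X))) (tf_shift (- X) g))"
    by (intro ext cinner_eqI) (metis adj)
qed

section \<open>Lattices\<close>

text \<open>The set \<open>V n\<close> of points within distance n of \<open>\<Lambda>\<close> is
  open and invariant under \<open>\<Lambda>\<close>, so its image in the quotient is open. These
  images increase and cover the quotient, and compactness selects finitely many.\<close>

lemma cocompact_imp_relatively_dense:
  fixes \<Lambda> :: "'a::euclidean_space set"
  assumes zero: "0 \<in> \<Lambda>" and add: "\<And>x y. x \<in> \<Lambda> \<Longrightarrow> y \<in> \<Lambda> \<Longrightarrow> x + y \<in> \<Lambda>"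
    and "cocompact \<Lambda>"
  obtains R where "R > 0" "\<And>z. \<exists>l\<in>\<Lambda>. dist z l < R"
proof -
  let ?Q = "quotient_space \<Lambda>"
  define V where "V n = {x. \<exists>l\<in>\<Lambda>. dist x l < real n}" for n
  have pre: "add_coset \<Lambda> -` (add_coset \<Lambda> ` V n) = V n" for n
  proof (intro equalityI subsetI)
    fix y assume "y \<in> add_coset \<Lambda> -` (add_coset \<Lambda> ` V n)"
    then obtain x where x: "x \<in> V n" "add_coset \<Lambda> y = add_coset \<Lambda> x" by auto
    have "y \<in> add_coset \<Lambda> y" using zero by (auto simp: add_coset_def)
    then obtain l where l: "l \<in> \<Lambda>" "y = x + l" unfolding x(2) by (auto simp: add_coset_def)
    from x obtain l' where "l' \<in> \<Lambda>" "dist x l' < real n" by (auto simp: V_def)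
    then show "y \<in> V n" using l add[of l' l] by (auto simp: V_def dist_norm intro!: bexI[of _ "l' + l"])
  qed auto
  have "V n = (\<Union>l\<in>\<Lambda>. ball l (real n))" for n
    by (auto simp: V_def dist_commute)
  then have "open (V n)" for n by (metis open_UN open_ball)
  then have "openin ?Q (add_coset \<Lambda> ` V n)" for n
    unfolding openin_quotient_space pre by auto
  moreover have "topspace ?Q \<subseteq> \<Union> (range (\<lambda>n. add_coset \<Lambda> ` V n))"
  proof
    fix c assume "c \<in> topspace ?Q"
    then obtain z where c: "c = add_coset \<Lambda> z"
      using openin_subset openin_quotient_space[of \<Lambda> "topspace ?Q"] openin_topspace by blast
    obtain n :: nat where "norm z < n" using reals_Archimedean2 by blast
    then have "z \<in> V n" using zero by (auto simp: V_def intro!: bexI[of _ 0])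
    then show "c \<in> \<Union> (range (\<lambda>n. add_coset \<Lambda> ` V n))" using c by blast
  qed
  ultimately obtain F where "finite F" "F \<subseteq> range (\<lambda>n. add_coset \<Lambda> ` V n)" "topspace ?Q \<subseteq> \<Union>F"
    using assms(3) unfolding cocompact_def compact_space_alt by (metis (mono_tags, lifting) rangeE)
  then obtain I where I: "finite I" "topspace ?Q \<subseteq> (\<Union>n\<in>I. add_coset \<Lambda> ` V n)"
    by (metis finite_subset_image)
  show ?thesis
  proof
    show "real (Suc (Max (insert 0 I))) > 0" by simp
    fix z
    have "add_coset \<Lambda> -` range (add_coset \<Lambda>) = UNIV" by auto
    then have "openin ?Q (range (add_coset \<Lambda>))"
      by (simp add: openin_quotient_space)
    then have "add_coset \<Lambda> z \<in> topspace ?Q" using openin_subset by blast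
    then obtain n where n: "n \<in> I" "z \<in> V n" using I(2) pre by blast
    then have "n < Suc (Max (insert 0 I))" using I(1) by (simp add: le_imp_less_Suc)
    then show "\<exists>l\<in>\<Lambda>. dist z l < real (Suc (Max (insert 0 I)))"
      using n(2) by (force simp: V_def)
  qed
qed

section \<open>Discrete subgroups: dual points and fundamental domains\<close>

locale subgroup_set =
  fixes \<Lambda> :: "'a::euclidean_space set"
  assumes zero_mem: "0 \<in> \<Lambda>"
    and add_mem: "x \<in> \<Lambda> \<Longrightarrow> y \<in> \<Lambda> \<Longrightarrow> x + y \<in> \<Lambda>"
    and uminus_mem: "x \<in> \<Lambda> \<Longrightarrow> - x \<in> \<Lambda>"
begin

lemma diff_mem: "x \<in> \<Lambda> \<Longrightarrow> y \<in> \<Lambda> \<Longrightarrow> x - y \<in> \<Lambda>"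
  using add_mem[of x "- y"] uminus_mem by simp

lemma scale_nat_mem: "x \<in> \<Lambda> \<Longrightarrow> real n *\<^sub>R x \<in> \<Lambda>"
  by (induct n) (auto simp: zero_mem add_mem scaleR_left_distrib)

lemma scale_int_mem: "x \<in> \<Lambda> \<Longrightarrow> of_int n *\<^sub>R x \<in> \<Lambda>"
  using scale_nat_mem[of x "nat n"] uminus_mem[OF scale_nat_mem[of x "nat (- n)"]]
  by (cases "n \<ge> 0") auto

lemma sum_mem: "(\<And>i. i \<in> I \<Longrightarrow> f i \<in> \<Lambda>) \<Longrightarrow> sum f I \<in> \<Lambda>"
  by (induct I rule: infinite_finite_induct) (auto simp: zero_mem add_mem)

lemma uniform_discrete_if_separated:
  assumes "e > 0" "\<And>x. x \<in> \<Lambda> \<Longrightarrow> norm x < e \<Longrightarrow> x = 0"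
  shows "uniform_discrete \<Lambda>"
  unfolding uniform_discrete_def dist_norm
  using assms(1) assms(2)[OF diff_mem] by (intro exI[of _ e]) (meson eq_iff_diff_eq_0)

text \<open>A discrete cocompact subgroup contains a basis \<open>B\<close> of the space and, by the pigeonhole
  principle, is contained in \<open>(1/N) \<int>B\<close> for some \<open>N\<close>; so its dual contains \<open>N\<close> times the
  lattice dual to \<open>\<int>B\<close>.\<close>

lemma dual_relatively_dense:
  assumes e: "e > 0" "\<And>x. x \<in> \<Lambda> \<Longrightarrow> norm x < e \<Longrightarrow> x = 0"
    and R: "\<And>z. \<exists>l\<in>\<Lambda>. dist z l < R"
  obtains R' where "R' \<ge> 0" "\<And>z. \<exists>y. (\<forall>l\<in>\<Lambda>. l \<bullet> y \<in> \<int>) \<and> dist z y \<le> R'"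
proof -
  \<comment> \<open>If \<open>\<Lambda>\<close> lay in a hyperplane with normal \<open>a\<close>,
    the point at height R above it in direction \<open>a\<close> would be at distance at least R
    from every lattice point.\<close>
  have "span \<Lambda> = UNIV"
  proof (rule ccontr)
    assume "span \<Lambda> \<noteq> UNIV"
    then obtain a where a: "a \<noteq> 0" "span \<Lambda> \<subseteq> {x. a \<bullet> x = 0}"
      using span_not_univ_subset_hyperplane by blast
    obtain l where l: "l \<in> \<Lambda>" "dist ((R / norm a) *\<^sub>R a) l < R" using R by blast
    have "a \<bullet> l = 0" using a(2) l(1) span_base by blast
    then have "(a \<bullet> ((R / norm a) *\<^sub>R a - l)) = R * norm a"
      using a(1) by (simp add: inner_diff_right power2_norm_eq_inner[symmetric] power2_eq_square)
    moreover have "\<bar>a \<bullet> ((R / norm a) *\<^sub>R a - l)\<bar> \<le> norm a * norm ((R / norm a) *\<^sub>R a - l)"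
      by (rule Cauchy_Schwarz_ineq2)
    ultimately have "norm a * R \<le> norm a * norm ((R / norm a) *\<^sub>R a - l)"
      by (simp add: mult.commute)
    then show False using l(2) a(1) by (simp add: dist_norm)
  qed
  obtain B where B: "B \<subseteq> \<Lambda>" "independent B" "\<Lambda> \<subseteq> span B"
    using maximal_independent_subset by blast
  have fB: "finite B" using B(2) by (rule independent_imp_finite)
  have sB: "span B = UNIV"
    using \<open>span \<Lambda> = UNIV\<close> span_mono[OF B(3)] by (simp add: span_span top.extremum_unique)
  define r where "r b v = representation B v b" for b v
  have lin: "linear (r b)" for b
    unfolding r_def using B(2) sB
    by (intro linearI) (auto simp: representation_add representation_scale)
  have expand: "v = (\<Sum>b\<in>B. r b v *\<^sub>R b)" for v
    unfolding r_def using sum_representation_eq[OF B(2), of v B] fB sB by simp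
  \<comment> \<open>The vectors representing the coordinate functionals; they form the basis dual to
    \<open>B\<close>.\<close>
  define d where "d b = (\<Sum>i\<in>Basis. r b i *\<^sub>R i)" for b
  have rd: "r b v = v \<bullet> d b" for b v
  proof -
    have "r b v = r b (\<Sum>i\<in>Basis. (v \<bullet> i) *\<^sub>R i)" by (simp add: euclidean_representation)
    also have "\<dots> = (\<Sum>i\<in>Basis. (v \<bullet> i) * r b i)"
      by (simp add: linear_sum[OF lin] linear_scale[OF lin])
    finally show ?thesis by (simp add: d_def inner_sum_right mult.commute)
  qed
  have dual: "c \<bullet> d b = (if b = c then 1 else 0)" if "c \<in> B" for b c
    using representation_basis[OF B(2) that] by (simp add: rd[symmetric] r_def)
  define P where "P = {v. \<forall>b\<in>B. 0 \<le> r b v \<and> r b v < 1}"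
  have "bounded P"
  proof (rule boundedI)
    fix v assume v: "v \<in> P"
    have "norm v \<le> (\<Sum>b\<in>B. norm (r b v *\<^sub>R b))"
      by (subst expand) (rule norm_sum)
    also have "\<dots> \<le> (\<Sum>b\<in>B. norm b)"
      using v by (intro sum_mono) (auto simp: P_def mult_left_le_one_le)
    finally show "norm v \<le> (\<Sum>b\<in>B. norm b)" .
  qed
  moreover have "uniform_discrete \<Lambda>" using e by (rule uniform_discrete_if_separated)
  ultimately have fin: "finite (\<Lambda> \<inter> P)"
    using uniform_discrete_finite_iff[of "\<Lambda> \<inter> P"]
    by (meson Int_lower1 Int_lower2 bounded_subset inf_le1 subset_iff uniform_discrete_def)
  \<comment> \<open>The factorial is divisible by every difference k' - k that the pigeonhole step
    can produce, so one \<open>N\<close> serves all lattice points and all coordinates.\<close>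
  define N :: nat where "N = fact (card (\<Lambda> \<inter> P))"
  have N: "real N * r b l \<in> \<int>" if "l \<in> \<Lambda>" "b \<in> B" for l b
  proof -
    \<comment> \<open>The multiple k l reduced modulo \<open>B\<close> to the half-open cell
      \<open>P\<close>. It stays in \<open>\<Lambda>\<close>, and
      \<open>\<Lambda> \<inter> P\<close> is finite, so two of the multiples with k from 0 up to the
      cardinality of that set have the same reduction.\<close>
    define f where "f k = real k *\<^sub>R l - (\<Sum>c\<in>B. of_int \<lfloor>real k * r c l\<rfloor> *\<^sub>R c)" for k :: nat
    have rf: "r b (f k) = frac (real k * r b l)" if "b \<in> B" for k b
    proof -
      have "r b (f k) = real k * r b l - (\<Sum>c\<in>B. of_int \<lfloor>real k * r c l\<rfloor> * (c \<bullet> d b))"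
        by (simp add: f_def rd inner_diff_left inner_sum_left)
      also have "(\<Sum>c\<in>B. of_int \<lfloor>real k * r c l\<rfloor> * (c \<bullet> d b)) = (\<Sum>c\<in>B. if b = c then of_int \<lfloor>real k * r c l\<rfloor> else 0)"
        by (intro sum.cong) (auto simp: dual)
      finally show ?thesis using that fB by (simp add: frac_def)
    qed
    have "f k \<in> \<Lambda> \<inter> P" for k
      using \<open>l \<in> \<Lambda>\<close> B(1) unfolding f_def[of k]
      by (auto simp: P_def rf[unfolded f_def] frac_lt_1 intro!: diff_mem scale_nat_mem sum_mem scale_int_mem)
    then have "f ` {..card (\<Lambda> \<inter> P)} \<subseteq> \<Lambda> \<inter> P" by auto
    then have "card (f ` {..card (\<Lambda> \<inter> P)}) \<le> card (\<Lambda> \<inter> P)"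
      using fin by (intro card_mono)
    then have "\<not> inj_on f {..card (\<Lambda> \<inter> P)}"
      using pigeonhole[of f "{..card (\<Lambda> \<inter> P)}"] by auto
    then obtain k k' where k: "k < k'" "k' \<le> card (\<Lambda> \<inter> P)" "f k = f k'"
      unfolding inj_on_def by (metis atMost_iff linorder_neqE_nat)
    have "frac (real k * r b l) = frac (real k' * r b l)" using rf[OF that(2)] k(3) by metis
    then have "real k' * r b l - real k * r b l = of_int (\<lfloor>real k' * r b l\<rfloor> - \<lfloor>real k * r b l\<rfloor>)"
      by (simp add: frac_def)
    then have *: "real (k' - k) * r b l \<in> \<int>" using k(1) by (metis Ints_of_int left_diff_distrib of_nat_diff less_imp_le)
    have "k' - k dvd N" unfolding N_def using k by (intro dvd_fact) auto
    then obtain m where "N = (k' - k) * m" by (auto simp: dvd_def)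
    then have "real N * r b l = real m * (real (k' - k) * r b l)" by simp
    then show ?thesis using * by (metis Ints_mult Ints_of_nat)
  qed
  have Npos: "real N > 0" by (simp add: N_def)
  show ?thesis
  proof
    show "(\<Sum>b\<in>B. real N * norm (d b)) \<ge> 0" by (intro sum_nonneg) auto
    fix z :: 'a
    \<comment> \<open>The remainder of z \<bullet> b modulo \<open>N\<close>. Subtracting these
      multiples of the dual vectors makes b \<bullet> y a multiple of \<open>N\<close> for every b
      in \<open>B\<close>, which clears the denominators of the lattice coordinates.\<close>
    define c where "c b = z \<bullet> b - real N * of_int \<lfloor>(z \<bullet> b) / real N\<rfloor>" for b
    define y where "y = z - (\<Sum>b\<in>B. c b *\<^sub>R d b)"
    have yb: "b \<bullet> y = real N * of_int \<lfloor>(z \<bullet> b) / real N\<rfloor>" if "b \<in> B" for b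
    proof -
      have "(\<Sum>b'\<in>B. c b' * (b \<bullet> d b')) = (\<Sum>b'\<in>B. if b' = b then c b' else 0)"
        using dual[OF that] by (intro sum.cong) auto
      then have "b \<bullet> y = b \<bullet> z - c b"
        using that fB by (simp add: y_def inner_diff_right inner_sum_right)
      then show ?thesis by (simp add: c_def inner_commute)
    qed
    have "l \<bullet> y \<in> \<int>" if "l \<in> \<Lambda>" for l
    proof -
      have "l \<bullet> y = (\<Sum>b\<in>B. r b l * (b \<bullet> y))"
        by (subst expand[of l]) (simp add: inner_sum_left)
      also have "\<dots> = (\<Sum>b\<in>B. (real N * r b l) * of_int \<lfloor>(z \<bullet> b) / real N\<rfloor>)"
        by (intro sum.cong) (auto simp: yb)
      also have "\<dots> \<in> \<int>" by (intro Ints_sum Ints_mult N that) auto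
      finally show ?thesis .
    qed
    moreover have "dist z y \<le> (\<Sum>b\<in>B. real N * norm (d b))"
    proof -
      have "\<bar>c b\<bar> \<le> real N" for b
      proof -
        have "c b = real N * frac ((z \<bullet> b) / real N)"
          using Npos by (simp add: c_def frac_def right_diff_distrib)
        then show ?thesis
          using Npos frac_lt_1[of "(z \<bullet> b) / real N"] frac_ge_0[of "(z \<bullet> b) / real N"]
          by (simp add: abs_mult mult_left_le)
      qed
      then have "norm (\<Sum>b\<in>B. c b *\<^sub>R d b) \<le> (\<Sum>b\<in>B. real N * norm (d b))"
        by (intro sum_norm_le) (simp add: mult_right_mono)
      then show ?thesis by (simp add: y_def dist_norm)
    qed
    ultimately show "\<exists>y. (\<forall>l\<in>\<Lambda>. l \<bullet> y \<in> \<int>) \<and> dist z y \<le> (\<Sum>b\<in>B. real N * norm (d b))" by blast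
  qed
qed

text \<open>The fundamental domains are built from a finite cover of a compact set of representatives by
  balls too small to meet their own nonzero translates.\<close>

lemma rounding_cells:
  assumes e: "e > 0" "\<And>x. x \<in> \<Lambda> \<Longrightarrow> norm x < e \<Longrightarrow> x = 0"
    and R: "\<And>z. \<exists>l\<in>\<Lambda>. dist z l \<le> R" and \<delta>: "\<delta> > 0"
  obtains n :: nat and X :: "nat \<Rightarrow> 'a" and D :: "nat \<Rightarrow> 'a set"
  where "\<And>i. D i \<in> sets borel" "\<And>i. D i \<subseteq> ball (X i) \<delta>"
    "\<And>z. \<exists>i<n. \<exists>l\<in>\<Lambda>. z - l \<in> D i"
    "\<And>z i j l m. \<lbrakk>l \<in> \<Lambda>; m \<in> \<Lambda>; z - l \<in> D i; z - m \<in> D j\<rbrakk> \<Longrightarrow> i = j \<and> l = m"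
proof -
  \<comment> \<open>Radius at most e/2 keeps two points of one ball closer than e, so a ball never
    contains two points that differ by a nonzero lattice vector.\<close>
  define \<delta>' where "\<delta>' = min \<delta> (e / 2)"
  have \<delta>': "\<delta>' > 0" "\<delta>' \<le> \<delta>" "2 * \<delta>' \<le> e" using e(1) \<delta> by (auto simp: \<delta>'_def)
  have "compact (cball (0::'a) R)" by simp
  then obtain T where T: "finite T" "cball (0::'a) R \<subseteq> (\<Union>x\<in>T. ball x \<delta>')"
  proof (rule compactE_image[of _ UNIV "\<lambda>x. ball x \<delta>'"])
    show "cball 0 R \<subseteq> (\<Union>x\<in>UNIV. ball x \<delta>')" using \<delta>'(1) by (meson UNIV_I UN_I centre_in_ball subsetI)
  qed (auto intro: that)
  obtain xs where xs: "set xs = T" using finite_list[OF T(1)] by blast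
  define n where "n = length xs"
  define X where "X i = xs ! i" for i
  define B where "B i = ball (X i) \<delta>'" for i
  \<comment> \<open>From each ball all lattice translates of the earlier balls are removed, so every
    orbit survives only in the first ball that it meets.\<close>
  define D where "D i = B i - (\<Union>j<i. \<Union>l\<in>\<Lambda>. (\<lambda>z. z - l) -` B j)" for i
  have cov: "\<exists>i<n. z \<in> B i" if "z \<in> cball 0 R" for z
  proof -
    obtain x where "x \<in> set xs" "z \<in> ball x \<delta>'" using T(2) \<open>z \<in> cball 0 R\<close> xs by blast
    then show ?thesis unfolding B_def X_def n_def by (auto simp: in_set_conv_nth)
  qed
  show ?thesis
  proof
    show "D i \<in> sets borel" for i
    proof -
      have "open ((\<lambda>z. z - l) -` B j)" for l j
        unfolding B_def by (intro open_vimage open_ball continuous_intros)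
      then show ?thesis unfolding D_def B_def by (intro sets.Diff borel_open open_UN ballI) auto
    qed
    show "D i \<subseteq> ball (X i) \<delta>" for i
      using \<delta>'(2) by (auto simp: D_def B_def)
    show "\<exists>i<n. \<exists>l\<in>\<Lambda>. z - l \<in> D i" for z
    proof -
      obtain l0 where l0: "l0 \<in> \<Lambda>" "dist z l0 \<le> R" using R by blast
      then obtain i0 where i0: "i0 < n" "z - l0 \<in> B i0" using cov[of "z - l0"] by (auto simp: dist_norm norm_minus_commute)
      define i where "i = (LEAST i. \<exists>l\<in>\<Lambda>. z - l \<in> B i)"
      have ex: "\<exists>l\<in>\<Lambda>. z - l \<in> B i" unfolding i_def by (rule LeastI_ex) (use l0 i0 in blast)
      then obtain l where l: "l \<in> \<Lambda>" "z - l \<in> B i" by blast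
      have "i \<le> i0" unfolding i_def by (rule Least_le) (use l0 i0 in blast)
      moreover have "z - l \<in> D i"
      proof -
        have "z - l - m \<notin> B j" if "j < i" "m \<in> \<Lambda>" for j m
          using not_less_Least[of j "\<lambda>i. \<exists>l\<in>\<Lambda>. z - l \<in> B i"] that add_mem[OF l(1) that(2)]
          by (auto simp: i_def diff_diff_eq)
        then show ?thesis using l(2) by (auto simp: D_def)
      qed
      ultimately show ?thesis using l(1) i0(1) by (meson le_less_trans)
    qed
    fix z i j l m assume lm: "l \<in> \<Lambda>" "m \<in> \<Lambda>" and z: "z - l \<in> D i" "z - m \<in> D j"
    have no: False if "i < j" "z - l \<in> D i" "z - m \<in> D j" "l \<in> \<Lambda>" "m \<in> \<Lambda>" for i j l m
    proof -
      have "z - m - (l - m) \<in> B i" using that(2) by (simp add: D_def)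
      moreover have "l - m \<in> \<Lambda>" using that diff_mem by blast
      ultimately show False using that(1,3) unfolding D_def by blast
    qed
    then have "i = j" using lm z by (metis linorder_neqE_nat)
    moreover have "l = m"
    proof -
      have "dist (X i) (z - l) < \<delta>'" "dist (X i) (z - m) < \<delta>'"
        using z \<open>i = j\<close> by (auto simp: D_def B_def)
      then have "dist (z - l) (z - m) < e" using \<delta>'(3) dist_triangle_less_add[of "z - l" "X i" \<delta>' "z - m" \<delta>']
        by (simp add: dist_commute)
      then have "norm (l - m) < e" by (simp add: dist_norm norm_minus_commute)
      then show ?thesis using e(2)[OF diff_mem[OF lm]] by simp
    qed
    ultimately show "i = j \<and> l = m" by simp
  qed
qed

end

section \<open>The adjoint lattice as a dual lattice for the symplectic form\<close>

definition symp :: "'n::finite phase_space \<Rightarrow> 'n phase_space" where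
  "symp X = (snd X, - fst X)"

lemma symp_linear: "linear symp"
  by (intro linearI) (auto simp: symp_def)

lemma norm_symp [simp]: "norm (symp X) = norm X"
  by (simp add: symp_def norm_prod_def add.commute)

lemma character_eq_iff: "character \<omega> t = character \<eta> s \<longleftrightarrow> \<omega> \<bullet> t - \<eta> \<bullet> s \<in> \<int>"
proof -
  have "2 * complex_of_real pi * \<i> * of_real a = 2 * complex_of_real pi * \<i> * of_real b + complex_of_real (of_int (2 * n) * pi) * \<i>
      \<longleftrightarrow> a = b + of_int n" for a b and n :: int
  proof -
    have "2 * complex_of_real pi * \<i> * of_real b + complex_of_real (of_int (2 * n) * pi) * \<i>
        = 2 * complex_of_real pi * \<i> * of_real (b + of_int n)"
      by (simp add: algebra_simps)
    moreover have "2 * complex_of_real pi * \<i> \<noteq> 0" by simp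
    ultimately show ?thesis by (metis mult_left_cancel of_real_eq_iff)
  qed
  then have "character \<omega> t = character \<eta> s \<longleftrightarrow> (\<exists>n::int. \<omega> \<bullet> t = \<eta> \<bullet> s + of_int n)"
    unfolding character_def exp_eq by auto
  also have "\<dots> \<longleftrightarrow> \<omega> \<bullet> t - \<eta> \<bullet> s \<in> \<int>"
    by (auto simp: Ints_def algebra_simps)
  finally show ?thesis .
qed

text \<open>Both orders of composition are scalar multiples of \<pi>(X + Y), so commuting means
  \<open>beta X Y = beta Y X\<close>. With X = (x, \<omega>) and Y = (y, \<eta>), X \<bullet> symp Y
  is the symplectic form x \<bullet> \<eta> - \<omega> \<bullet> y; up to the isometry
  \<open>symp\<close> the adjoint lattice is therefore the dual lattice.\<close>

lemma mem_adjoint_lattice_iff: "Y \<in> adjoint_lattice \<Lambda> \<longleftrightarrow> (\<forall>X\<in>\<Lambda>. X \<bullet> symp Y \<in> \<int>)"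
proof -
  have "tf_shift X \<circ> tf_shift Y = tf_shift Y \<circ> tf_shift X \<longleftrightarrow> X \<bullet> symp Y \<in> \<int>" for X
  proof -
    have "tf_shift X \<circ> tf_shift Y = tf_shift Y \<circ> tf_shift X \<longleftrightarrow> beta X Y = beta Y X"
    proof
      assume "tf_shift X \<circ> tf_shift Y = tf_shift Y \<circ> tf_shift X"
      then have "tf_shift X (tf_shift Y gaussian) = tf_shift Y (tf_shift X gaussian)"
        by (metis comp_apply)
      then show "beta X Y = beta Y X"
        using cscale_cancel tf_shift_gaussian_nonzero by (metis tf_shift_tf_shift add.commute)
    qed (auto simp: fun_eq_iff tf_shift_tf_shift add.commute)
    also have "\<dots> \<longleftrightarrow> X \<bullet> symp Y \<in> \<int>"
    proof -
      have eq: "X \<bullet> symp Y = snd Y \<bullet> fst X - snd X \<bullet> fst Y"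
        by (simp add: symp_def inner_prod_def inner_commute)
      have "beta X Y = beta Y X \<longleftrightarrow> (- snd Y) \<bullet> fst X - (- snd X) \<bullet> fst Y \<in> \<int>"
        unfolding beta_def by (rule character_eq_iff)
      also have "\<dots> \<longleftrightarrow> X \<bullet> symp Y \<in> \<int>"
        using Ints_minus[of "X \<bullet> symp Y"] Ints_minus[of "- (X \<bullet> symp Y)"] by (auto simp: eq)
      finally show ?thesis .
    qed
    finally show ?thesis .
  qed
  then show ?thesis by (simp add: adjoint_lattice_def)
qed

lemma adjoint_lattice_subgroup: "subgroup_set (adjoint_lattice \<Lambda>)"
proof -
  note l = linear_0[OF symp_linear] linear_add[OF symp_linear] linear_neg[OF symp_linear]
  show ?thesis
    by standard (auto simp: mem_adjoint_lattice_iff l inner_add_right)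
qed

text \<open>Duality exchanges the two properties: relative density of \<open>\<Lambda>\<close>
  separates the points of the adjoint lattice, and separation of \<open>\<Lambda>\<close> makes the
  adjoint lattice relatively dense.\<close>

lemma adjoint_lattice_geometry:
  assumes "tf_lattice \<Lambda>"
  obtains e R where "e > 0" "\<And>Y. Y \<in> adjoint_lattice \<Lambda> \<Longrightarrow> norm Y < e \<Longrightarrow> Y = 0"
    "\<And>z. \<exists>Y\<in>adjoint_lattice \<Lambda>. dist z Y \<le> R"
proof -
  interpret subgroup_set \<Lambda> using assms by unfold_locales (auto simp: tf_lattice_def)
  obtain R where R: "R > 0" "\<And>z. \<exists>l\<in>\<Lambda>. dist z l < R"
    using cocompact_imp_relatively_dense[of \<Lambda>] assms unfolding tf_lattice_def by metis
  obtain e where e: "e > 0" "\<And>y. y \<in> \<Lambda> \<Longrightarrow> norm y < e \<Longrightarrow> y = 0"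
    using assms zero_mem unfolding tf_lattice_def
    by (metis discreteD dist_0_norm isolated_inE_dist)
  obtain R' where R': "\<And>z. \<exists>y. (\<forall>l\<in>\<Lambda>. l \<bullet> y \<in> \<int>) \<and> dist z y \<le> R'"
    using dual_relatively_dense[OF e R(2)] by metis
  show ?thesis
  proof
    show "1 / (2 * R) > 0" using R(1) by simp
    fix Y assume Y: "Y \<in> adjoint_lattice \<Lambda>" "norm Y < 1 / (2 * R)"
    show "Y = 0"
    proof (rule ccontr)
      assume "Y \<noteq> 0"
      define v where "v = symp Y"
      have v: "norm v = norm Y" "norm v > 0" using \<open>Y \<noteq> 0\<close> by (auto simp: v_def)
      \<comment> \<open>The centre pairs with \<open>v\<close> to exactly 1/2. For a lattice point
        within R of it the pairing is off by at most R |v| < 1/2, hence lies strictly between 0 and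
        1 and is no integer; this is where the bound 1/(2 R) comes from.\<close>
      obtain l where l: "l \<in> \<Lambda>" "dist ((1 / (2 * (norm v)\<^sup>2)) *\<^sub>R v) l < R" using R(2) by blast
      have "\<bar>l \<bullet> v - 1 / 2\<bar> = \<bar>((1 / (2 * (norm v)\<^sup>2)) *\<^sub>R v - l) \<bullet> v\<bar>"
        using v(2) by (simp add: inner_diff_left power2_norm_eq_inner[symmetric] abs_minus_commute)
      also have "\<dots> \<le> norm ((1 / (2 * (norm v)\<^sup>2)) *\<^sub>R v - l) * norm v"
        by (rule Cauchy_Schwarz_ineq2)
      also have "\<dots> \<le> R * norm v"
        using l(2) by (intro mult_right_mono) (auto simp: dist_norm)
      also have "\<dots> < 1 / 2" using Y(2) R(1) v by (simp add: field_simps)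
      finally have lv: "\<bar>l \<bullet> v - 1 / 2\<bar> < 1 / 2" .
      have "l \<bullet> v \<in> \<int>" using Y(1) l(1) by (simp add: mem_adjoint_lattice_iff v_def)
      then obtain k where "l \<bullet> v = of_int k" by (auto elim: Ints_cases)
      then have "0 < (of_int k :: real)" "(of_int k :: real) < 1" using lv by linarith+
      then show False by simp
    qed
  next
    fix z :: "'a phase_space"
    obtain y where y: "\<forall>l\<in>\<Lambda>. l \<bullet> y \<in> \<int>" "dist (symp z) y \<le> R'" using R' by blast
    define Y where "Y = (- snd y, fst y)"
    have "symp Y = y" by (simp add: Y_def symp_def)
    then have "Y \<in> adjoint_lattice \<Lambda>" "dist z Y \<le> R'"
      using y by (auto simp: mem_adjoint_lattice_iff dist_norm linear_diff[OF symp_linear, symmetric])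
    then show "\<exists>Y\<in>adjoint_lattice \<Lambda>. dist z Y \<le> R'" by blast
  qed
qed

section \<open>The short-time Fourier transform\<close>

definition stft :: "'n::finite L2 \<Rightarrow> 'n phase_space \<Rightarrow> complex" where
  "stft f z = cinner f (tf_shift z gaussian)"

definition gau :: "real^'n::finite \<Rightarrow> real" where
  "gau x = 2 powr (- real CARD('n) / 4) * exp (- pi * (x \<bullet> x))"

lemma gau_pos: "gau x > 0"
  by (simp add: gau_def)

lemma gau_nonneg [simp]: "0 \<le> gau x"
  by (simp add: gau_pos less_imp_le)

lemma abs_gau [simp]: "\<bar>gau x\<bar> = gau x"
  using gau_pos[of x] by simp

lemma measurable_gau [measurable]: "gau \<in> borel_measurable borel"
  unfolding gau_def[abs_def] by measurable

lemma sq_integrable_gau: "sq_integrable (\<lambda>x. complex_of_real (gau x))"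
  unfolding gau_def by (rule sq_integrable_gaussian)

lemma gaussian_eq: "gaussian = abs_L2 (\<lambda>x. complex_of_real (gau x))"
  unfolding gaussian_def gau_def by simp

lemma tf_shift_gaussian:
  "sq_integrable (\<lambda>t. character (snd z) t * complex_of_real (gau (t - fst z)))"
  "tf_shift z gaussian = abs_L2 (\<lambda>t. character (snd z) t * complex_of_real (gau (t - fst z)))"
  using tf_shift_abs[OF sq_integrable_gau, where x = "fst z" and \<omega> = "snd z"] by (simp_all add: gaussian_eq)

lemma stft_eq_integral:
  "stft f z = (LINT t|lborel. rep_L2 f t * (cnj (character (snd z) t) * complex_of_real (gau (t - fst z))))"
  unfolding stft_def tf_shift_gaussian(2) by (subst cinner_abs_right[OF tf_shift_gaussian(1)]) simp

lemma measurable_stft [measurable]: "stft f \<in> borel_measurable borel"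
  unfolding stft_eq_integral[abs_def] borel_prod[symmetric] by measurable

lemma measurable_stft_pair [measurable]: "stft f \<in> borel_measurable (borel \<Otimes>\<^sub>M borel)"
  by (simp add: borel_prod)

lemma stft_add: "stft (f + g) z = stft f z + stft g z"
  and stft_diff: "stft (f - g) z = stft f z - stft g z"
  and stft_cscale: "stft (cscale c f) z = c * stft f z"
  and stft_zero [simp]: "stft 0 z = 0"
  using cinner_diff_left[of 0 0 "tf_shift z gaussian"]
  by (simp_all add: stft_def cinner_add_left cinner_diff_left cinner_cscale_left)

lemma bounded_linear_stft: "bounded_linear (\<lambda>f. stft f z)"
  unfolding stft_def by (rule bounded_linear_cinner_left)

lemma mem_feichtinger_iff: "f \<in> feichtinger \<longleftrightarrow> integrable lborel (stft f)"
proof -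
  have "(\<integral>\<^sup>+x. \<integral>\<^sup>+\<omega>. ennreal (cmod (stft f (x, \<omega>))) \<partial>lborel \<partial>lborel) = (\<integral>\<^sup>+z. ennreal (cmod (stft f z)) \<partial>(lborel \<Otimes>\<^sub>M lborel))"
    by (subst lborel.nn_integral_fst) (simp_all add: lborel_prod)
  then show ?thesis
    by (simp add: feichtinger_def integrable_iff_bounded lborel_prod stft_def[symmetric])
qed

lemma stft_fourier: "stft f (x, \<omega>) = fourier (\<lambda>t. rep_L2 f t * complex_of_real (gau (t - x))) \<omega>"
  unfolding stft_eq_integral fourier_def by (simp add: mult_ac)

lemma sq_integrable_gau_shift: "sq_integrable (\<lambda>t. complex_of_real (gau (t - x)))"
  by (rule sq_integrable_translate[OF sq_integrable_gau])

lemma integrable_rep_gau: "integrable lborel (\<lambda>t. rep_L2 f t * complex_of_real (gau (t - x)))"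
  using sq_integrable_mult_cnj[OF sq_integrable_rep sq_integrable_gau_shift, of f x] by simp

text \<open>The constant c of the overview. It depends on the dimension alone, hence the type
  argument. For this window it equals 2^-d rather than 1; it stays symbolic, since its positivity is
  enough.\<close>

definition gnorm :: "'n::finite itself \<Rightarrow> real" where
  "gnorm _ = (LINT t|lborel. (gau (t :: real^'n))\<^sup>2)"

lemma integral_gau_shift:
  fixes t :: "real^'n::finite"
  shows "integrable lborel (\<lambda>x. (gau (t - x))\<^sup>2)" "(LINT x|lborel. (gau (t - x))\<^sup>2) = gnorm TYPE('n)"
proof -
  have i: "integrable lborel (\<lambda>x :: real^'n. (gau x)\<^sup>2)"
    using sq_integrable_gau[where 'a='n] by (simp add: sq_integrable_def)
  show "integrable lborel (\<lambda>x. (gau (t - x))\<^sup>2)"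
    using lborel_integrable_affine[of "-1", OF _ i, of t] by simp
  show "(LINT x|lborel. (gau (t - x))\<^sup>2) = gnorm TYPE('n)"
    unfolding gnorm_def using lborel_integral_affine[of "-1" "\<lambda>x :: real^'n. (gau x)\<^sup>2" t] by simp
qed

text \<open>For almost every \<open>x\<close> this is Fourier inversion for \<open>t \<mapsto> f t \<cdot> \<phi> (t - x)\<close>, whose transform
  is \<open>V f (x, \<cdot>)\<close>.\<close>

lemma feichtinger_inversion_AE:
  fixes f :: "'n::finite L2"
  assumes "f \<in> feichtinger"
  shows "AE t in lborel. (LINT z|lborel. stft f z * (character (snd z) t * complex_of_real (gau (t - fst z))))
    = complex_of_real (gnorm TYPE('n)) * rep_L2 f t"
proof -
  have int: "integrable lborel (stft f)" using assms by (simp add: mem_feichtinger_iff)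
  then have intp: "integrable (lborel \<Otimes>\<^sub>M lborel) (stft f)" by (simp add: lborel_prod)
  define I where "I x t = (LINT \<omega>|lborel. stft f (x, \<omega>) * character \<omega> t)" for x t
  have [measurable]: "(\<lambda>p. I (fst p) (snd p)) \<in> borel_measurable (borel \<Otimes>\<^sub>M borel)"
    unfolding I_def by measurable
  have [measurable]: "(\<lambda>x. I x t) \<in> borel_measurable borel" for t
    unfolding I_def by measurable
  have "AE x in lborel. integrable lborel (\<lambda>\<omega>. stft f (x, \<omega>))"
    by (rule lborel_pair.AE_integrable_fst'[OF intp])
  then have "AE x in lborel. AE t in lborel. rep_L2 f t * complex_of_real (gau (t - x)) = I x t"
  proof eventually_elim
    case (elim x)
    then show ?case
      using fourier_inversion[OF integrable_rep_gau[of f x]] by (simp add: stft_fourier I_def)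
  qed
  moreover have "{p \<in> space (lborel \<Otimes>\<^sub>M lborel). rep_L2 f (snd p) * complex_of_real (gau (snd p - fst p)) = I (fst p) (snd p)}
      \<in> sets (lborel \<Otimes>\<^sub>M lborel)"
    by measurable
  \<comment> \<open>Inversion gives, for almost every x, an exceptional null set of t that depends
    on x. Since the set of good pairs is measurable, the quantifiers can be exchanged, and t is then
    fixed while x is integrated.\<close>
  ultimately have "AE t in lborel. AE x in lborel. rep_L2 f t * complex_of_real (gau (t - x)) = I x t"
    using lborel_pair.AE_commute[of "\<lambda>x t. rep_L2 f t * complex_of_real (gau (t - x)) = I x t"] by blast
  then show ?thesis
  proof eventually_elim
    case (elim t)
    let ?g = "\<lambda>z. stft f z * (character (snd z) t * complex_of_real (gau (t - fst z)))"
    have bnd: "gau y \<le> 2 powr (- real CARD('n) / 4)" for y :: "real^'n"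
      by (simp add: gau_def)
    have "integrable lborel ?g"
    proof (rule Bochner_Integration.integrable_bound)
      show "integrable lborel (\<lambda>z. 2 powr (- real CARD('n) / 4) * cmod (stft f z))" using int by simp
      show "AE z in lborel. norm (?g z) \<le> norm (2 powr (- real CARD('n) / 4) * cmod (stft f z))"
        using bnd gau_pos by (auto simp: norm_mult mult.commute[of "cmod _"] less_imp_le intro!: AE_I2 mult_right_mono)
      show "?g \<in> borel_measurable lborel"
        unfolding lborel_prod[symmetric] by measurable
    qed
    then have "integrable (lborel \<Otimes>\<^sub>M lborel) ?g" by (simp add: lborel_prod)
    from lborel_pair.integral_fst'[OF this]
    have "(LINT z|lborel. ?g z) = (LINT x|lborel. LINT \<omega>|lborel. ?g (x, \<omega>))"
      by (simp add: lborel_prod)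
    also have "\<dots> = (LINT x|lborel. complex_of_real (gau (t - x)) * I x t)"
    proof (rule Bochner_Integration.integral_cong)
      fix x
      have "(LINT \<omega>|lborel. ?g (x, \<omega>)) = (LINT \<omega>|lborel. complex_of_real (gau (t - x)) * (stft f (x, \<omega>) * character \<omega> t))"
        by (intro Bochner_Integration.integral_cong) (auto simp: mult_ac)
      then show "(LINT \<omega>|lborel. ?g (x, \<omega>)) = complex_of_real (gau (t - x)) * I x t"
        by (simp add: I_def)
    qed simp
    \<comment> \<open>The window enters once through V f and once through the shifted Gaussian, so
      integration over x leaves c times f t.\<close>
    also have "\<dots> = (LINT x|lborel. rep_L2 f t * complex_of_real ((gau (t - x))\<^sup>2))"
      using elim by (intro integral_cong_AE) (auto simp: power2_eq_square mult_ac elim!: eventually_mono)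
    also have "\<dots> = complex_of_real (gnorm TYPE('n)) * rep_L2 f t"
      by (simp only: integral_mult_right_zero integral_complex_of_real integral_gau_shift mult.commute)
    finally show ?case .
  qed
qed

text \<open>The weak form of inversion: the pointwise formula is integrated against the conjugate of
  \<open>g\<close>. Exchanging the integrals is allowed because V f is integrable over phase space
  and the integral of |g| against a translated Gaussian is bounded uniformly in the
  translation.\<close>

lemma feichtinger_inversion:
  fixes f g :: "'n::finite L2"
  assumes "f \<in> feichtinger"
  shows "complex_of_real (gnorm TYPE('n)) * cinner f g = (LINT z|lborel. stft f z * cnj (stft g z))"
proof -
  have int: "integrable lborel (stft f)" using assms by (simp add: mem_feichtinger_iff)
  let ?G = "\<lambda>z t. stft f z * (character (snd z) t * complex_of_real (gau (t - fst z)) * cnj (rep_L2 g t))"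
  have meas: "(\<lambda>(z, t). ?G z t) \<in> borel_measurable (lborel \<Otimes>\<^sub>M lborel)"
    unfolding lborel_prod[symmetric] by measurable
  have ig: "integrable lborel (\<lambda>t. cmod (rep_L2 g t) * gau (t - x))" for x
    using integrable_norm[OF integrable_rep_gau[of g x]] gau_pos by (simp add: norm_mult less_imp_le)
  define L where "L x = (LINT t|lborel. cmod (rep_L2 g t) * gau (t - x))" for x
  define M where "M = (LINT t|lborel. (cmod (rep_L2 g t))\<^sup>2) + gnorm TYPE('n)"
  have L: "0 \<le> L x" "L x \<le> M" for x
  proof -
    show "0 \<le> L x" unfolding L_def by simp
    have ix: "integrable lborel (\<lambda>t. (gau (t - x))\<^sup>2)" "(LINT t|lborel. (gau (t - x))\<^sup>2) = gnorm TYPE('n)"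
      using integral_gau_shift[of x] by (simp_all add: gau_def inner_commute inner_diff_left inner_diff_right norm_minus_commute algebra_simps)
    have i2: "integrable lborel (\<lambda>t. (cmod (rep_L2 g t))\<^sup>2)" using sq_integrable_rep[of g] by (simp add: sq_integrable_def)
    have "L x \<le> (LINT t|lborel. (cmod (rep_L2 g t))\<^sup>2 + (gau (t - x))\<^sup>2)"
      unfolding L_def
    proof (rule integral_mono[OF ig])
      fix t
      have "2 * (cmod (rep_L2 g t) * gau (t - x)) \<le> (cmod (rep_L2 g t))\<^sup>2 + (gau (t - x))\<^sup>2"
        using sum_squares_bound[of "cmod (rep_L2 g t)" "gau (t - x)"] by simp
      moreover have "0 \<le> cmod (rep_L2 g t) * gau (t - x)" using gau_pos[of "t - x"] by simp
      ultimately show "cmod (rep_L2 g t) * gau (t - x) \<le> (cmod (rep_L2 g t))\<^sup>2 + (gau (t - x))\<^sup>2" by linarith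
    qed (use ix i2 in simp)
    also have "\<dots> = M" using ix i2 by (simp add: M_def)
    finally show "L x \<le> M" .
  qed
  have intG: "integrable (lborel \<Otimes>\<^sub>M lborel) (\<lambda>(z, t). ?G z t)"
  proof (rule lborel_pair.Fubini_integrable[OF meas])
    have nG: "cmod (?G z t) = cmod (stft f z) * (cmod (rep_L2 g t) * gau (t - fst z))" for z t
      using gau_pos by (simp add: norm_mult less_imp_le)
    have "integrable lborel (\<lambda>z. cmod (stft f z) * L (fst z))"
    proof (rule Bochner_Integration.integrable_bound)
      show "integrable lborel (\<lambda>z. M * cmod (stft f z))" using int by simp
      show "AE z in lborel. norm (cmod (stft f z) * L (fst z)) \<le> norm (M * cmod (stft f z))"
        using L order_trans[OF L] by (auto simp: abs_mult mult.commute[of M] intro!: AE_I2 mult_left_mono)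
      show "(\<lambda>z. cmod (stft f z) * L (fst z)) \<in> borel_measurable lborel"
        unfolding L_def lborel_prod[symmetric] by measurable
    qed
    then show "integrable lborel (\<lambda>z. LINT t|lborel. norm (case (z, t) of (z, t) \<Rightarrow> ?G z t))"
      by (simp add: nG L_def)
    show "AE z in lborel. integrable lborel (\<lambda>t. case (z, t) of (z, t) \<Rightarrow> ?G z t)"
    proof (rule AE_I2)
      fix z :: "'n phase_space"
      have "integrable lborel (\<lambda>t. ?G z t)"
      proof (rule Bochner_Integration.integrable_bound)
        show "integrable lborel (\<lambda>t. cmod (stft f z) * (cmod (rep_L2 g t) * gau (t - fst z)))" using ig by simp
      qed (use gau_pos in \<open>auto simp: norm_mult less_imp_le\<close>)
      then show "integrable lborel (\<lambda>t. case (z, t) of (z, t) \<Rightarrow> ?G z t)" by simp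
    qed
  qed
  have "(LINT z|lborel. stft f z * cnj (stft g z)) = (LINT z|lborel. LINT t|lborel. ?G z t)"
  proof (rule Bochner_Integration.integral_cong)
    fix z
    have "cnj (stft g z) = (LINT t|lborel. character (snd z) t * complex_of_real (gau (t - fst z)) * cnj (rep_L2 g t))"
      unfolding stft_eq_integral by (simp add: mult_ac flip: Bochner_Integration.integral_cnj)
    then show "stft f z * cnj (stft g z) = (LINT t|lborel. ?G z t)"
      by simp
  qed simp
  also have "\<dots> = (LINT t|lborel. LINT z|lborel. ?G z t)"
    using lborel_pair.Fubini_integral[OF intG] by simp
  also have "\<dots> = (LINT t|lborel. complex_of_real (gnorm TYPE('n)) * (rep_L2 f t * cnj (rep_L2 g t)))"
  proof (rule integral_cong_AE)
    show "AE t in lborel. (LINT z|lborel. ?G z t) = complex_of_real (gnorm TYPE('n)) * (rep_L2 f t * cnj (rep_L2 g t))"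
      using feichtinger_inversion_AE[OF assms]
    proof eventually_elim
      case (elim t)
      have "(LINT z|lborel. ?G z t) = (LINT z|lborel. stft f z * (character (snd z) t * complex_of_real (gau (t - fst z)))) * cnj (rep_L2 g t)"
        by (simp add: mult.assoc flip: integral_mult_left_zero)
      then show ?case by (simp add: elim mult_ac)
    qed
    show "(\<lambda>t. LINT z|lborel. ?G z t) \<in> borel_measurable lborel"
      unfolding lborel_prod[symmetric] by measurable
  qed auto
  also have "\<dots> = complex_of_real (gnorm TYPE('n)) * cinner f g"
    by (simp add: cinner_rep)
  finally show ?thesis by simp
qed

lemma norm_gaussian_squared: "(norm (gaussian :: 'n::finite L2))\<^sup>2 = gnorm TYPE('n)"
proof -
  have "cinner (gaussian :: 'n L2) gaussian = (LINT t|lborel. complex_of_real ((gau (t :: real^'n))\<^sup>2))"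
    unfolding gaussian_eq by (simp add: abs_L2_cinner sq_integrable_gau power2_eq_square)
  also have "\<dots> = complex_of_real (gnorm TYPE('n))"
    unfolding gnorm_def by (rule integral_complex_of_real)
  finally show ?thesis by (simp only: norm_L2_squared of_real_eq_iff)
qed

lemma gnorm_pos: "gnorm TYPE('n::finite) > 0"
  using norm_gaussian_squared[where 'n='n] gaussian_nonzero[where 'n='n] by (metis zero_less_norm_iff zero_less_power)

section \<open>The Gaussian kernel: reproducing formula, closed form and decay\<close>

definition gker :: "'n::finite phase_space \<Rightarrow> 'n phase_space \<Rightarrow> complex" where
  "gker u z = cinner (tf_shift u gaussian) (tf_shift z gaussian)"

lemma stft_tf_shift_gaussian: "stft (tf_shift u gaussian) z = gker u z"
  by (simp add: stft_def gker_def)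

lemma gker_commute: "gker u z = cnj (gker z u)"
  unfolding gker_def by (rule cinner_commute)

text \<open>Inversion tested on a shifted Gaussian, whose short-time Fourier transform is the kernel
  itself.\<close>

lemma reproducing_formula:
  fixes f :: "'n::finite L2"
  assumes "f \<in> feichtinger"
  shows "complex_of_real (gnorm TYPE('n)) * stft f w = (LINT z|lborel. stft f z * gker z w)"
  using feichtinger_inversion[OF assms, of "tf_shift w gaussian"]
  by (simp add: stft_def[of f w] stft_tf_shift_gaussian gker_commute[of _ w, symmetric])

text \<open>Centring the integration variable at the midpoint of the two translations makes the
  product of the windows a Gaussian in t times one in the difference of the translations, so the
  integral is the Fourier transform of exp(-2 \<pi> |t|^2) at the difference of the
  frequencies.\<close>

lemma gker_eq:
  fixes u z :: "'n::finite phase_space"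
  shows "gker u z = complex_of_real (gnorm TYPE('n) * exp (- pi / 2 * ((u - z) \<bullet> (u - z))))
    * exp (\<i> * complex_of_real (pi * ((snd u - snd z) \<bullet> (fst u + fst z))))"
proof -
  define A where "A = 2 powr (- real CARD('n) / 4)"
  define s where "s = A\<^sup>2 / sqrt 2 ^ CARD('n)"
  have *: "gker u z = complex_of_real (s * exp (- pi / 2 * ((u - z) \<bullet> (u - z))))
    * exp (\<i> * complex_of_real (pi * ((snd u - snd z) \<bullet> (fst u + fst z))))" for u z :: "'n phase_space"
  proof -
    define m where "m = (1/2) *\<^sub>R (fst u + fst z)"
    define \<xi> where "\<xi> = snd u - snd z"
    define y where "y = fst u - fst z"
    let ?h = "\<lambda>t. character (snd u) t * complex_of_real (gau (t - fst u)) * (cnj (character (snd z) t) * complex_of_real (gau (t - fst z)))"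
    have e3: "exp (complex_of_real a + b + c) = complex_of_real (exp a) * exp b * exp c" for a b c
      by (simp only: exp_add exp_of_real)
    have h: "?h (m + 1 *\<^sub>R t) = complex_of_real (A\<^sup>2 * exp (- pi / 2 * (y \<bullet> y))) * exp (\<i> * complex_of_real (pi * (\<xi> \<bullet> (fst u + fst z))))
        * exp (complex_of_real (- pi * 2 * (t \<bullet> t)) + 2 * pi * \<i> * complex_of_real (\<xi> \<bullet> t))" for t
    proof -
      have "?h (m + t) = complex_of_real (A\<^sup>2) *
          (exp (2 * pi * \<i> * complex_of_real (snd u \<bullet> (m + t))) * exp (- (2 * pi * \<i> * complex_of_real (snd z \<bullet> (m + t))))
           * (exp (complex_of_real (- pi * ((m + t - fst u) \<bullet> (m + t - fst u)))) * exp (complex_of_real (- pi * ((m + t - fst z) \<bullet> (m + t - fst z))))))"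
        unfolding character_def gau_def A_def[symmetric] exp_cnj exp_of_real
        by (simp add: power2_eq_square mult_ac)
      also have "\<dots> = complex_of_real (A\<^sup>2) * exp (complex_of_real (- pi / 2 * (y \<bullet> y)) + \<i> * complex_of_real (pi * (\<xi> \<bullet> (fst u + fst z)))
         + (complex_of_real (- pi * 2 * (t \<bullet> t)) + 2 * pi * \<i> * complex_of_real (\<xi> \<bullet> t)))"
      proof -
        have r: "(m + t - fst u) \<bullet> (m + t - fst u) + (m + t - fst z) \<bullet> (m + t - fst z) = 2 * (t \<bullet> t) + (y \<bullet> y) / 2"
          by (simp add: m_def y_def inner_diff_left inner_diff_right inner_add_left inner_add_right inner_commute field_simps)
        have i: "2 * (snd u \<bullet> (m + t)) - 2 * (snd z \<bullet> (m + t)) = \<xi> \<bullet> (fst u + fst z) + 2 * (\<xi> \<bullet> t)"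
          by (simp add: m_def \<xi>_def inner_diff_left inner_add_right field_simps)
        have "2 * pi * \<i> * complex_of_real (snd u \<bullet> (m + t)) + - (2 * pi * \<i> * complex_of_real (snd z \<bullet> (m + t)))
            + (complex_of_real (- pi * ((m + t - fst u) \<bullet> (m + t - fst u))) + complex_of_real (- pi * ((m + t - fst z) \<bullet> (m + t - fst z))))
          = \<i> * complex_of_real (pi * (2 * (snd u \<bullet> (m + t)) - 2 * (snd z \<bullet> (m + t))))
            + complex_of_real (- pi * ((m + t - fst u) \<bullet> (m + t - fst u) + (m + t - fst z) \<bullet> (m + t - fst z)))"
          by (simp add: algebra_simps)
        also have "\<dots> = complex_of_real (- pi / 2 * (y \<bullet> y)) + \<i> * complex_of_real (pi * (\<xi> \<bullet> (fst u + fst z)))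
         + (complex_of_real (- pi * 2 * (t \<bullet> t)) + 2 * pi * \<i> * complex_of_real (\<xi> \<bullet> t))"
          unfolding r i by (simp add: algebra_simps)
        finally show ?thesis by (simp only: exp_add[symmetric])
      qed
      finally show ?thesis by (simp only: e3 of_real_mult[of "A\<^sup>2"] scaleR_one mult.assoc)
    qed
    have "gker u z = (LINT t|lborel. ?h t)"
      unfolding gker_def tf_shift_gaussian(2) by (subst abs_L2_cinner[OF tf_shift_gaussian(1) tf_shift_gaussian(1)]) simp
    also have "\<dots> = \<bar>1\<bar> ^ DIM(real^'n) *\<^sub>R (LINT t|lborel. ?h (m + 1 *\<^sub>R t))"
      by (rule lborel_integral_affine) auto
    also have "\<dots> = complex_of_real (A\<^sup>2 * exp (- pi / 2 * (y \<bullet> y))) * exp (\<i> * complex_of_real (pi * (\<xi> \<bullet> (fst u + fst z))))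
        * complex_of_real (exp (- pi * (\<xi> \<bullet> \<xi>) / 2) / sqrt 2 ^ DIM(real^'n))"
      unfolding h integral_mult_right_zero by (subst gaussian_fourier(2)) auto
    also have "\<dots> = complex_of_real (s * (exp (- pi / 2 * (y \<bullet> y)) * exp (- pi / 2 * (\<xi> \<bullet> \<xi>)))) * exp (\<i> * complex_of_real (pi * (\<xi> \<bullet> (fst u + fst z))))"
      by (simp add: s_def mult_ac)
    also have "exp (- pi / 2 * (y \<bullet> y)) * exp (- pi / 2 * (\<xi> \<bullet> \<xi>)) = exp (- pi / 2 * ((u - z) \<bullet> (u - z)))"
      unfolding exp_add[symmetric] by (simp add: inner_prod_def y_def \<xi>_def field_simps)
    finally show ?thesis unfolding \<xi>_def .
  qed
  \<comment> \<open>The prefactor \<open>s\<close> is the value of the kernel at u = z = 0, hence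
    the squared norm of the Gaussian.\<close>
  have "complex_of_real (gnorm TYPE('n)) = gker 0 (0 :: 'n phase_space)"
    unfolding gker_def norm_L2_squared by (simp add: norm_gaussian_squared)
  also have "\<dots> = complex_of_real s" unfolding * by simp
  finally show ?thesis using *[of u z] by simp
qed

lemma gnorm_nonneg [simp]: "0 \<le> gnorm TYPE('n::finite)"
  using gnorm_pos[where 'n='n] by simp

text \<open>The mean value inequality on the disc of radius |z|, where exp has modulus at most exp
  |z|.\<close>

lemma norm_exp_minus_one_le: "cmod (exp z - 1) \<le> cmod z * exp (cmod z)"
proof -
  have "cmod (exp z - exp 0) \<le> exp (cmod z) * cmod (z - 0)"
  proof (rule field_differentiable_bound[of "cball 0 (cmod z)" exp exp])
    show "(exp has_field_derivative exp x) (at x within cball 0 (cmod z))" for x :: complex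
      by (rule DERIV_subset[OF DERIV_exp]) simp
    show "cmod (exp x) \<le> exp (cmod z)" if "x \<in> cball 0 (cmod z)" for x
    proof -
      have "Re x \<le> cmod z" using that complex_Re_le_cmod[of x] by simp
      then show ?thesis by simp
    qed
  qed auto
  then show ?thesis by (simp add: mult.commute)
qed

text \<open>The kernel \<open>gker\<close> decays like exp(-(\<pi>/2) |a|^2). Half of this rate is
  kept here; the other half is spent on moving a base point by at most 1 and on the exponential
  growth of the Lipschitz factors.\<close>

definition psi :: "'a::real_inner \<Rightarrow> real" where
  "psi a = exp (- (pi / 4) * (a \<bullet> a))"

lemma psi_nonneg [simp]: "0 \<le> psi a" and abs_psi [simp]: "\<bar>psi a\<bar> = psi a"
  and psi_le_1: "psi a \<le> 1"
  by (simp_all add: psi_def)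

lemma measurable_psi [measurable]: "(psi :: 'a::euclidean_space \<Rightarrow> real) \<in> borel_measurable borel"
  unfolding psi_def[abs_def] by measurable

lemma integrable_psi: "integrable lborel (psi :: 'a::euclidean_space \<Rightarrow> real)"
  unfolding psi_def[abs_def] by (rule integrable_gaussian) simp

lemma psi_minus_commute: "psi (a - b) = psi (b - a)"
  by (simp add: psi_def inner_diff_left inner_diff_right inner_commute)

text \<open>In the sum of the two phases the terms quadratic in z cancel. What is left depends on z
  only linearly, through the symplectic pairing with u - w; the remaining phase is constant in z and
  does not affect the modulus of differences.\<close>

lemma gker_mult:
  fixes u z w :: "'n::finite phase_space"
  shows "gker u z * gker z w = complex_of_real ((gnorm TYPE('n))\<^sup>2)
    * exp (\<i> * complex_of_real (pi * (snd u \<bullet> fst u - snd w \<bullet> fst w)))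
    * exp (complex_of_real (- pi / 2 * ((u - z) \<bullet> (u - z) + (z - w) \<bullet> (z - w))) + \<i> * complex_of_real (pi * (z \<bullet> symp (u - w))))"
proof -
  have phase: "(snd u - snd z) \<bullet> (fst u + fst z) + (snd z - snd w) \<bullet> (fst z + fst w)
      = (snd u \<bullet> fst u - snd w \<bullet> fst w) + z \<bullet> symp (u - w)"
    by (simp add: symp_def inner_prod_def inner_diff_left inner_diff_right inner_add_left inner_add_right inner_commute)
  have "gker u z * gker z w = complex_of_real ((gnorm TYPE('n))\<^sup>2)
     * (complex_of_real (exp (- pi / 2 * ((u - z) \<bullet> (u - z)))) * complex_of_real (exp (- pi / 2 * ((z - w) \<bullet> (z - w)))))
     * (exp (\<i> * complex_of_real (pi * ((snd u - snd z) \<bullet> (fst u + fst z)))) * exp (\<i> * complex_of_real (pi * ((snd z - snd w) \<bullet> (fst z + fst w)))))"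
    unfolding gker_eq by (simp add: power2_eq_square mult_ac)
  also have "(complex_of_real (exp (- pi / 2 * ((u - z) \<bullet> (u - z)))) * complex_of_real (exp (- pi / 2 * ((z - w) \<bullet> (z - w)))))
     = exp (complex_of_real (- pi / 2 * ((u - z) \<bullet> (u - z) + (z - w) \<bullet> (z - w))))"
    unfolding exp_of_real[symmetric] exp_add[symmetric] by (simp add: algebra_simps)
  also have "exp (\<i> * complex_of_real (pi * ((snd u - snd z) \<bullet> (fst u + fst z)))) * exp (\<i> * complex_of_real (pi * ((snd z - snd w) \<bullet> (fst z + fst w))))
     = exp (\<i> * complex_of_real (pi * ((snd u - snd z) \<bullet> (fst u + fst z) + (snd z - snd w) \<bullet> (fst z + fst w))))"
    unfolding exp_add[symmetric] by (simp add: algebra_simps)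
  also have "\<dots> = exp (\<i> * complex_of_real (pi * (snd u \<bullet> fst u - snd w \<bullet> fst w))) * exp (\<i> * complex_of_real (pi * (z \<bullet> symp (u - w))))"
    unfolding phase exp_add[symmetric] by (simp add: algebra_simps)
  finally show ?thesis by (simp only: exp_add mult_ac)
qed

text \<open>Only the exponent \<zeta> varies with z, and between z and p it changes by at most |q| T
  with T affine in |a| and |b|. The resulting factor exp (2 T) grows only exponentially and is
  absorbed by half of the Gaussian decay.\<close>

lemma gker_mult_lipschitz:
  fixes u p z w :: "'n::finite phase_space"
  assumes "norm (p - z) \<le> 1"
  shows "cmod (gker u p * gker p w - gker u z * gker z w)
    \<le> norm (p - z) * ((gnorm TYPE('n))\<^sup>2 * exp (34 * pi)) * (psi (u - z) * psi (w - z))"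
proof -
  define q a b where "q = p - z" and "a = u - z" and "b = w - z"
  define \<zeta> where "\<zeta> z = complex_of_real (- pi / 2 * ((u - z) \<bullet> (u - z) + (z - w) \<bullet> (z - w))) + \<i> * complex_of_real (pi * (z \<bullet> symp (u - w)))" for z
  define T where "T = pi * (1 + 2 * norm a + 2 * norm b)"
  have T: "T \<ge> 0" by (simp add: T_def)
  have q1: "norm q \<le> 1" using assms by (simp add: q_def)
  have "u - p = a - q" "p - w = - (b - q)" "z - w = - b" by (simp_all add: q_def a_def b_def)
  then have "\<zeta> p - \<zeta> z = complex_of_real (- pi * (q \<bullet> q - a \<bullet> q - b \<bullet> q)) + \<i> * complex_of_real (pi * (q \<bullet> symp (a - b)))"
  proof -
    assume 1: "u - p = a - q" "p - w = - (b - q)" "z - w = - b"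
    have 2: "p \<bullet> symp (u - w) - z \<bullet> symp (u - w) = q \<bullet> symp (a - b)"
      by (simp add: q_def a_def b_def inner_diff_left)
    have 3: "- pi / 2 * ((a - q) \<bullet> (a - q) + (- (b - q)) \<bullet> (- (b - q))) - (- pi / 2 * (a \<bullet> a + (- b) \<bullet> (- b)))
       = - pi * (q \<bullet> q - a \<bullet> q - b \<bullet> q)"
      by (simp add: inner_diff_left inner_diff_right inner_commute field_simps)
    have "\<zeta> p - \<zeta> z = complex_of_real (- pi / 2 * ((a - q) \<bullet> (a - q) + (- (b - q)) \<bullet> (- (b - q))) - (- pi / 2 * (a \<bullet> a + (- b) \<bullet> (- b))))
        + \<i> * complex_of_real (pi * (p \<bullet> symp (u - w) - z \<bullet> symp (u - w)))"
      unfolding \<zeta>_def 1 a_def[symmetric] by (simp only: of_real_diff right_diff_distrib of_real_mult) (simp add: algebra_simps)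
    then show ?thesis unfolding 2 3 .
  qed
  also have "cmod \<dots> \<le> \<bar>- pi * (q \<bullet> q - a \<bullet> q - b \<bullet> q)\<bar> + \<bar>pi * (q \<bullet> symp (a - b))\<bar>"
    by (rule order_trans[OF norm_triangle_ineq]) (simp only: norm_of_real norm_mult norm_ii mult_1 order_refl)
  also have "\<dots> \<le> norm q * T"
  proof -
    have "\<bar>q \<bullet> q - a \<bullet> q - b \<bullet> q\<bar> \<le> norm q * norm q + norm a * norm q + norm b * norm q"
      using Cauchy_Schwarz_ineq2[of q q] Cauchy_Schwarz_ineq2[of a q] Cauchy_Schwarz_ineq2[of b q] by linarith
    moreover have "norm q * norm q \<le> norm q" using q1 by (simp add: mult_left_le)
    moreover have "\<bar>q \<bullet> symp (a - b)\<bar> \<le> norm q * (norm a + norm b)"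
      using Cauchy_Schwarz_ineq2[of q "symp (a - b)"] norm_triangle_ineq4[of a b]
      by (simp add: order_trans[OF _ mult_left_mono])
    ultimately have "\<bar>q \<bullet> q - a \<bullet> q - b \<bullet> q\<bar> + \<bar>q \<bullet> symp (a - b)\<bar> \<le> norm q * (1 + 2 * norm a + 2 * norm b)"
      by (simp add: algebra_simps)
    then have "pi * (\<bar>q \<bullet> q - a \<bullet> q - b \<bullet> q\<bar> + \<bar>q \<bullet> symp (a - b)\<bar>) \<le> pi * (norm q * (1 + 2 * norm a + 2 * norm b))"
      by (intro mult_left_mono) auto
    moreover have "\<bar>- pi * x\<bar> + \<bar>pi * y\<bar> = pi * (\<bar>x\<bar> + \<bar>y\<bar>)" for x y
      by (simp add: abs_mult distrib_left)
    ultimately show ?thesis by (simp add: T_def mult.left_commute)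
  qed
  finally have d: "cmod (\<zeta> p - \<zeta> z) \<le> norm q * T" .
  then have dT: "cmod (\<zeta> p - \<zeta> z) \<le> T" using q1 T mult_right_mono[of "norm q" 1 T] by simp
  have "cmod (exp (\<zeta> p) - exp (\<zeta> z)) = cmod (exp (\<zeta> z)) * cmod (exp (\<zeta> p - \<zeta> z) - 1)"
    unfolding norm_mult[symmetric] by (simp add: exp_diff right_diff_distrib)
  also have "\<dots> \<le> cmod (exp (\<zeta> z)) * (norm q * exp (2 * T))"
  proof (intro mult_left_mono)
    have "cmod (exp (\<zeta> p - \<zeta> z) - 1) \<le> cmod (\<zeta> p - \<zeta> z) * exp (cmod (\<zeta> p - \<zeta> z))"
      by (rule norm_exp_minus_one_le)
    also have "\<dots> \<le> (norm q * T) * exp T"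
      using d dT T by (intro mult_mono) auto
    also have "\<dots> \<le> (norm q * exp T) * exp T"
      using exp_ge_add_one_self[of T] by (intro mult_right_mono mult_left_mono) (auto simp del: exp_ge_add_one_self)
    also have "\<dots> = norm q * exp (2 * T)" by (simp add: exp_double power2_eq_square)
    finally show "cmod (exp (\<zeta> p - \<zeta> z) - 1) \<le> norm q * exp (2 * T)" .
  qed simp
  also have "\<dots> \<le> norm q * (exp (34 * pi) * (psi a * psi b))"
  proof -
    have "cmod (exp (\<zeta> z)) = exp (- pi / 2 * (a \<bullet> a + b \<bullet> b))"
      unfolding \<zeta>_def norm_exp_eq_Re
      by (simp add: a_def b_def inner_diff_left inner_diff_right inner_commute)
    moreover have "- pi / 2 * (a \<bullet> a + b \<bullet> b) + 2 * T \<le> 34 * pi + (- (pi / 4) * (a \<bullet> a) + - (pi / 4) * (b \<bullet> b))"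
    proof -
      \<comment> \<open>This is (|x|/2 - 4)^2 \<ge> 0. The terms 16 + 16 for a and b, together with
        the constant 2 in 2 T, each times \<pi>, give 34 \<pi>.\<close>
      have s: "4 * norm x \<le> (x \<bullet> x) / 4 + 16" for x :: "'n phase_space"
        using zero_le_power2[of "norm x / 2 - 4"] by (simp add: power2_diff power_divide power2_norm_eq_inner)
      have "pi * (4 * norm a + 4 * norm b) \<le> pi * ((a \<bullet> a) / 4 + 16 + ((b \<bullet> b) / 4 + 16))"
        using s[of a] s[of b] by (intro mult_left_mono add_mono) auto
      then show ?thesis by (simp add: T_def algebra_simps)
    qed
    ultimately have "cmod (exp (\<zeta> z)) * exp (2 * T) \<le> exp (34 * pi) * (psi a * psi b)"
      unfolding psi_def by (simp flip: exp_add)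
    from mult_left_mono[OF this norm_ge_zero[of q]] show ?thesis by (simp only: mult_ac)
  qed
  finally have e: "cmod (exp (\<zeta> p) - exp (\<zeta> z)) \<le> norm q * (exp (34 * pi) * (psi a * psi b))" .
  have "gker u p * gker p w - gker u z * gker z w = complex_of_real ((gnorm TYPE('n))\<^sup>2)
    * exp (\<i> * complex_of_real (pi * (snd u \<bullet> fst u - snd w \<bullet> fst w))) * (exp (\<zeta> p) - exp (\<zeta> z))"
    unfolding gker_mult \<zeta>_def by (simp only: right_diff_distrib)
  then have "cmod (gker u p * gker p w - gker u z * gker z w) = (gnorm TYPE('n))\<^sup>2 * cmod (exp (\<zeta> p) - exp (\<zeta> z))"
    by (simp only: norm_mult norm_of_real norm_exp_i_times abs_power2 mult_1_right)
  also have "\<dots> \<le> (gnorm TYPE('n))\<^sup>2 * (norm q * (exp (34 * pi) * (psi a * psi b)))"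
    using e by (intro mult_left_mono) auto
  finally show ?thesis by (simp add: q_def a_def b_def mult_ac)
qed

text \<open>Moving the base point from p to z costs half of the Gaussian rate and the factor exp
  (\<pi>/2), because |a|^2 \<le> 2 |a - q|^2 + 2 |q|^2 with |q| \<le> 1.\<close>

lemma cmod_gker_le:
  fixes u p z :: "'n::finite phase_space"
  assumes "norm (p - z) \<le> 1"
  shows "cmod (gker u p) \<le> gnorm TYPE('n) * exp (pi / 2) * psi (u - z)"
proof -
  define q a where "q = p - z" and "a = u - z"
  have up: "u - p = a - q" by (simp add: q_def a_def)
  have "q \<bullet> q \<le> 1" using assms by (simp add: q_def dot_square_norm power_le_one)
  moreover have "a \<bullet> a \<le> 2 * ((a - q) \<bullet> (a - q)) + 2 * (q \<bullet> q)"
    using inner_ge_zero[of "a - 2 *\<^sub>R q"] by (simp add: inner_diff_left inner_diff_right inner_commute)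
  ultimately have "a \<bullet> a \<le> 2 * ((a - q) \<bullet> (a - q)) + 2" by linarith
  then have "pi / 4 * (a \<bullet> a) \<le> pi / 4 * (2 * ((a - q) \<bullet> (a - q)) + 2)" by (intro mult_left_mono) auto
  then have "exp (- pi / 2 * ((u - p) \<bullet> (u - p))) \<le> exp (pi / 2 + - (pi / 4) * (a \<bullet> a))"
    unfolding up by (simp add: algebra_simps)
  then have "exp (- pi / 2 * ((u - p) \<bullet> (u - p))) \<le> exp (pi / 2) * psi a"
    by (simp only: psi_def exp_add)
  then have "gnorm TYPE('n) * exp (- pi / 2 * ((u - p) \<bullet> (u - p))) \<le> gnorm TYPE('n) * (exp (pi / 2) * psi a)"
    using gnorm_pos[where 'n='n] by (intro mult_left_mono) auto
  moreover have "cmod (gker u p) = gnorm TYPE('n) * exp (- pi / 2 * ((u - p) \<bullet> (u - p)))"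
    unfolding gker_eq norm_mult norm_exp_i_times using gnorm_pos[where 'n='n] by (simp add: norm_mult)
  ultimately show ?thesis by (simp add: a_def mult_ac)
qed

section \<open>Local averages that control V f\<close>

lemma measurable_gker [measurable]: "gker u \<in> borel_measurable borel"
  unfolding stft_tf_shift_gaussian[symmetric] by measurable

lemma measurable_gker_left [measurable]: "(\<lambda>z. gker z w) \<in> borel_measurable borel"
  unfolding gker_commute[of _ w] by measurable

text \<open>Fubini together with translation invariance of the integral of \<open>P\<close>. The
  bound P \<le> 1 makes the convolution integral converge at every point z, not only almost
  everywhere.\<close>

lemma convolution_integrable:
  fixes F P :: "'a::euclidean_space \<Rightarrow> real"
  assumes F: "integrable lborel F" and P: "integrable lborel P" "\<And>x. 0 \<le> P x" "\<And>x. P x \<le> 1"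
  shows "integrable lborel (\<lambda>u. F u * P (u - z))"
    and "integrable lborel (\<lambda>z. LINT u|lborel. F u * P (u - z))"
    and "(LINT z|lborel. LINT u|lborel. F u * P (u - z)) = (LINT u|lborel. F u) * (LINT x|lborel. P x)"
proof -
  have [measurable]: "F \<in> borel_measurable borel" "P \<in> borel_measurable borel"
    using borel_measurable_integrable[OF F] borel_measurable_integrable[OF P(1)] by simp_all
  show "integrable lborel (\<lambda>u. F u * P (u - z))"
    by (rule Bochner_Integration.integrable_bound[OF F]) (use P in \<open>auto simp: abs_mult mult_left_le\<close>)
  have Pu: "integrable lborel (\<lambda>z. P (u - z))" "(LINT z|lborel. P (u - z)) = (LINT x|lborel. P x)" for u
    using lborel_integrable_affine[of "-1", OF _ P(1), of u] lborel_integral_affine[of "-1" P u] by simp_all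
  have int: "integrable (lborel \<Otimes>\<^sub>M lborel) (\<lambda>(u, z). F u * P (u - z))"
  proof (rule lborel_pair.Fubini_integrable)
    show "integrable lborel (\<lambda>u. LINT z|lborel. norm (case (u, z) of (u, z) \<Rightarrow> F u * P (u - z)))"
      using F P(2) by (simp add: abs_mult Pu)
    show "AE u in lborel. integrable lborel (\<lambda>z. case (u, z) of (u, z) \<Rightarrow> F u * P (u - z))"
      using Pu by simp
  qed measurable
  show "integrable lborel (\<lambda>z. LINT u|lborel. F u * P (u - z))"
    by (rule lborel_pair.integrable_snd[OF int])
  have "(LINT z|lborel. LINT u|lborel. F u * P (u - z)) = (LINT u|lborel. LINT z|lborel. F u * P (u - z))"
    by (rule lborel_pair.Fubini_integral[OF int])
  then show "(LINT z|lborel. LINT u|lborel. F u * P (u - z)) = (LINT u|lborel. F u) * (LINT x|lborel. P x)"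
    by (simp add: Pu)
qed

text \<open>The convolution of |V f| with \<open>psi\<close>: up to a constant, an integrable
  majorant at z for V f on the whole unit ball around z. Sampling and Riemann sums need such uniform
  local control, which integrability of V f alone does not express.\<close>

definition smear :: "'n::finite L2 \<Rightarrow> 'n phase_space \<Rightarrow> real" where
  "smear f z = (LINT u|lborel. cmod (stft f u) * psi (u - z))"

lemma smear_nonneg [simp]: "0 \<le> smear f z"
  unfolding smear_def by simp

lemma measurable_smear [measurable]: "smear f \<in> borel_measurable borel"
  unfolding smear_def[abs_def] by measurable

lemma smear_integrable:
  fixes f :: "'n::finite L2"
  assumes "f \<in> feichtinger"
  shows "integrable lborel (smear f)"
    "(LINT z|lborel. smear f z) = (LINT z|lborel. cmod (stft f z)) * (LINT a|lborel. psi (a :: 'n phase_space))"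
proof -
  have "integrable lborel (\<lambda>z. cmod (stft f z))" using assms by (simp add: mem_feichtinger_iff)
  note conv = convolution_integrable[OF this integrable_psi psi_nonneg psi_le_1]
  show "integrable lborel (smear f)"
    "(LINT z|lborel. smear f z) = (LINT z|lborel. cmod (stft f z)) * (LINT a|lborel. psi (a :: 'n phase_space))"
    unfolding smear_def[abs_def] by (rule conv)+
qed

text \<open>The reproducing formula bounds V f at p by an average of |V f| against the kernel, whose
  decay can be measured from z instead of p.\<close>

lemma stft_le_smear:
  fixes f :: "'n::finite L2"
  assumes f: "f \<in> feichtinger" and pz: "norm (p - z) \<le> 1"
  shows "cmod (stft f p) \<le> exp (pi / 2) * smear f z"
proof -
  have int: "integrable lborel (stft f)" using f by (simp add: mem_feichtinger_iff)
  have "gnorm TYPE('n) * cmod (stft f p) = cmod (LINT u|lborel. stft f u * gker u p)"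
    unfolding reproducing_formula[OF f, symmetric] using gnorm_pos[where 'n='n] by (simp add: norm_mult)
  also have "\<dots> \<le> (LINT u|lborel. cmod (stft f u * gker u p))" by (rule integral_norm_bound)
  also have "\<dots> \<le> (LINT u|lborel. (gnorm TYPE('n) * exp (pi / 2)) * (cmod (stft f u) * psi (u - z)))"
  proof (rule integral_mono')
    show "integrable lborel (\<lambda>u. (gnorm TYPE('n) * exp (pi / 2)) * (cmod (stft f u) * psi (u - z)))"
      by (intro integrable_mult_right convolution_integrable(1) integrable_norm int integrable_psi) (auto simp: psi_le_1)
    show "cmod (stft f u * gker u p) \<le> (gnorm TYPE('n) * exp (pi / 2)) * (cmod (stft f u) * psi (u - z))" for u
      using mult_left_mono[OF cmod_gker_le[OF pz, of u], of "cmod (stft f u)"] by (simp add: norm_mult mult_ac)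
  qed simp
  also have "\<dots> = gnorm TYPE('n) * (exp (pi / 2) * smear f z)"
    by (simp add: smear_def)
  finally show ?thesis using gnorm_pos[where 'n='n] by simp
qed

lemma integrable_stft_gker:
  fixes f :: "'n::finite L2"
  assumes "f \<in> feichtinger" "h \<in> borel_measurable borel" "\<And>u. cmod (h u) \<le> K"
  shows "integrable lborel (\<lambda>u. stft f u * h u)"
proof (rule Bochner_Integration.integrable_bound)
  show "integrable lborel (\<lambda>u. K * cmod (stft f u))"
    using assms(1) by (simp add: mem_feichtinger_iff)
  have "cmod (stft f u * h u) \<le> norm (K * cmod (stft f u))" for u
    using mult_right_mono[OF order_trans[OF assms(3)[of u] abs_ge_self], of "cmod (stft f u)"]
    by (simp add: norm_mult abs_mult mult.commute)
  then show "AE u in lborel. norm (stft f u * h u) \<le> norm (K * cmod (stft f u))" by simp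
qed (use assms(2) in simp)

lemma cmod_gker_bound: "cmod (gker u (z :: 'n::finite phase_space)) \<le> gnorm TYPE('n)"
  using cmod_cinner_le[of "tf_shift u gaussian" "tf_shift z gaussian"]
  by (simp add: gker_def norm_gaussian_squared[symmetric] power2_eq_square)

text \<open>Expanding V f by the reproducing formula makes the factor \<open>gker p w\<close> part
  of a product of two kernels, so the Lipschitz bound for products applies under the integral. One
  of its two factors c is used up by the formula.\<close>

lemma stft_gker_lipschitz:
  fixes f :: "'n::finite L2"
  assumes f: "f \<in> feichtinger" and pz: "norm (p - z) \<le> 1"
  shows "cmod (stft f p * gker p w - stft f z * gker z w)
    \<le> norm (p - z) * (gnorm TYPE('n) * exp (34 * pi)) * (smear f z * psi (w - z))"
proof -
  let ?c = "gnorm TYPE('n)"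
  have c: "?c > 0" by (rule gnorm_pos)
  have int: "integrable lborel (stft f)" using f by (simp add: mem_feichtinger_iff)
  have i: "integrable lborel (\<lambda>u. stft f u * (gker u p * gker p w))" for p
  proof (rule integrable_stft_gker[OF f, where K = "?c * ?c"])
    show "cmod (gker u p * gker p w) \<le> ?c * ?c" for u
      unfolding norm_mult by (intro mult_mono cmod_gker_bound) (use c in auto)
  qed simp
  have r: "complex_of_real ?c * (stft f p * gker p w) = (LINT u|lborel. stft f u * (gker u p * gker p w))" for p
  proof -
    have "complex_of_real ?c * (stft f p * gker p w) = (LINT u|lborel. stft f u * gker u p) * gker p w"
      by (simp add: reproducing_formula[OF f, symmetric])
    then show ?thesis by (simp add: mult.assoc flip: integral_mult_left_zero)
  qed
  have "?c * cmod (stft f p * gker p w - stft f z * gker z w)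
      = cmod (complex_of_real ?c * (stft f p * gker p w) - complex_of_real ?c * (stft f z * gker z w))"
    using c by (simp add: norm_mult flip: right_diff_distrib)
  also have "\<dots> = cmod (LINT u|lborel. stft f u * (gker u p * gker p w) - stft f u * (gker u z * gker z w))"
    unfolding r using i by simp
  also have "\<dots> \<le> (LINT u|lborel. cmod (stft f u * (gker u p * gker p w) - stft f u * (gker u z * gker z w)))"
    by (rule integral_norm_bound)
  also have "\<dots> \<le> (LINT u|lborel. (norm (p - z) * (?c\<^sup>2 * exp (34 * pi)) * psi (w - z)) * (cmod (stft f u) * psi (u - z)))"
  proof (rule integral_mono')
    show "integrable lborel (\<lambda>u. (norm (p - z) * (?c\<^sup>2 * exp (34 * pi)) * psi (w - z)) * (cmod (stft f u) * psi (u - z)))"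
      by (intro integrable_mult_right convolution_integrable(1) integrable_norm int integrable_psi) (auto simp: psi_le_1)
    show "cmod (stft f u * (gker u p * gker p w) - stft f u * (gker u z * gker z w))
      \<le> (norm (p - z) * (?c\<^sup>2 * exp (34 * pi)) * psi (w - z)) * (cmod (stft f u) * psi (u - z))" for u
      using mult_left_mono[OF gker_mult_lipschitz[OF pz, of u w], of "cmod (stft f u)"]
      unfolding right_diff_distrib[symmetric] norm_mult by (simp add: mult_ac)
  qed simp
  also have "\<dots> = ?c * (norm (p - z) * (?c * exp (34 * pi)) * (smear f z * psi (w - z)))"
    by (simp add: smear_def power2_eq_square)
  finally show ?thesis using c by (simp only: mult_le_cancel_left_pos)
qed

section \<open>Sampling along lattice translates and Riemann sums over cells\<close>

lemma has_sum_partition: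
  fixes g :: "'a \<Rightarrow> 'b::{banach, second_countable_topology}"
  assumes I: "countable I" and A: "\<And>j. j \<in> I \<Longrightarrow> A j \<in> sets M" "disjoint_family_on A I" "(\<Union>j\<in>I. A j) = space M"
    and g: "integrable M g"
  shows "((\<lambda>j. LINT x|M. indicator (A j) x *\<^sub>R g x) has_sum (LINT x|M. g x)) I"
proof -
  \<comment> \<open>The countable family is renumbered by the naturals, with the empty set at
    numbers that belong to no index. Dominated convergence then applies to the partial sums, and
    absolute summability allows the return to an unordered sum over \<open>I\<close>.\<close>
  define B where "B n = (\<Union>j\<in>{j\<in>I. to_nat_on I j = n}. A j)" for n
  have BA: "B (to_nat_on I j) = A j" if "j \<in> I" for j
    using inj_on_to_nat_on[OF I] that unfolding B_def by (auto dest: inj_onD)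
  have B0: "B n = {}" if "n \<notin> to_nat_on I ` I" for n
    using that by (auto simp: B_def)
  have Bm: "B n \<in> sets M" for n
    using A(1) BA B0 by (metis imageE sets.empty_sets)
  have Bd: "disjoint_family B"
    unfolding disjoint_family_on_def
  proof (intro ballI impI equals0I)
    fix m n x assume mn: "m \<noteq> n" "x \<in> B m \<inter> B n"
    then obtain j k where jk: "j \<in> I" "k \<in> I" "to_nat_on I j = m" "to_nat_on I k = n" "x \<in> A j" "x \<in> A k"
      by (auto simp: B_def)
    then have "j \<noteq> k" using mn(1) by auto
    then show False using disjoint_family_onD[OF A(2) jk(1,2)] jk(5,6) by auto
  qed
  have BU: "(\<Union>n. B n) = space M"
    unfolding A(3)[symmetric] B_def by auto
  have int: "integrable M (\<lambda>x. indicat_real (B n) x *\<^sub>R g x)"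
    "integrable M (\<lambda>x. indicat_real (B n) x * norm (g x))" for n
    using integrable_mult_indicator[OF Bm g, of n] integrable_mult_indicator[OF Bm integrable_norm[OF g], of n] by simp_all
  have fsum: "(\<Sum>n<m. indicat_real (B n) x) = indicat_real (\<Union>n<m. B n) x" for m x
    using Bd by (subst indicator_UN_disjoint) (auto intro: disjoint_family_on_mono)
  have "summable (\<lambda>n. LINT x|M. indicat_real (B n) x * norm (g x))"
  proof (rule bounded_imp_summable)
    fix m
    show "0 \<le> (LINT x|M. indicat_real (B m) x * norm (g x))" by (intro integral_nonneg_AE) auto
    have "(\<Sum>n\<le>m. LINT x|M. indicat_real (B n) x * norm (g x)) = (LINT x|M. (\<Sum>n<Suc m. indicat_real (B n) x) * norm (g x))"
      using int(2)
      by (simp only: sum_distrib_right lessThan_Suc_atMost) (subst Bochner_Integration.integral_sum, auto)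
    also have "\<dots> \<le> (LINT x|M. norm (g x))"
      unfolding fsum by (rule integral_mono') (use g in \<open>auto split: split_indicator\<close>)
    finally show "(\<Sum>n\<le>m. LINT x|M. indicat_real (B n) x * norm (g x)) \<le> (LINT x|M. norm (g x))" .
  qed
  then have norm_sum: "summable (\<lambda>n. norm (LINT x|M. indicator (B n) x *\<^sub>R g x))"
  proof (rule summable_comparison_test'[of _ 0])
    show "norm (norm (LINT x|M. indicat_real (B n) x *\<^sub>R g x)) \<le> (LINT x|M. indicat_real (B n) x * norm (g x))" for n
      using integral_norm_bound[of M "\<lambda>x. indicat_real (B n) x *\<^sub>R g x"] by simp
  qed
  have "(\<lambda>m. LINT x|M. (\<Sum>n<m. indicat_real (B n) x) *\<^sub>R g x) \<longlonglongrightarrow> (LINT x|M. g x)"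
  proof (rule integral_dominated_convergence[where w = "\<lambda>x. norm (g x)"])
    show "AE x in M. (\<lambda>m. (\<Sum>n<m. indicat_real (B n) x) *\<^sub>R g x) \<longlonglongrightarrow> g x"
    proof (rule AE_I2)
      fix x assume "x \<in> space M"
      then obtain n where n: "x \<in> B n" using BU by blast
      then have "(\<Sum>n<m. indicat_real (B n) x) *\<^sub>R g x = g x" if "m \<ge> Suc n" for m
        using that unfolding fsum by (auto simp: indicator_def)
      then show "(\<lambda>m. (\<Sum>n<m. indicat_real (B n) x) *\<^sub>R g x) \<longlonglongrightarrow> g x"
        by (intro tendsto_eventually) (auto simp: eventually_sequentially)
    qed
    show "AE x in M. norm ((\<Sum>n<m. indicat_real (B n) x) *\<^sub>R g x) \<le> norm (g x)" for m
      unfolding fsum by (auto split: split_indicator)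
  qed (use g Bm in auto)
  moreover have "(LINT x|M. (\<Sum>n<m. indicat_real (B n) x) *\<^sub>R g x) = (\<Sum>n<m. LINT x|M. indicator (B n) x *\<^sub>R g x)" for m
    unfolding scaleR_sum_left using int(1) by (subst Bochner_Integration.integral_sum) auto
  ultimately have "(\<lambda>n. LINT x|M. indicator (B n) x *\<^sub>R g x) sums (LINT x|M. g x)"
    by (simp add: sums_def)
  then have "((\<lambda>n. LINT x|M. indicator (B n) x *\<^sub>R g x) has_sum (LINT x|M. g x)) UNIV"
    by (rule norm_summable_imp_has_sum[OF norm_sum])
  then have "((\<lambda>n. LINT x|M. indicator (B n) x *\<^sub>R g x) has_sum (LINT x|M. g x)) (to_nat_on I ` I)"
    using B0 by (subst has_sum_cong_neutral[where T = UNIV and g = "\<lambda>n. LINT x|M. indicator (B n) x *\<^sub>R g x"]) auto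
  then have "((\<lambda>j. LINT x|M. indicator (B (to_nat_on I j)) x *\<^sub>R g x) has_sum (LINT x|M. g x)) I"
    by (subst (asm) has_sum_reindex[OF inj_on_to_nat_on[OF I]]) (simp add: comp_def)
  then show ?thesis
    by (rule has_sum_cong[THEN iffD1, rotated]) (simp add: BA)
qed


lemma uniform_discrete_imp_countable:
  fixes S :: "'a::heine_borel set"
  assumes "uniform_discrete S"
  shows "countable S"
proof -
  have "finite (S \<inter> cball a (real n))" for a n
    using assms uniform_discrete_finite_iff[of "S \<inter> cball a (real n)"]
    by (metis (mono_tags, lifting) Int_iff bounded_Int bounded_cball uniform_discrete_def)
  then have "countable (\<Union>n::nat. S \<inter> cball undefined (real n))"
    by (intro countable_UN countable_finite countableI_type)
  moreover have "(\<Union>n::nat. S \<inter> cball undefined (real n)) = S"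
    using real_arch_simple by auto
  ultimately show ?thesis by simp
qed

text \<open>The balls of radius \<open>r\<close> around the points x - Y are disjoint, and each
  sample is at most a constant times the value of \<open>smear f\<close> anywhere in its ball.
  Integrating over the balls bounds every finite sum by a multiple of the integral of
  \<open>smear f\<close>.\<close>

lemma sampling_summable:
  fixes f :: "'n::finite L2"
  assumes f: "f \<in> feichtinger" and G: "subgroup_set \<Gamma>"
    and e: "e > 0" "\<And>Y. Y \<in> \<Gamma> \<Longrightarrow> norm Y < e \<Longrightarrow> Y = 0"
  shows "(\<lambda>Y. cmod (stft f (x - Y))) summable_on \<Gamma>"
proof (rule nonneg_bdd_above_summable_on)
  interpret subgroup_set \<Gamma> by (rule G)
  \<comment> \<open>r \<le> 1 keeps the balls within the range of \<open>stft_le_smear\<close>; 2 r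
    \<le> e makes them disjoint.\<close>
  define r where "r = min 1 (e / 2)"
  have r: "r > 0" "r \<le> 1" "2 * r \<le> e" using e(1) by (auto simp: r_def)
  define v where "v = measure lborel (ball (0 :: 'n phase_space) r)"
  have fin: "emeasure lborel (ball (y :: 'n phase_space) r) < \<infinity>" for y by (rule emeasure_lborel_ball_finite)
  have v: "measure lborel (ball y r) = v" for y :: "'n phase_space"
    unfolding v_def by (simp only: content_ball[OF less_imp_le[OF r(1)]])
  have "v > 0" unfolding v_def using r(1) by (simp add: content_ball_pos)
  have sm: "integrable lborel (smear f)" by (rule smear_integrable[OF f])
  show "bdd_above (sum (\<lambda>Y. cmod (stft f (x - Y))) ` {F. F \<subseteq> \<Gamma> \<and> finite F})"
  proof (rule bdd_aboveI2)
    fix F assume "F \<in> {F. F \<subseteq> \<Gamma> \<and> finite F}"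
    then have F: "F \<subseteq> \<Gamma>" "finite F" by auto
    let ?B = "\<lambda>Y. ball (x - Y) r"
    have disj: "disjoint_family_on ?B F"
      unfolding disjoint_family_on_def
    proof (intro ballI impI equals0I)
      fix Y Z z assume YZ: "Y \<in> F" "Z \<in> F" "Y \<noteq> Z" "z \<in> ?B Y \<inter> ?B Z"
      then have "dist (x - Y) (x - Z) < e"
        using dist_triangle_less_add[of "x - Y" z r "x - Z" r] r(3) by (simp add: dist_commute)
      then have "norm (Y - Z) < e" by (simp add: dist_norm norm_minus_commute)
      then show False using e(2)[OF diff_mem, of Y Z] YZ F by auto
    qed
    have ii: "integrable lborel (\<lambda>z. indicat_real (?B Y) z * smear f z)" for Y
      using integrable_mult_indicator[OF _ sm, of "?B Y"] by simp
    have "v * (\<Sum>Y\<in>F. cmod (stft f (x - Y))) = (\<Sum>Y\<in>F. LINT z|lborel. indicat_real (?B Y) z * cmod (stft f (x - Y)))"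
      by (simp add: v sum_distrib_left fin mult.commute)
    also have "\<dots> \<le> (\<Sum>Y\<in>F. LINT z|lborel. exp (pi / 2) * (indicat_real (?B Y) z * smear f z))"
    proof (rule sum_mono, rule integral_mono')
      fix Y z
      show "indicat_real (?B Y) z * cmod (stft f (x - Y)) \<le> exp (pi / 2) * (indicat_real (?B Y) z * smear f z)"
        using stft_le_smear[OF f, of "x - Y" z] r(2) by (auto simp: indicator_def dist_norm)
    qed (use ii in auto)
    also have "\<dots> = exp (pi / 2) * (LINT z|lborel. (\<Sum>Y\<in>F. indicat_real (?B Y) z) * smear f z)"
      using ii by (simp add: sum_distrib_left[symmetric] sum_distrib_right Bochner_Integration.integral_sum)
    also have "\<dots> \<le> exp (pi / 2) * (LINT z|lborel. smear f z)"
    proof (intro mult_left_mono integral_mono'[OF sm])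
      fix z
      have "(\<Sum>Y\<in>F. indicat_real (?B Y) z) = indicat_real (\<Union>Y\<in>F. ?B Y) z"
        by (rule indicator_UN_disjoint[OF F(2) disj, symmetric])
      then show "(\<Sum>Y\<in>F. indicat_real (?B Y) z) * smear f z \<le> smear f z"
        by (simp only:) (auto split: split_indicator)
    qed auto
    finally show "(\<Sum>Y\<in>F. cmod (stft f (x - Y))) \<le> exp (pi / 2) * (LINT z|lborel. smear f z) / v"
      using \<open>v > 0\<close> by (simp add: field_simps)
  qed
qed simp

text \<open>The translates of the cells by \<open>\<Gamma>\<close> partition phase space, so the
  reproducing integral splits into pieces. On each piece the integrand differs from its value at the
  sample point by at most \<open>\<delta>\<close> times an integrable majorant, and these errors add
  up to one integral of the majorant.\<close>

lemma riemann_sum_bound: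
  fixes f :: "'n::finite L2" and X :: "nat \<Rightarrow> 'n phase_space"
  assumes f: "f \<in> feichtinger" and G: "subgroup_set \<Gamma>"
    and e: "e > 0" "\<And>Y. Y \<in> \<Gamma> \<Longrightarrow> norm Y < e \<Longrightarrow> Y = 0"
    and \<delta>: "\<delta> \<le> 1"
    and D: "\<And>i. D i \<in> sets borel" "\<And>i. D i \<subseteq> ball (X i) \<delta>"
      "\<And>z. \<exists>i<n. \<exists>l\<in>\<Gamma>. z - l \<in> D i"
      "\<And>z i j l m. \<lbrakk>l \<in> \<Gamma>; m \<in> \<Gamma>; z - l \<in> D i; z - m \<in> D j\<rbrakk> \<Longrightarrow> i = j \<and> l = m"
  shows "cmod ((\<Sum>i<n. complex_of_real (measure lborel (D i)) * (\<Sum>\<^sub>\<infinity>Y\<in>\<Gamma>. stft f (X i - Y) * gker (X i - Y) w))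
      - complex_of_real (gnorm TYPE('n)) * stft f w)
    \<le> \<delta> * (gnorm TYPE('n) * exp (34 * pi)) * (LINT z|lborel. smear f z * psi (z - w))"
proof -
  interpret subgroup_set \<Gamma> by (rule G)
  let ?c = "gnorm TYPE('n)"
  have sm: "integrable lborel (smear f)" by (rule smear_integrable[OF f])
  define I where "I = {..<n} \<times> \<Gamma>"
  define A where "A p = {z. z + snd p \<in> D (fst p)}" for p :: "nat \<times> 'n phase_space"
  have "uniform_discrete \<Gamma>" using e by (rule uniform_discrete_if_separated)
  then have "countable \<Gamma>" by (rule uniform_discrete_imp_countable)
  then have I: "countable I" unfolding I_def by (intro countable_SIGMA) auto
  have Aeq: "A p = (\<lambda>z. z + snd p) -` D (fst p) \<inter> space lborel" for p by (auto simp: A_def)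
  have Am: "A p \<in> sets lborel" for p
    unfolding Aeq by (rule measurable_sets[where A = borel]) (use D(1) in auto)
  have Adisj: "disjoint_family_on A I"
    unfolding disjoint_family_on_def
  proof (intro ballI impI equals0I)
    fix p q z assume pq: "p \<in> I" "q \<in> I" "p \<noteq> q" "z \<in> A p \<inter> A q"
    \<comment> \<open>The cells are addressed by z - l and the pieces by z + Y, hence the passage to
      negatives.\<close>
    then have "- snd p \<in> \<Gamma>" "- snd q \<in> \<Gamma>" by (auto simp only: I_def mem_Times_iff uminus_mem)
    then have "fst p = fst q \<and> - snd p = - snd q"
      by (rule D(4)[of _ _ z]) (use pq(4) in \<open>simp_all add: A_def\<close>)
    then show False using pq(3) by (auto simp: prod_eq_iff)
  qed
  have AU: "(\<Union>p\<in>I. A p) = space lborel"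
  proof -
    have "z \<in> (\<Union>p\<in>I. A p)" for z
    proof -
      obtain i l where il: "i < n" "l \<in> \<Gamma>" "z - l \<in> D i" using D(3) by blast
      then show ?thesis by (intro UN_I[of "(i, - l)"]) (simp_all add: I_def A_def uminus_mem)
    qed
    then show ?thesis by auto
  qed
  have Amea: "measure lborel (A p) = measure lborel (D (fst p))" "emeasure lborel (A p) < \<infinity>" for p
  proof -
    have "emeasure lborel (D (fst p)) = emeasure (distr lborel borel (\<lambda>z. snd p + z)) (D (fst p))"
      by (simp only: lborel_distr_plus)
    also have "\<dots> = emeasure lborel (A p)"
      using D(1) by (subst emeasure_distr) (auto simp: A_def add.commute vimage_def)
    finally have eq: "emeasure lborel (D (fst p)) = emeasure lborel (A p)" .
    then show "measure lborel (A p) = measure lborel (D (fst p))" by (simp add: measure_def)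
    have "emeasure lborel (D (fst p)) \<le> emeasure lborel (ball (X (fst p)) \<delta>)"
      by (rule emeasure_mono[OF D(2)]) simp
    also have "\<dots> < \<infinity>" by (rule emeasure_lborel_ball_finite)
    finally show "emeasure lborel (A p) < \<infinity>" by (simp add: eq)
  qed
  define g where "g z = stft f z * gker z w" for z
  have [measurable]: "g \<in> borel_measurable borel" unfolding g_def by measurable
  have gi: "integrable lborel g"
    unfolding g_def by (rule integrable_stft_gker[OF f _ cmod_gker_bound]) simp
  define K where "K = \<delta> * (?c * exp (34 * pi))"
  define h where "h z = K * (smear f z * psi (z - w))" for z
  have hi: "integrable lborel h"
    unfolding h_def
    by (intro integrable_mult_right convolution_integrable(1) sm integrable_psi) (auto simp: psi_le_1)
  define s where "s p = complex_of_real (measure lborel (D (fst p))) * (stft f (X (fst p) - snd p) * gker (X (fst p) - snd p) w)" for p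
  define G where "G p = (LINT z|lborel. indicator (A p) z *\<^sub>R g z)" for p
  define H where "H p = (LINT z|lborel. indicator (A p) z *\<^sub>R h z)" for p
  have Gsum: "(G has_sum (complex_of_real ?c * stft f w)) I"
    unfolding G_def reproducing_formula[OF f] g_def[symmetric]
    by (rule has_sum_partition[OF I Am Adisj AU gi])
  have Hsum: "(H has_sum (LINT z|lborel. h z)) I"
    unfolding H_def by (rule has_sum_partition[OF I Am Adisj AU hi])
  have sGH: "cmod (s p - G p) \<le> H p" for p
  proof -
    let ?P = "X (fst p) - snd p"
    have ig: "integrable lborel (\<lambda>z. indicat_real (A p) z *\<^sub>R g z)"
      by (rule integrable_mult_indicator[OF Am gi])
    have iA: "integrable lborel (\<lambda>z. indicat_real (A p) z *\<^sub>R g ?P)"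
      using Am Amea(2) by (intro integrable_scaleR_left integrable_real_indicator) auto
    have "s p = (LINT z|lborel. indicat_real (A p) z *\<^sub>R g ?P)"
      using Am Amea by (simp add: s_def g_def scaleR_conv_of_real)
    then have "s p - G p = (LINT z|lborel. indicat_real (A p) z *\<^sub>R g ?P - indicat_real (A p) z *\<^sub>R g z)"
      unfolding G_def using ig iA by simp
    then have "cmod (s p - G p) \<le> (LINT z|lborel. cmod (indicat_real (A p) z *\<^sub>R g ?P - indicat_real (A p) z *\<^sub>R g z))"
      by (simp only: integral_norm_bound)
    also have "\<dots> \<le> H p"
      unfolding H_def
    proof (rule integral_mono)
      show "integrable lborel (\<lambda>z. cmod (indicat_real (A p) z *\<^sub>R g ?P - indicat_real (A p) z *\<^sub>R g z))"
        using ig iA by (intro integrable_norm Bochner_Integration.integrable_diff)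
      show "integrable lborel (\<lambda>z. indicat_real (A p) z *\<^sub>R h z)"
        by (rule integrable_mult_indicator[OF Am hi])
      fix z
      show "cmod (indicat_real (A p) z *\<^sub>R g ?P - indicat_real (A p) z *\<^sub>R g z) \<le> indicat_real (A p) z *\<^sub>R h z"
      proof (cases "z \<in> A p")
        case True
        then have "dist (X (fst p)) (z + snd p) < \<delta>" using D(2)[of "fst p"] by (auto simp: A_def)
        then have d: "norm (?P - z) \<le> \<delta>" by (simp add: dist_norm diff_diff_eq add.commute)
        have "cmod (g ?P - g z) \<le> norm (?P - z) * (?c * exp (34 * pi)) * (smear f z * psi (w - z))"
          unfolding g_def by (rule stft_gker_lipschitz[OF f]) (use d \<delta> in simp)
        also have "\<dots> \<le> \<delta> * (?c * exp (34 * pi)) * (smear f z * psi (w - z))"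
          using d by (intro mult_right_mono) auto
        finally show ?thesis using True by (simp add: h_def K_def psi_minus_commute[of w])
      qed simp
    qed
    finally show ?thesis .
  qed
  have abs: "(\<lambda>p. cmod (s p - G p)) summable_on I"
    by (rule summable_on_comparison_test[OF has_sum_imp_summable[OF Hsum]]) (use sGH in auto)
  define E where "E = infsum (\<lambda>p. s p - G p) I"
  have Esum: "((\<lambda>p. s p - G p) has_sum E) I"
    unfolding E_def by (rule has_sum_infsum[OF abs_summable_summable[OF abs]])
  have "cmod E \<le> infsum (\<lambda>p. cmod (s p - G p)) I"
    unfolding E_def using abs by (rule norm_infsum_bound)
  also have "\<dots> \<le> (LINT z|lborel. h z)"
    using has_sum_mono[OF has_sum_infsum[OF abs] Hsum] sGH by blast
  finally have Eb: "cmod E \<le> (LINT z|lborel. h z)" .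
  \<comment> \<open>Summability of the sample terms is a consequence: they are the sum of the
    absolutely summable errors and the integrals over the pieces.\<close>
  have "(s has_sum (E + complex_of_real ?c * stft f w)) I"
    using has_sum_add[OF Esum Gsum] by simp
  then have sI: "s summable_on I" "infsum s I = E + complex_of_real ?c * stft f w"
    by (auto simp: has_sum_iff)
  have "infsum s I = (\<Sum>\<^sub>\<infinity>i\<in>{..<n}. \<Sum>\<^sub>\<infinity>Y\<in>\<Gamma>. s (i, Y))"
    using sI(1) unfolding I_def by (rule infsum_Sigma_banach[symmetric])
  also have "\<dots> = (\<Sum>i<n. complex_of_real (measure lborel (D i)) * (\<Sum>\<^sub>\<infinity>Y\<in>\<Gamma>. stft f (X i - Y) * gker (X i - Y) w))"
    by (simp add: s_def infsum_cmult_right')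
  finally have sums: "infsum s I = \<dots>" .
  from Eb show ?thesis
    unfolding sums[symmetric] sI(2) by (simp add: h_def K_def)
qed

section \<open>The twisted group algebra and its action\<close>

lemma free_right_module_simps [simp]:
  "carrier (free_right_module R n) = {..<n} \<rightarrow>\<^sub>E carrier R"
  "\<zero>\<^bsub>free_right_module R n\<^esub> = (\<lambda>i\<in>{..<n}. \<zero>\<^bsub>R\<^esub>)"
  "v \<oplus>\<^bsub>free_right_module R n\<^esub> w = (\<lambda>i\<in>{..<n}. v i \<oplus>\<^bsub>R\<^esub> w i)"
  "ract (free_right_module R n) v a = (\<lambda>i\<in>{..<n}. v i \<otimes>\<^bsub>R\<^esub> a)"
  by (simp_all add: free_right_module_def)

lemma abelian_group_free_right_module:
  assumes "abelian_group R"
  shows "abelian_group (free_right_module R n)"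
proof -
  interpret abelian_group R by (rule assms)
  show ?thesis
  proof (rule abelian_groupI)
    fix x assume x: "x \<in> carrier (free_right_module R n)"
    show "\<exists>y\<in>carrier (free_right_module R n). y \<oplus>\<^bsub>free_right_module R n\<^esub> x = \<zero>\<^bsub>free_right_module R n\<^esub>"
      by (rule bexI[of _ "\<lambda>i\<in>{..<n}. \<ominus>\<^bsub>R\<^esub> x i"]) (use x in \<open>auto simp: fun_eq_iff PiE_iff l_neg restrict_def extensional_def\<close>)
  qed (auto simp: fun_eq_iff PiE_iff extensional_def restrict_def a_ac)
qed

text \<open>An additive map sends zero to an element that equals its own double, so this is how
  additive maps are seen to preserve zero.\<close>

lemma (in abelian_group) zero_if_idem: "x \<in> carrier G \<Longrightarrow> x \<oplus> x = x \<Longrightarrow> x = \<zero>"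
  by (metis add.l_cancel_one)

text \<open>The projection of \<open>R^n\<close> onto the summand is \<open>C (D C)\<^sup>-\<^sup>1 D\<close>.\<close>

lemma fin_gen_projectiveI:
  fixes R :: "('a, 'r) ring_scheme" and M :: "('a, 'b, 'm) right_module_scheme" and n :: nat
  assumes M: "right_module R M"
    and C: "\<And>x i. x \<in> carrier M \<Longrightarrow> i < n \<Longrightarrow> C i x \<in> carrier R"
    and C_add: "\<And>x y i. x \<in> carrier M \<Longrightarrow> y \<in> carrier M \<Longrightarrow> i < n \<Longrightarrow> C i (x \<oplus>\<^bsub>M\<^esub> y) = C i x \<oplus>\<^bsub>R\<^esub> C i y"
    and C_act: "\<And>x a i. x \<in> carrier M \<Longrightarrow> a \<in> carrier R \<Longrightarrow> i < n \<Longrightarrow> C i (ract M x a) = C i x \<otimes>\<^bsub>R\<^esub> a"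
    and D: "\<And>v. v \<in> {..<n} \<rightarrow>\<^sub>E carrier R \<Longrightarrow> D v \<in> carrier M"
    and D_add: "\<And>v w. v \<in> {..<n} \<rightarrow>\<^sub>E carrier R \<Longrightarrow> w \<in> {..<n} \<rightarrow>\<^sub>E carrier R \<Longrightarrow>
        D (\<lambda>i\<in>{..<n}. v i \<oplus>\<^bsub>R\<^esub> w i) = D v \<oplus>\<^bsub>M\<^esub> D w"
    and D_act: "\<And>v a. v \<in> {..<n} \<rightarrow>\<^sub>E carrier R \<Longrightarrow> a \<in> carrier R \<Longrightarrow>
        D (\<lambda>i\<in>{..<n}. v i \<otimes>\<^bsub>R\<^esub> a) = ract M (D v) a"
    and bij: "bij_betw (\<lambda>x. D (\<lambda>i\<in>{..<n}. C i x)) (carrier M) (carrier M)"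
  shows "fin_gen_projective R M"
proof -
  interpret right_module R M by (rule M)
  let ?F = "free_right_module R n"
  let ?z = "\<zero>\<^bsub>M\<^esub>" and ?o = "\<zero>\<^bsub>?F\<^esub>"
  interpret F: abelian_group ?F
    by (rule abelian_group_free_right_module) (rule R.abelian_group_axioms)
  define h where "h x = (\<lambda>i\<in>{..<n}. C i x)" for x
  define P where "P = h ` carrier M"
  define Q where "Q = {v \<in> carrier ?F. D v = ?z}"
  have hF: "h x \<in> carrier ?F" if "x \<in> carrier M" for x
    using C[OF that] by (simp add: h_def)
  have h_add: "h (x \<oplus>\<^bsub>M\<^esub> y) = h x \<oplus>\<^bsub>?F\<^esub> h y" if "x \<in> carrier M" "y \<in> carrier M" for x y
    using C_add[OF that] by (auto simp: h_def fun_eq_iff)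
  have h_act: "h (ract M x a) = ract ?F (h x) a" if "x \<in> carrier M" "a \<in> carrier R" for x a
    using C_act[OF that] by (auto simp: h_def fun_eq_iff)
  have DM: "D v \<in> carrier M" if "v \<in> carrier ?F" for v using D that by simp
  have D_add': "D (v \<oplus>\<^bsub>?F\<^esub> w) = D v \<oplus>\<^bsub>M\<^esub> D w" if "v \<in> carrier ?F" "w \<in> carrier ?F" for v w
    using D_add that by simp
  have D_act': "D (ract ?F v a) = ract M (D v) a" if "v \<in> carrier ?F" "a \<in> carrier R" for v a
    using D_act that by simp
  have h0: "h ?z = ?o"
    using h_add[of "?z" "?z"] hF[of "?z"] by (intro F.zero_if_idem) simp_all
  have D0: "D ?o = ?z"
    using D_add'[of "?o" "?o"] DM[of "?o"] F.zero_closed F.l_zero[of "?o"]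
    by (intro M.zero_if_idem) (simp_all del: free_right_module_simps)
  have act0: "ract M ?z a = ?z" if "a \<in> carrier R" for a
    using ract_add_left[of "?z" "?z" a] ract_closed[of "?z" a] that by (intro M.zero_if_idem) simp_all
  have bij': "bij_betw (\<lambda>x. D (h x)) (carrier M) (carrier M)" using bij by (simp add: h_def)
  have P: "submodule_of R ?F P"
    unfolding submodule_of_def
  proof (intro conjI ballI)
    show "P \<subseteq> carrier ?F" using hF by (auto simp: P_def)
    show "?o \<in> P" unfolding P_def by (rule image_eqI[of _ _ "?z"]) (simp_all only: h0 M.zero_closed)
    fix x assume "x \<in> P"
    then obtain x' where x': "x' \<in> carrier M" "x = h x'" by (auto simp: P_def)
    show "x \<oplus>\<^bsub>?F\<^esub> y \<in> P" if y: "y \<in> P" for y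
    proof -
      obtain y' where y': "y' \<in> carrier M" "y = h y'" using y by (auto simp: P_def)
      show ?thesis
        unfolding P_def x'(2) y'(2) h_add[OF x'(1) y'(1), symmetric] by (intro imageI M.a_closed x' y')
    qed
    have "\<ominus>\<^bsub>?F\<^esub> x = h (\<ominus>\<^bsub>M\<^esub> x')"
    proof (rule F.minus_equality)
      have "h (\<ominus>\<^bsub>M\<^esub> x') \<oplus>\<^bsub>?F\<^esub> h x' = h (\<ominus>\<^bsub>M\<^esub> x' \<oplus>\<^bsub>M\<^esub> x')"
        using x' h_add[of "\<ominus>\<^bsub>M\<^esub> x'" x'] by simp
      also have "\<dots> = ?o" using x' h0 by (simp add: M.l_neg)
      finally show "h (\<ominus>\<^bsub>M\<^esub> x') \<oplus>\<^bsub>?F\<^esub> x = ?o" using x'(2) by simp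
    qed (use x' hF in auto)
    then show "\<ominus>\<^bsub>?F\<^esub> x \<in> P" using x'(1) by (auto simp: P_def)
    fix a assume "a \<in> carrier R"
    then show "ract ?F x a \<in> P"
      using x' h_act[of x' a] ract_closed[of x' a] unfolding P_def by (metis imageI)
  qed
  have Q: "submodule_of R ?F Q"
    unfolding submodule_of_def
  proof (intro conjI ballI)
    show "Q \<subseteq> carrier ?F" by (auto simp: Q_def)
    show "?o \<in> Q" using D0 F.zero_closed by (simp add: Q_def del: free_right_module_simps)
    fix x assume x: "x \<in> Q"
    then have xF: "x \<in> carrier ?F" "D x = ?z" by (auto simp: Q_def)
    show "x \<oplus>\<^bsub>?F\<^esub> y \<in> Q" if y: "y \<in> Q" for y
    proof -
      have yF: "y \<in> carrier ?F" "D y = ?z" using y by (auto simp: Q_def)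
      have "D (x \<oplus>\<^bsub>?F\<^esub> y) = ?z"
        unfolding D_add'[OF xF(1) yF(1)] xF(2) yF(2) by (rule M.l_zero[OF M.zero_closed])
      then show ?thesis unfolding Q_def using F.a_closed[OF xF(1) yF(1)] by blast
    qed
    have "D (\<ominus>\<^bsub>?F\<^esub> x) = ?z"
      using D_add'[OF F.a_inv_closed[OF xF(1)] xF(1)] DM[OF F.a_inv_closed[OF xF(1)]]
      unfolding F.l_neg[OF xF(1)] D0 xF(2) by (metis M.r_zero)
    then show "\<ominus>\<^bsub>?F\<^esub> x \<in> Q" unfolding Q_def using F.a_inv_closed[OF xF(1)] by blast
    fix a assume a: "a \<in> carrier R"
    have "ract ?F x a \<in> carrier ?F" using xF(1) a by (auto simp: PiE_iff)
    moreover have "D (ract ?F x a) = ?z"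
      unfolding D_act'[OF xF(1) a] xF(2) by (rule act0[OF a])
    ultimately show "ract ?F x a \<in> Q" unfolding Q_def by blast
  qed
  have "P <+>\<^bsub>?F\<^esub> Q = carrier ?F"
  proof (intro equalityI subsetI)
    fix v assume "v \<in> P <+>\<^bsub>?F\<^esub> Q"
    then obtain p q where "p \<in> P" "q \<in> Q" "v = p \<oplus>\<^bsub>?F\<^esub> q"
      unfolding set_add_def set_mult_def by (auto simp del: free_right_module_simps)
    then show "v \<in> carrier ?F"
      using P Q F.a_closed[of p q] unfolding submodule_of_def by blast
  next
    \<comment> \<open>Surjectivity of D \<circ> h provides x such that h x has the same image under
      \<open>D\<close> as v; the remainder after removing h x is then killed by
      \<open>D\<close>.\<close>
    fix v assume v: "v \<in> carrier ?F"
    then obtain x where x: "x \<in> carrier M" "D (h x) = D v"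
      using bij_betw_imp_surj_on[OF bij'] DM[OF v] by (metis (no_types, lifting) imageE)
    define q where "q = \<ominus>\<^bsub>?F\<^esub> h x \<oplus>\<^bsub>?F\<^esub> v"
    have hx: "h x \<in> carrier ?F" by (rule hF[OF x(1)])
    have qF: "q \<in> carrier ?F" unfolding q_def by (intro F.a_closed F.a_inv_closed hx v)
    have vq: "v = h x \<oplus>\<^bsub>?F\<^esub> q"
      unfolding q_def by (rule F.r_neg2[OF hx v, symmetric])
    then have "D v = D v \<oplus>\<^bsub>M\<^esub> D q" using D_add'[OF hx qF] x(2) by metis
    then have "D v \<oplus>\<^bsub>M\<^esub> D q = D v \<oplus>\<^bsub>M\<^esub> ?z" unfolding M.r_zero[OF DM[OF v]] by (rule sym)
    then have "D q = ?z"
      using M.r_neg1[OF DM[OF v] DM[OF qF]] M.r_neg1[OF DM[OF v] M.zero_closed] by argo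
    then have "q \<in> Q" unfolding Q_def using qF by blast
    moreover have "h x \<in> P" using x(1) by (simp add: P_def)
    ultimately show "v \<in> P <+>\<^bsub>?F\<^esub> Q"
      unfolding set_add_def set_mult_def using vq by (auto simp del: free_right_module_simps)
  qed
  moreover have "P \<inter> Q = {?o}"
  proof (intro equalityI subsetI)
    fix v assume "v \<in> P \<inter> Q"
    then obtain x where x: "x \<in> carrier M" "v = h x" "D (h x) = ?z" by (auto simp: P_def Q_def)
    \<comment> \<open>Injectivity of D \<circ> h makes the intersection of the two summands
      trivial.\<close>
    then have "D (h x) = D (h ?z)" by (simp only: h0 D0)
    then have "x = ?z"
      using bij_betw_imp_inj_on[OF bij'] x(1) M.zero_closed by (metis (no_types, lifting) inj_onD)
    then show "v \<in> {?o}" using x(2) h0 by simp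
  qed (use P Q in \<open>auto simp: submodule_of_def simp del: free_right_module_simps\<close>)
  ultimately have "direct_summand R ?F P"
    using P Q unfolding direct_summand_def by blast
  moreover have "right_module_iso R M (?F\<lparr>carrier := P\<rparr>) h"
    unfolding right_module_iso_def
  proof (intro conjI ballI)
    have "inj_on h (carrier M)"
      using bij_betw_imp_inj_on[OF bij'] by (auto simp: inj_on_def)
    then show "bij_betw h (carrier M) (carrier (?F\<lparr>carrier := P\<rparr>))"
      by (simp add: bij_betw_def P_def)
  qed (use h_add h_act in \<open>simp_all\<close>)
  ultimately show ?thesis
    unfolding fin_gen_projective_def using M by blast
qed

section \<open>Absolutely convergent double sums over a subgroup\<close>

lemma summable_on_times_real:
  fixes f :: "'a \<Rightarrow> real" and g :: "'b \<Rightarrow> real"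
  assumes f: "f summable_on A" "\<And>x. x \<in> A \<Longrightarrow> 0 \<le> f x" and g: "g summable_on B" "\<And>y. y \<in> B \<Longrightarrow> 0 \<le> g y"
  shows "(\<lambda>(x, y). f x * g y) summable_on A \<times> B"
proof (rule nonneg_bdd_above_summable_on)
  show "bdd_above (sum (\<lambda>(x, y). f x * g y) ` {F. F \<subseteq> A \<times> B \<and> finite F})"
  proof (rule bdd_aboveI2)
    fix F assume "F \<in> {F. F \<subseteq> A \<times> B \<and> finite F}"
    then have F: "F \<subseteq> A \<times> B" "finite F" by auto
    then have sub: "fst ` F \<subseteq> A" "snd ` F \<subseteq> B" by auto
    \<comment> \<open>A finite set of pairs lies in the rectangle spanned by its two projections,
      over which the sum factors.\<close>
    have "(\<Sum>(x, y)\<in>F. f x * g y) \<le> (\<Sum>(x, y)\<in>fst ` F \<times> snd ` F. f x * g y)"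
    proof (rule sum_mono2)
      show "F \<subseteq> fst ` F \<times> snd ` F" by force
    qed (use F sub f(2) g(2) in \<open>auto intro!: mult_nonneg_nonneg\<close>)
    also have "\<dots> = sum f (fst ` F) * sum g (snd ` F)"
      by (simp add: sum_product sum.cartesian_product)
    also have "\<dots> \<le> infsum f A * infsum g B"
      using f g sub F(2)
      by (intro mult_mono finite_sum_le_infsum infsum_nonneg sum_nonneg) auto
    finally show "(\<Sum>(x, y)\<in>F. f x * g y) \<le> infsum f A * infsum g B" .
  qed
qed (use f g in auto)

context subgroup_set
begin

lemma bij_shift: "X \<in> \<Lambda> \<Longrightarrow> bij_betw (\<lambda>Y. X - Y) \<Lambda> \<Lambda>"
  by (rule bij_betwI[where g = "\<lambda>Y. X - Y"]) (auto simp: diff_mem)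

lemma bij_shift': "Y \<in> \<Lambda> \<Longrightarrow> bij_betw (\<lambda>Z. Z + Y) \<Lambda> \<Lambda>"
  by (rule bij_betwI[where g = "\<lambda>Z. Z - Y"]) (auto simp: add_mem diff_mem)

text \<open>The change of variables that turns a convolution summed over X into a sum over
  independent pairs.\<close>

lemma bij_convolution: "bij_betw (\<lambda>(X, Y). (Y, X - Y)) (\<Lambda> \<times> \<Lambda>) (\<Lambda> \<times> \<Lambda>)"
  by (rule bij_betwI[where g = "\<lambda>(Y, Z). (Z + Y, Y)"]) (auto simp: add_mem diff_mem)

lemma convolution_summable:
  assumes a: "(\<lambda>X. cmod (a X)) summable_on \<Lambda>" and b: "(\<lambda>X. cmod (b X)) summable_on \<Lambda>"
  shows "(\<lambda>(X, Y). cmod (a Y) * cmod (b (X - Y))) summable_on \<Lambda> \<times> \<Lambda>"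
proof -
  have "(\<lambda>(Y, Z). cmod (a Y) * cmod (b Z)) summable_on \<Lambda> \<times> \<Lambda>"
    using a b by (intro summable_on_times_real) auto
  then have "(\<lambda>p. (\<lambda>(Y, Z). cmod (a Y) * cmod (b Z)) ((\<lambda>(X, Y). (Y, X - Y)) p)) summable_on \<Lambda> \<times> \<Lambda>"
    by (subst summable_on_reindex_bij_betw[OF bij_convolution])
  then show ?thesis by (simp add: case_prod_unfold)
qed

end

section \<open>Adjoint shifts and the right action in explicit form\<close>

definition tf_adj :: "'n::finite phase_space \<Rightarrow> 'n L2 \<Rightarrow> 'n L2" where
  "tf_adj X g = cscale (cnj (beta X (- X))) (tf_shift (- X) g)"

lemma cadjoint_tf_shift_eq: "cadjoint (tf_shift X) = tf_adj X"
  by (simp add: cadjoint_tf_shift tf_adj_def fun_eq_iff)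

lemma tf_shift_tf_adj_same [simp]: "tf_shift X (tf_adj X f) = f"
  by (simp add: tf_adj_def tf_shift_cscale tf_shift_tf_shift)

lemma cinner_tf_adj_right: "cinner f (tf_adj X g) = cinner (tf_shift X f) g"
  using cinner_tf_shift[of X f "tf_adj X g"] by simp

lemma cinner_tf_adj_left: "cinner (tf_adj X f) g = cinner f (tf_shift X g)"
  using cinner_tf_shift[of X "tf_adj X f" g] by simp

lemma tf_adj_add: "tf_adj X (f + g) = tf_adj X f + tf_adj X g"
  and tf_adj_cscale: "tf_adj X (cscale c f) = cscale c (tf_adj X f)"
  and norm_tf_adj [simp]: "norm (tf_adj X f) = norm f"
  by (simp_all add: tf_adj_def tf_shift_add tf_shift_cscale cscale_add_right mult.commute)

lemma bounded_linear_tf_adj: "bounded_linear (tf_adj X)"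
  by (rule bounded_linear_tf_intro) (simp_all add: tf_adj_add tf_adj_cscale)

lemma tf_adj_zero [simp]: "tf_adj 0 f = f"
  by (simp add: tf_adj_def)

text \<open>Taking adjoints reverses the order, and the adjoint of \<pi>(Y) \<pi>(Z) picks up the
  conjugate cocycle. This is why the action is a right one and why the convolution is twisted by the
  conjugate of the cocycle.\<close>

lemma tf_adj_tf_adj: "tf_adj Z (tf_adj Y g) = cscale (cnj (beta Y Z)) (tf_adj (Y + Z) g)"
  by (rule cinner_eqI) (simp add: cinner_tf_adj_right tf_shift_tf_shift cinner_cscale_left)

lemma tf_shift_tf_adj: "tf_shift Y (tf_adj Z f) = cscale (cnj (beta (Y - Z) Z)) (tf_shift (Y - Z) f)"
  using tf_shift_tf_shift[of "Y - Z" Z "tf_adj Z f"] by simp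

text \<open>The phase is kept anonymous because it always occurs inside a modulus or together with
  its conjugate.\<close>

lemma tf_adj_tf_shift_gaussian:
  obtains \<theta> where "cmod \<theta> = 1" "tf_adj Y (tf_shift X gaussian) = cscale \<theta> (tf_shift (X - Y) gaussian)"
  by (rule that[of "cnj (beta Y (- Y)) * beta (- Y) X"]) (simp_all add: tf_adj_def tf_shift_tf_shift norm_mult)

lemma stft_tf_adj: "stft (tf_adj X g) z = cnj (beta X z) * stft g (X + z)"
  by (simp add: stft_def cinner_tf_adj_left tf_shift_tf_shift)

lemma bounded_linear_cscale_left: "bounded_linear (\<lambda>c. cscale c f)"
  by (rule bounded_linear_intro[of _ "norm f"]) (auto simp: cscale_add_left scaleR_cscale scaleR_conv_of_real)

text \<open>Here and in \<open>tconv\<close> the record fields reappear with the definite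
  descriptions of adjoint and cocycle replaced by the closed forms \<open>tf_adj\<close> and
  \<open>beta\<close>.\<close>

definition act :: "'n::finite phase_space set \<Rightarrow> 'n L2 \<Rightarrow> ('n phase_space \<Rightarrow> complex) \<Rightarrow> 'n L2" where
  "act \<Gamma> g b = (\<Sum>\<^sub>\<infinity>X\<in>\<Gamma>. cscale (b X) (tf_adj X g))"

definition l1 :: "'a set \<Rightarrow> ('a \<Rightarrow> complex) set" where
  "l1 \<Gamma> = {b. (\<forall>X. X \<notin> \<Gamma> \<longrightarrow> b X = 0) \<and> (\<lambda>X. cmod (b X)) summable_on \<Gamma>}"

definition tconv :: "'n::finite phase_space set \<Rightarrow> ('n phase_space \<Rightarrow> complex) \<Rightarrow> ('n phase_space \<Rightarrow> complex) \<Rightarrow> 'n phase_space \<Rightarrow> complex" where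
  "tconv \<Gamma> a b X = (if X \<in> \<Gamma> then (\<Sum>\<^sub>\<infinity>Y\<in>\<Gamma>. a Y * b (X - Y) * cnj (beta Y (X - Y))) else 0)"

lemma twisted_l1_simps [simp]:
  "carrier (twisted_l1 \<Gamma>) = l1 \<Gamma>"
  "a \<otimes>\<^bsub>twisted_l1 \<Gamma>\<^esub> b = tconv \<Gamma> a b"
  "\<one>\<^bsub>twisted_l1 \<Gamma>\<^esub> = (\<lambda>X. if X = 0 then 1 else 0)"
  "\<zero>\<^bsub>twisted_l1 \<Gamma>\<^esub> = (\<lambda>X. 0)"
  "a \<oplus>\<^bsub>twisted_l1 \<Gamma>\<^esub> b = (\<lambda>X. a X + b X)"
  by (simp_all add: twisted_l1_def l1_def tconv_def cocycle_eq_beta fun_eq_iff)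

lemma feichtinger_module_simps [simp]:
  "carrier (feichtinger_module \<Gamma>) = feichtinger"
  "\<zero>\<^bsub>feichtinger_module \<Gamma>\<^esub> = 0"
  "f \<oplus>\<^bsub>feichtinger_module \<Gamma>\<^esub> g = f + g"
  "ract (feichtinger_module \<Gamma>) g b = act \<Gamma> g b"
  by (simp_all add: feichtinger_module_def act_def cadjoint_tf_shift_eq)

lemma infsum_single:
  fixes f :: "'a \<Rightarrow> 'b::{comm_monoid_add, t2_space}"
  assumes "i \<in> A" "\<And>j. j \<in> A \<Longrightarrow> j \<noteq> i \<Longrightarrow> f j = 0"
  shows "infsum f A = f i"
proof -
  have "infsum f A = infsum f {i}"
    by (rule infsum_cong_neutral) (use assms in auto)
  then show ?thesis by simp
qed

lemma l1_summable: "b \<in> l1 \<Gamma> \<Longrightarrow> (\<lambda>X. cmod (b X)) summable_on \<Gamma>"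
  and l1_zero: "b \<in> l1 \<Gamma> \<Longrightarrow> X \<notin> \<Gamma> \<Longrightarrow> b X = 0"
  by (auto simp: l1_def)

lemma l1_bounded:
  assumes "b \<in> l1 \<Gamma>"
  shows "cmod (b X) \<le> (\<Sum>\<^sub>\<infinity>X\<in>\<Gamma>. cmod (b X))"
proof (cases "X \<in> \<Gamma>")
  case True
  then show ?thesis
    using finite_sum_le_infsum[OF l1_summable[OF assms], of "{X}"] by simp
next
  case False
  then show ?thesis using l1_zero[OF assms False] by (simp add: infsum_nonneg)
qed

lemma l1_mult_bounded_summable:
  fixes c :: "'a \<Rightarrow> complex"
  assumes "b \<in> l1 \<Gamma>" "\<And>X. X \<in> \<Gamma> \<Longrightarrow> cmod (c X) \<le> K"
  shows "(\<lambda>X. cmod (b X * c X)) summable_on \<Gamma>"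
proof (rule summable_on_comparison_test)
  show "(\<lambda>X. cmod (b X) * K) summable_on \<Gamma>"
    by (intro summable_on_cmult_left l1_summable assms(1))
  show "cmod (b X * c X) \<le> cmod (b X) * K" if "X \<in> \<Gamma>" for X
    using assms(2)[OF that] by (simp add: norm_mult mult_left_mono)
qed auto

lemma l1_add: "a \<in> l1 \<Gamma> \<Longrightarrow> b \<in> l1 \<Gamma> \<Longrightarrow> (\<lambda>X. a X + b X) \<in> l1 \<Gamma>"
proof -
  assume a: "a \<in> l1 \<Gamma>" and b: "b \<in> l1 \<Gamma>"
  have "(\<lambda>X. cmod (a X + b X)) summable_on \<Gamma>"
    by (rule summable_on_comparison_test[OF summable_on_add[OF l1_summable[OF a] l1_summable[OF b]]])
      (auto intro: norm_triangle_ineq)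
  then show ?thesis using a b by (simp add: l1_def)
qed

lemma zero_mem_l1: "(\<lambda>X. 0) \<in> l1 \<Gamma>"
  by (simp add: l1_def)

lemma l1_cmult: "a \<in> l1 \<Gamma> \<Longrightarrow> (\<lambda>X. c * a X) \<in> l1 \<Gamma>"
  by (auto simp: l1_def norm_mult intro: summable_on_cmult_right)

lemma feichtinger_add: "f \<in> feichtinger \<Longrightarrow> g \<in> feichtinger \<Longrightarrow> f + g \<in> feichtinger"
  by (simp add: mem_feichtinger_iff stft_add[abs_def])

lemma feichtinger_cscale: "f \<in> feichtinger \<Longrightarrow> cscale c f \<in> feichtinger"
  by (simp add: mem_feichtinger_iff stft_cscale[abs_def])

lemma zero_mem_feichtinger: "(0 :: 'n::finite L2) \<in> feichtinger"
  by (simp add: mem_feichtinger_iff stft_zero[abs_def])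

text \<open>Countability of \<open>\<Gamma>\<close> allows the sum over \<open>\<Gamma>\<close> to
  be exchanged with the Lebesgue integral when Feichtinger's algebra is shown to be stable under the
  action.\<close>

locale tf_group = subgroup_set \<Gamma> for \<Gamma> :: "'n::finite phase_space set" +
  assumes countable: "countable \<Gamma>"
begin

section \<open>Ring laws and module laws\<close>

lemma tconv_row:
  assumes a: "a \<in> l1 \<Gamma>" and b: "b \<in> l1 \<Gamma>"
  shows "(\<lambda>Y. cmod (a Y * b (X - Y) * cnj (beta Y (X - Y)))) summable_on \<Gamma>"
    and "(\<lambda>Y. a Y * b (X - Y) * cnj (beta Y (X - Y))) summable_on \<Gamma>"
proof -
  have "(\<lambda>Y. cmod (a Y * (b (X - Y) * cnj (beta Y (X - Y))))) summable_on \<Gamma>"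
    by (rule l1_mult_bounded_summable[OF a, where K = "\<Sum>\<^sub>\<infinity>X\<in>\<Gamma>. cmod (b X)"]) (simp add: norm_mult l1_bounded[OF b])
  then show "(\<lambda>Y. cmod (a Y * b (X - Y) * cnj (beta Y (X - Y)))) summable_on \<Gamma>"
    by (simp add: mult.assoc)
  then show "(\<lambda>Y. a Y * b (X - Y) * cnj (beta Y (X - Y))) summable_on \<Gamma>"
    by (rule abs_summable_summable)
qed

lemma tconv_closed:
  assumes a: "a \<in> l1 \<Gamma>" and b: "b \<in> l1 \<Gamma>"
  shows "tconv \<Gamma> a b \<in> l1 \<Gamma>"
proof -
  have "(\<lambda>X. \<Sum>\<^sub>\<infinity>Y\<in>\<Gamma>. cmod (a Y) * cmod (b (X - Y))) summable_on \<Gamma>"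
    by (rule summable_on_Sigma_banach) (rule convolution_summable[OF l1_summable[OF a] l1_summable[OF b]])
  then have "(\<lambda>X. cmod (tconv \<Gamma> a b X)) summable_on \<Gamma>"
  proof (rule summable_on_comparison_test)
    fix X assume "X \<in> \<Gamma>"
    then show "cmod (tconv \<Gamma> a b X) \<le> (\<Sum>\<^sub>\<infinity>Y\<in>\<Gamma>. cmod (a Y) * cmod (b (X - Y)))"
      using norm_infsum_bound[OF tconv_row(1)[OF a b, of X]] by (simp add: tconv_def norm_mult)
  qed simp
  then show ?thesis by (simp add: l1_def tconv_def)
qed

text \<open>Both sides are iterated sums of one absolutely summable family \<open>G\<close>; after
  exchanging the sums, the substitution Y = W + Z in the inner one and the cocycle identity produce
  the other bracketing.\<close>

lemma tconv_assoc:
  assumes a: "a \<in> l1 \<Gamma>" and b: "b \<in> l1 \<Gamma>" and c: "c \<in> l1 \<Gamma>"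
  shows "tconv \<Gamma> (tconv \<Gamma> a b) c = tconv \<Gamma> a (tconv \<Gamma> b c)"
proof
  fix X
  show "tconv \<Gamma> (tconv \<Gamma> a b) c X = tconv \<Gamma> a (tconv \<Gamma> b c) X"
  proof (cases "X \<in> \<Gamma>")
    case X: True
    define G where "G Y Z = a Z * b (Y - Z) * c (X - Y) * cnj (beta Z (Y - Z)) * cnj (beta Y (X - Y))" for Y Z
    have "(\<lambda>p. cmod (case p of (Y, Z) \<Rightarrow> G Y Z)) summable_on \<Gamma> \<times> \<Gamma>"
    proof (rule summable_on_comparison_test)
      let ?K = "\<Sum>\<^sub>\<infinity>X\<in>\<Gamma>. cmod (c X)"
      show "(\<lambda>p. (case p of (Y, Z) \<Rightarrow> cmod (a Z) * cmod (b (Y - Z))) * ?K) summable_on \<Gamma> \<times> \<Gamma>"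
        by (intro summable_on_cmult_left convolution_summable l1_summable a b)
      show "cmod (case p of (Y, Z) \<Rightarrow> G Y Z) \<le> (case p of (Y, Z) \<Rightarrow> cmod (a Z) * cmod (b (Y - Z))) * ?K" for p
        using l1_bounded[OF c] by (cases p) (simp add: G_def norm_mult mult_left_mono)
    qed simp
    then have G: "(\<lambda>(Y, Z). G Y Z) summable_on \<Gamma> \<times> \<Gamma>"
      by (rule abs_summable_summable)
    have "tconv \<Gamma> (tconv \<Gamma> a b) c X = (\<Sum>\<^sub>\<infinity>Y\<in>\<Gamma>. \<Sum>\<^sub>\<infinity>Z\<in>\<Gamma>. G Y Z)"
    proof -
      have "tconv \<Gamma> a b Y * c (X - Y) * cnj (beta Y (X - Y)) = (\<Sum>\<^sub>\<infinity>Z\<in>\<Gamma>. G Y Z)" if "Y \<in> \<Gamma>" for Y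
      proof -
        have "tconv \<Gamma> a b Y * (c (X - Y) * cnj (beta Y (X - Y)))
            = (\<Sum>\<^sub>\<infinity>Z\<in>\<Gamma>. a Z * b (Y - Z) * cnj (beta Z (Y - Z)) * (c (X - Y) * cnj (beta Y (X - Y))))"
          using that by (simp add: tconv_def infsum_cmult_left')
        also have "\<dots> = (\<Sum>\<^sub>\<infinity>Z\<in>\<Gamma>. G Y Z)" by (rule infsum_cong) (simp add: G_def mult_ac)
        finally show ?thesis by (simp add: mult.assoc)
      qed
      then show ?thesis using X by (simp add: tconv_def[of \<Gamma> "tconv \<Gamma> a b"] cong: infsum_cong)
    qed
    also have "\<dots> = (\<Sum>\<^sub>\<infinity>Z\<in>\<Gamma>. \<Sum>\<^sub>\<infinity>Y\<in>\<Gamma>. G Y Z)"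
      by (rule infsum_swap_banach[OF G])
    also have "\<dots> = tconv \<Gamma> a (tconv \<Gamma> b c) X"
    proof -
      have "(\<Sum>\<^sub>\<infinity>Y\<in>\<Gamma>. G Y Z) = a Z * tconv \<Gamma> b c (X - Z) * cnj (beta Z (X - Z))" if Z: "Z \<in> \<Gamma>" for Z
      proof -
        have "G (W + Z) Z = a Z * cnj (beta Z (X - Z)) * (b W * c (X - Z - W) * cnj (beta W (X - Z - W)))" for W
        proof -
          \<comment> \<open>The 2-cocycle identity for Z, W and X - Z - W, here a consequence of
            multiplicativity of \<open>beta\<close> in each argument.\<close>
          have "beta Z W * beta (W + Z) (X - (W + Z)) = beta Z (X - Z) * beta W (X - Z - W)"
            using beta_add_right[of Z W "X - Z - W"] by (simp add: beta_add_left diff_diff_eq add.commute)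
          then have "cnj (beta Z W) * cnj (beta (W + Z) (X - (W + Z))) = cnj (beta Z (X - Z)) * cnj (beta W (X - Z - W))"
            by (metis complex_cnj_mult)
          then show ?thesis by (simp add: G_def diff_diff_eq add.commute mult_ac)
        qed
        then have "(\<Sum>\<^sub>\<infinity>Y\<in>\<Gamma>. G Y Z) = (\<Sum>\<^sub>\<infinity>W\<in>\<Gamma>. a Z * cnj (beta Z (X - Z)) * (b W * c (X - Z - W) * cnj (beta W (X - Z - W))))"
          by (subst infsum_reindex_bij_betw[OF bij_shift'[OF Z], symmetric]) simp
        also have "\<dots> = a Z * cnj (beta Z (X - Z)) * tconv \<Gamma> b c (X - Z)"
          using diff_mem[OF X Z] by (simp add: tconv_def infsum_cmult_right')
        finally show ?thesis by (simp add: mult_ac)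
      qed
      then show ?thesis using X by (simp add: tconv_def[of \<Gamma> a "tconv \<Gamma> b c"] cong: infsum_cong)
    qed
    finally show ?thesis .
  qed (simp add: tconv_def)
qed

lemma tconv_one_left: "b \<in> l1 \<Gamma> \<Longrightarrow> tconv \<Gamma> (\<lambda>X. if X = 0 then 1 else 0) b = b"
  and tconv_one_right: "b \<in> l1 \<Gamma> \<Longrightarrow> tconv \<Gamma> b (\<lambda>X. if X = 0 then 1 else 0) = b"
proof -
  assume b: "b \<in> l1 \<Gamma>"
  have "tconv \<Gamma> (\<lambda>X. if X = 0 then 1 else 0) b X = b X" for X
    using l1_zero[OF b, of X]
    by (auto simp: tconv_def infsum_single[OF zero_mem])
  then show "tconv \<Gamma> (\<lambda>X. if X = 0 then 1 else 0) b = b" by blast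
  have "tconv \<Gamma> b (\<lambda>X. if X = 0 then 1 else 0) X = b X" for X
    using l1_zero[OF b, of X]
    by (auto simp: tconv_def infsum_single[of X])
  then show "tconv \<Gamma> b (\<lambda>X. if X = 0 then 1 else 0) = b" by blast
qed

lemma one_mem_l1: "(\<lambda>X. if X = 0 then 1 else 0) \<in> l1 \<Gamma>"
proof -
  have "(\<lambda>X. cmod (if X = 0 then 1 else 0)) summable_on \<Gamma>"
    by (subst summable_on_cong_neutral[where T = "{0}" and g = "\<lambda>X. 1"]) (auto simp: zero_mem)
  then show ?thesis using zero_mem by (auto simp: l1_def)
qed

lemma tconv_add_left:
  assumes "a \<in> l1 \<Gamma>" "a' \<in> l1 \<Gamma>" "b \<in> l1 \<Gamma>"
  shows "tconv \<Gamma> (\<lambda>X. a X + a' X) b = (\<lambda>X. tconv \<Gamma> a b X + tconv \<Gamma> a' b X)"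
  using tconv_row(2)[OF assms(1,3)] tconv_row(2)[OF assms(2,3)]
  by (auto simp: tconv_def fun_eq_iff distrib_right infsum_add)

lemma tconv_add_right:
  assumes "a \<in> l1 \<Gamma>" "b \<in> l1 \<Gamma>" "b' \<in> l1 \<Gamma>"
  shows "tconv \<Gamma> a (\<lambda>X. b X + b' X) = (\<lambda>X. tconv \<Gamma> a b X + tconv \<Gamma> a b' X)"
  using tconv_row(2)[OF assms(1,2)] tconv_row(2)[OF assms(1,3)]
  by (auto simp: tconv_def fun_eq_iff distrib_right distrib_left infsum_add)

lemma ring_twisted_l1: "ring (twisted_l1 \<Gamma>)"
proof (rule ringI)
  show "abelian_group (twisted_l1 \<Gamma>)"
  proof (rule abelian_groupI)
    fix x assume "x \<in> carrier (twisted_l1 \<Gamma>)"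
    then show "\<exists>y\<in>carrier (twisted_l1 \<Gamma>). y \<oplus>\<^bsub>twisted_l1 \<Gamma>\<^esub> x = \<zero>\<^bsub>twisted_l1 \<Gamma>\<^esub>"
      using l1_cmult[of x \<Gamma> "- 1"] by (intro bexI[of _ "\<lambda>X. - 1 * x X"]) auto
  qed (auto simp: l1_add zero_mem_l1 ac_simps)
  show "monoid (twisted_l1 \<Gamma>)"
    by (rule monoidI) (simp_all add: tconv_closed tconv_assoc tconv_one_left tconv_one_right one_mem_l1)
qed (simp_all add: tconv_add_left tconv_add_right)

lemma act_abs_summable:
  assumes "b \<in> l1 \<Gamma>"
  shows "(\<lambda>X. norm (cscale (b X) (tf_adj X g))) summable_on \<Gamma>"
  using l1_summable[OF assms] by (simp add: summable_on_cmult_left)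

lemma act_has_sum:
  assumes "b \<in> l1 \<Gamma>"
  shows "((\<lambda>X. cscale (b X) (tf_adj X g)) has_sum act \<Gamma> g b) \<Gamma>"
  unfolding act_def by (rule has_sum_infsum[OF abs_summable_summable[OF act_abs_summable[OF assms]]])

lemma act_bounded_linear:
  assumes "b \<in> l1 \<Gamma>" "bounded_linear h"
  shows "h (act \<Gamma> g b) = (\<Sum>\<^sub>\<infinity>X\<in>\<Gamma>. h (cscale (b X) (tf_adj X g)))"
  by (rule infsumI[OF has_sum_bounded_linear[OF assms(2) act_has_sum[OF assms(1)]], symmetric])

lemma stft_act:
  assumes "b \<in> l1 \<Gamma>"
  shows "stft (act \<Gamma> g b) z = (\<Sum>\<^sub>\<infinity>X\<in>\<Gamma>. b X * stft (tf_adj X g) z)"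
  using act_bounded_linear[OF assms bounded_linear_stft] by (simp add: stft_cscale)

text \<open>V of the result is dominated by the sum of |b X| times a translate of |V g|; integrating
  termwise and using translation invariance leaves the l^1 norm of \<open>b\<close> times the L^1
  norm of V g.\<close>

lemma act_closed:
  assumes g: "g \<in> feichtinger" and b: "b \<in> l1 \<Gamma>"
  shows "act \<Gamma> g b \<in> feichtinger"
proof -
  have int: "integrable lborel (stft g)" using g by (simp add: mem_feichtinger_iff)
  define N where "N = (\<integral>\<^sup>+z. ennreal (cmod (stft g z)) \<partial>lborel)"
  have N: "N < \<infinity>" using int by (simp add: N_def integrable_iff_bounded)
  have bound: "cmod (stft g z) \<le> norm g * norm (gaussian :: 'n L2)" for z
    unfolding stft_def using cmod_cinner_le[of g "tf_shift z gaussian"] by simp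
  \<comment> \<open>Nonnegative sums become integrals over the counting measure, so that Tonelli
    applies in the extended reals and no integrability has to be known in advance.\<close>
  have nonneg_sum: "ennreal (infsum h \<Gamma>) = (\<integral>\<^sup>+X. ennreal (h X) \<partial>count_space \<Gamma>)"
    if "h summable_on \<Gamma>" "\<And>X. X \<in> \<Gamma> \<Longrightarrow> 0 \<le> h X" for h :: "'n phase_space \<Rightarrow> real"
  proof -
    have "(\<lambda>x. norm (h x)) summable_on \<Gamma>"
      using that by (subst summable_on_cong[of _ _ h]) auto
    then have "Infinite_Set_Sum.abs_summable_on h \<Gamma>" by (rule abs_summable_equivalent[THEN iffD1])
    then show ?thesis using nn_integral_conv_infsetsum[of h \<Gamma>] that(2) by (simp add: infsetsum_infsum)
  qed
  have "(\<integral>\<^sup>+z. ennreal (cmod (stft (act \<Gamma> g b) z)) \<partial>lborel)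
      \<le> (\<integral>\<^sup>+z. (\<integral>\<^sup>+X. ennreal (cmod (b X) * cmod (stft g (X + z))) \<partial>count_space \<Gamma>) \<partial>lborel)"
  proof (rule nn_integral_mono)
    fix z
    have eq: "cmod (b X * stft (tf_adj X g) z) = cmod (b X) * cmod (stft g (X + z))" for X
      by (simp add: stft_tf_adj norm_mult)
    have s: "(\<lambda>X. cmod (b X * stft (tf_adj X g) z)) summable_on \<Gamma>"
      by (rule l1_mult_bounded_summable[OF b, where K = "norm g * norm (gaussian :: 'n L2)"]) (simp add: stft_tf_adj norm_mult bound)
    have "cmod (stft (act \<Gamma> g b) z) \<le> (\<Sum>\<^sub>\<infinity>X\<in>\<Gamma>. cmod (b X * stft (tf_adj X g) z))"
      unfolding stft_act[OF b] by (rule norm_infsum_bound[OF s])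
    then have "ennreal (cmod (stft (act \<Gamma> g b) z)) \<le> ennreal (\<Sum>\<^sub>\<infinity>X\<in>\<Gamma>. cmod (b X * stft (tf_adj X g) z))"
      by (rule ennreal_leI)
    also have "\<dots> = (\<integral>\<^sup>+X. ennreal (cmod (b X * stft (tf_adj X g) z)) \<partial>count_space \<Gamma>)"
      by (rule nonneg_sum[OF s]) simp
    finally show "ennreal (cmod (stft (act \<Gamma> g b) z)) \<le> (\<integral>\<^sup>+X. ennreal (cmod (b X) * cmod (stft g (X + z))) \<partial>count_space \<Gamma>)"
      by (simp only: eq)
  qed
  also have "\<dots> = (\<integral>\<^sup>+X. (\<integral>\<^sup>+z. ennreal (cmod (b X) * cmod (stft g (X + z))) \<partial>lborel) \<partial>count_space \<Gamma>)"
    by (rule nn_integral_count_space_nn_integral[OF countable]) measurable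
  also have "\<dots> = (\<integral>\<^sup>+X. ennreal (cmod (b X)) * N \<partial>count_space \<Gamma>)"
  proof (rule nn_integral_cong)
    fix X
    have "N = (\<integral>\<^sup>+z. ennreal (cmod (stft g (X + z))) \<partial>lborel)"
      unfolding N_def by (subst lborel_nn_integral_affine[of 1 _ X]) simp_all
    then show "(\<integral>\<^sup>+z. ennreal (cmod (b X) * cmod (stft g (X + z))) \<partial>lborel) = ennreal (cmod (b X)) * N"
      by (simp add: ennreal_mult nn_integral_cmult)
  qed
  also have "\<dots> = ennreal (\<Sum>\<^sub>\<infinity>X\<in>\<Gamma>. cmod (b X)) * N"
    by (simp add: nn_integral_multc nonneg_sum[OF l1_summable[OF b]])
  also have "\<dots> < \<infinity>" using N by (simp add: ennreal_mult_less_top)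
  finally show ?thesis by (simp add: mem_feichtinger_iff integrable_iff_bounded)
qed

lemma act_add_left: "b \<in> l1 \<Gamma> \<Longrightarrow> act \<Gamma> (f + g) b = act \<Gamma> f b + act \<Gamma> g b"
  using has_sum_add[OF act_has_sum[of b f] act_has_sum[of b g]]
  unfolding act_def[of _ "f + g"] by (intro infsumI) (simp add: tf_adj_add cscale_add_right)

lemma act_add_right: "a \<in> l1 \<Gamma> \<Longrightarrow> b \<in> l1 \<Gamma> \<Longrightarrow> act \<Gamma> g (\<lambda>X. a X + b X) = act \<Gamma> g a + act \<Gamma> g b"
  using has_sum_add[OF act_has_sum[of a g] act_has_sum[of b g]]
  unfolding act_def[of _ g "\<lambda>X. a X + b X"] by (intro infsumI) (simp add: cscale_add_left)

lemma act_cscale: "b \<in> l1 \<Gamma> \<Longrightarrow> act \<Gamma> (cscale c g) b = cscale c (act \<Gamma> g b)"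
  using act_bounded_linear[of b "cscale c" g, OF _ bounded_linear_cscale]
  by (simp add: act_def tf_adj_cscale mult.commute)

lemma act_one: "act \<Gamma> g (\<lambda>X. if X = 0 then 1 else 0) = g"
  unfolding act_def by (subst infsum_single[OF zero_mem]) auto

text \<open>Both sides sum the family \<open>G\<close> over all pairs (Y, W): the left one along the
  fibres of Y + W, the right one as an iterated sum with W as the outer variable.\<close>

lemma act_assoc:
  assumes a: "a \<in> l1 \<Gamma>" and b: "b \<in> l1 \<Gamma>"
  shows "act \<Gamma> g (tconv \<Gamma> a b) = act \<Gamma> (act \<Gamma> g a) b"
proof -
  define G where "G Y W = cscale (a Y * b W * cnj (beta Y W)) (tf_adj (Y + W) g)" for Y W
  have nG: "norm (G Y W) = cmod (a Y) * cmod (b W) * norm g" for Y W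
    by (simp add: G_def norm_mult)
  have "(\<lambda>p. (case p of (Y, W) \<Rightarrow> cmod (a Y) * cmod (b W)) * norm g) summable_on \<Gamma> \<times> \<Gamma>"
    by (intro summable_on_cmult_left summable_on_times_real l1_summable a b) auto
  then have "(\<lambda>p. norm (case p of (Y, W) \<Rightarrow> G Y W)) summable_on \<Gamma> \<times> \<Gamma>"
    by (simp add: nG case_prod_unfold)
  then have G: "(\<lambda>(Y, W). G Y W) summable_on \<Gamma> \<times> \<Gamma>"
    by (rule abs_summable_summable)
  then have "(\<lambda>p. (\<lambda>(Y, W). G Y W) ((\<lambda>(X, Y). (Y, X - Y)) p)) summable_on \<Gamma> \<times> \<Gamma>"
    by (subst summable_on_reindex_bij_betw[OF bij_convolution])
  then have G': "(\<lambda>(X, Y). G Y (X - Y)) summable_on \<Gamma> \<times> \<Gamma>"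
    by (simp add: case_prod_unfold)
  have "act \<Gamma> g (tconv \<Gamma> a b) = (\<Sum>\<^sub>\<infinity>X\<in>\<Gamma>. \<Sum>\<^sub>\<infinity>Y\<in>\<Gamma>. G Y (X - Y))"
    unfolding act_def
  proof (rule infsum_cong)
    fix X assume X: "X \<in> \<Gamma>"
    have "cscale (tconv \<Gamma> a b X) (tf_adj X g) = (\<Sum>\<^sub>\<infinity>Y\<in>\<Gamma>. cscale (a Y * b (X - Y) * cnj (beta Y (X - Y))) (tf_adj X g))"
      using has_sum_bounded_linear[OF bounded_linear_cscale_left[of "tf_adj X g"] has_sum_infsum[OF tconv_row(2)[OF a b, of X]]] X
      by (simp add: tconv_def infsumI)
    then show "cscale (tconv \<Gamma> a b X) (tf_adj X g) = (\<Sum>\<^sub>\<infinity>Y\<in>\<Gamma>. G Y (X - Y))"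
      by (simp add: G_def)
  qed
  also have "\<dots> = infsum (\<lambda>(X, Y). G Y (X - Y)) (\<Gamma> \<times> \<Gamma>)"
    by (rule infsum_Sigma'_banach[OF G'])
  also have "\<dots> = infsum (\<lambda>p. (\<lambda>(Y, W). G Y W) ((\<lambda>(X, Y). (Y, X - Y)) p)) (\<Gamma> \<times> \<Gamma>)"
    by (simp add: case_prod_unfold)
  also have "\<dots> = infsum (\<lambda>(Y, W). G Y W) (\<Gamma> \<times> \<Gamma>)"
    by (rule infsum_reindex_bij_betw[OF bij_convolution])
  also have "\<dots> = (\<Sum>\<^sub>\<infinity>Y\<in>\<Gamma>. \<Sum>\<^sub>\<infinity>W\<in>\<Gamma>. G Y W)"
    by (rule infsum_Sigma'_banach[OF G, symmetric])
  also have "\<dots> = (\<Sum>\<^sub>\<infinity>W\<in>\<Gamma>. \<Sum>\<^sub>\<infinity>Y\<in>\<Gamma>. G Y W)"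
    by (rule infsum_swap_banach[OF G])
  also have "\<dots> = act \<Gamma> (act \<Gamma> g a) b"
    unfolding act_def[of _ _ b]
  proof (rule infsum_cong)
    fix W
    have "cscale (b W) (tf_adj W (act \<Gamma> g a)) = (\<Sum>\<^sub>\<infinity>Y\<in>\<Gamma>. cscale (b W) (tf_adj W (cscale (a Y) (tf_adj Y g))))"
      by (rule act_bounded_linear[OF a bounded_linear_compose[OF bounded_linear_cscale bounded_linear_tf_adj]])
    also have "\<dots> = (\<Sum>\<^sub>\<infinity>Y\<in>\<Gamma>. G Y W)"
      by (rule infsum_cong) (simp add: G_def tf_adj_cscale tf_adj_tf_adj mult_ac)
    finally show "(\<Sum>\<^sub>\<infinity>Y\<in>\<Gamma>. G Y W) = cscale (b W) (tf_adj W (act \<Gamma> g a))" ..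
  qed
  finally show ?thesis .
qed

lemma right_module_feichtinger: "right_module (twisted_l1 \<Gamma>) (feichtinger_module \<Gamma>)"
proof (intro right_module.intro right_module_axioms.intro ring_twisted_l1)
  show "abelian_group (feichtinger_module \<Gamma>)"
  proof (rule abelian_groupI)
    fix x assume "x \<in> carrier (feichtinger_module \<Gamma>)"
    then show "\<exists>y\<in>carrier (feichtinger_module \<Gamma>). y \<oplus>\<^bsub>feichtinger_module \<Gamma>\<^esub> x = \<zero>\<^bsub>feichtinger_module \<Gamma>\<^esub>"
      using feichtinger_cscale[of x "- 1"] by (intro bexI[of _ "- x"]) (auto simp: uminus_L2_def[symmetric])
  qed (auto simp: feichtinger_add zero_mem_feichtinger ac_simps)
qed (simp_all add: act_closed act_add_left act_add_right act_assoc act_one)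

end

section \<open>Invertibility of the frame operator\<close>

lemma stft_sum: "stft (sum g I) z = (\<Sum>i\<in>I. stft (g i) z)"
  by (rule linear_sum[OF bounded_linear.linear[OF bounded_linear_stft]])

definition feichtinger_norm :: "'n::finite L2 \<Rightarrow> real" where
  "feichtinger_norm f = (LINT z|lborel. cmod (stft f z))"

lemma feichtinger_norm_nonneg [simp]: "0 \<le> feichtinger_norm f"
  by (simp add: feichtinger_norm_def)

lemma feichtinger_norm_add_le:
  assumes "f \<in> feichtinger" "g \<in> feichtinger"
  shows "feichtinger_norm (f + g) \<le> feichtinger_norm f + feichtinger_norm g"
proof -
  have i: "integrable lborel (stft f)" "integrable lborel (stft g)" using assms by (simp_all add: mem_feichtinger_iff)
  have "feichtinger_norm (f + g) \<le> (LINT z|lborel. cmod (stft f z) + cmod (stft g z))"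
    unfolding feichtinger_norm_def stft_add
    by (rule integral_mono') (use i in \<open>auto intro: norm_triangle_ineq\<close>)
  then show ?thesis using i by (simp add: feichtinger_norm_def)
qed

lemma feichtinger_norm_cscale: "feichtinger_norm (cscale c f) = cmod c * feichtinger_norm f"
  by (simp add: feichtinger_norm_def stft_cscale norm_mult)

lemma feichtinger_norm_diff_le:
  assumes "f \<in> feichtinger" "g \<in> feichtinger"
  shows "feichtinger_norm (f - g) \<le> feichtinger_norm f + feichtinger_norm g"
  using feichtinger_norm_add_le[OF assms(1) feichtinger_cscale[OF assms(2), of "- 1"]] feichtinger_norm_cscale[of "- 1" g]
  by (simp add: minus_L2_def uminus_L2_def)

lemma feichtinger_diff: "f \<in> feichtinger \<Longrightarrow> g \<in> feichtinger \<Longrightarrow> f - g \<in> feichtinger"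
  by (simp add: minus_L2_def uminus_L2_def feichtinger_add feichtinger_cscale)

lemma cmod_stft_le:
  fixes f :: "'n::finite L2"
  shows "cmod (stft f z) \<le> norm f * norm (gaussian :: 'n L2)"
  unfolding stft_def using cmod_cinner_le[of f "tf_shift z gaussian"] by simp

text \<open>Inversion with g = f gives c |f|^2 as the integral of |V f|^2, which is at most sup |V
  f| times the L^1 norm of V f; the supremum is at most |f| |\<phi>|, and one factor |f|
  cancels.\<close>

lemma norm_le_feichtinger_norm:
  fixes f :: "'n::finite L2"
  assumes f: "f \<in> feichtinger"
  shows "gnorm TYPE('n) * norm f \<le> norm (gaussian :: 'n L2) * feichtinger_norm f"
proof (cases "f = 0")
  case False
  have int: "integrable lborel (stft f)" using f by (simp add: mem_feichtinger_iff)
  have "gnorm TYPE('n) * norm f * norm f = cmod (complex_of_real (gnorm TYPE('n)) * cinner f f)"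
    by (simp add: norm_L2_squared norm_mult norm_power power2_eq_square)
  also have "\<dots> \<le> (LINT z|lborel. cmod (stft f z * cnj (stft f z)))"
    unfolding feichtinger_inversion[OF f] by (rule integral_norm_bound)
  also have "\<dots> \<le> (LINT z|lborel. norm (gaussian :: 'n L2) * norm f * cmod (stft f z))"
  proof (rule integral_mono')
    show "cmod (stft f z * cnj (stft f z)) \<le> norm (gaussian :: 'n L2) * norm f * cmod (stft f z)" for z
      using mult_right_mono[OF cmod_stft_le[of f z], of "cmod (stft f z)"] by (simp add: norm_mult mult_ac)
  qed (use int in auto)
  also have "\<dots> = norm (gaussian :: 'n L2) * feichtinger_norm f * norm f"
    by (simp add: feichtinger_norm_def mult_ac)
  finally show ?thesis by (rule mult_right_le_imp_le) (use False in simp)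
qed simp

lemma eq_zero_if_feichtinger_norm_zero:
  fixes f :: "'n::finite L2"
  assumes "f \<in> feichtinger" "feichtinger_norm f \<le> 0"
  shows "f = 0"
proof -
  have "feichtinger_norm f = 0" using assms(2) by (simp add: order_antisym)
  then have "gnorm TYPE('n) * norm f \<le> 0"
    using norm_le_feichtinger_norm[OF assms(1)] by simp
  then show ?thesis using gnorm_pos[where 'n='n] by (simp add: mult_le_0_iff)
qed

text \<open>Just enough completeness for a geometric series. The sum is formed in the Hilbert space,
  whose norm is controlled by the Feichtinger norm; V passes through it pointwise, and exchanging
  sum and integral for |V (u j)| bounds the L^1 norm by the sum of the majorants.\<close>

lemma feichtinger_complete:
  fixes u :: "nat \<Rightarrow> 'n::finite L2"
  assumes u: "\<And>j. u j \<in> feichtinger" and A: "\<And>j. feichtinger_norm (u j) \<le> A * (1/2) ^ j"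
  shows "summable u" "suminf u \<in> feichtinger" "feichtinger_norm (suminf u) \<le> 2 * A"
proof -
  define B where "B = norm (gaussian :: 'n L2) / gnorm TYPE('n)"
  have c: "gnorm TYPE('n) > 0" by (rule gnorm_pos)
  have "B \<ge> 0" by (simp add: B_def)
  have nu: "norm (u j) \<le> B * A * (1/2) ^ j" for j
  proof -
    have "norm (u j) \<le> B * feichtinger_norm (u j)"
      using norm_le_feichtinger_norm[OF u[of j]] c by (simp add: B_def field_simps)
    also have "\<dots> \<le> B * (A * (1/2) ^ j)" using A \<open>B \<ge> 0\<close> by (intro mult_left_mono)
    finally show ?thesis by (simp add: mult.assoc)
  qed
  have geo: "summable (\<lambda>j. C * (1/2) ^ j :: real)" for C by (intro summable_mult summable_geometric) simp
  have sn: "summable (\<lambda>j. norm (u j))"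
    by (rule summable_comparison_test'[OF geo[of "B * A"], of 0]) (use nu in simp)
  then show su: "summable u" by (rule summable_norm_cancel)
  have ss: "summable (\<lambda>j. cmod (stft (u j) z))" for z
    by (rule summable_comparison_test'[OF summable_mult2[OF sn, of "norm (gaussian :: 'n L2)"], of 0]) (simp add: cmod_stft_le)
  have st: "cmod (stft (suminf u) z) \<le> (\<Sum>j. cmod (stft (u j) z))" for z
  proof -
    have "stft (suminf u) z = (\<Sum>j. stft (u j) z)"
      using bounded_linear.suminf[OF bounded_linear_stft su, of z] by simp
    then show ?thesis using summable_norm[OF ss] by simp
  qed
  have "A \<ge> 0" using order_trans[OF feichtinger_norm_nonneg A[of 0]] by simp
  have "(\<integral>\<^sup>+z. ennreal (cmod (stft (suminf u) z)) \<partial>lborel) \<le> (\<integral>\<^sup>+z. (\<Sum>j. ennreal (cmod (stft (u j) z))) \<partial>lborel)"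
    using st ss by (intro nn_integral_mono) (simp add: suminf_ennreal2 ennreal_leI)
  also have "\<dots> = (\<Sum>j. \<integral>\<^sup>+z. ennreal (cmod (stft (u j) z)) \<partial>lborel)"
    by (rule nn_integral_suminf) measurable
  also have "\<dots> \<le> (\<Sum>j. ennreal (A * (1/2) ^ j))"
  proof (rule suminf_le)
    fix j
    have "(\<integral>\<^sup>+z. ennreal (cmod (stft (u j) z)) \<partial>lborel) = ennreal (feichtinger_norm (u j))"
      unfolding feichtinger_norm_def using u[of j] by (intro nn_integral_eq_integral) (simp_all add: mem_feichtinger_iff)
    then show "(\<integral>\<^sup>+z. ennreal (cmod (stft (u j) z)) \<partial>lborel) \<le> ennreal (A * (1/2) ^ j)"
      using A by (simp add: ennreal_leI)
  qed auto
  also have "\<dots> = ennreal (\<Sum>j. A * (1/2) ^ j)"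
    using geo \<open>A \<ge> 0\<close> by (intro suminf_ennreal2) auto
  also have "(\<Sum>j. A * (1/2) ^ j) = 2 * A"
    by (subst suminf_mult) (auto simp: suminf_geometric summable_geometric)
  finally have le: "(\<integral>\<^sup>+z. ennreal (cmod (stft (suminf u) z)) \<partial>lborel) \<le> ennreal (2 * A)" .
  then have int: "integrable lborel (stft (suminf u))"
    by (simp add: integrable_iff_bounded order.strict_trans1[OF le])
  then show "suminf u \<in> feichtinger" by (simp add: mem_feichtinger_iff)
  have "ennreal (feichtinger_norm (suminf u)) \<le> ennreal (2 * A)"
    using le unfolding feichtinger_norm_def by (subst nn_integral_eq_integral[symmetric]) (use int in auto)
  then show "feichtinger_norm (suminf u) \<le> 2 * A" using \<open>A \<ge> 0\<close> by (simp add: ennreal_le_iff)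
qed

text \<open>\<open>T\<close> is contracting in the Feichtinger norm, and no continuity for the
  Hilbert space norm is assumed, although the limit \<open>g\<close> is formed there. Therefore the
  equation for \<open>g\<close> is checked by bounding the Feichtinger norm of the defect
  \<open>d\<close>, not by passing to the limit under \<open>T\<close>.\<close>

lemma neumann_bij:
  fixes T :: "'n::finite L2 \<Rightarrow> 'n L2"
  assumes T: "\<And>f. f \<in> feichtinger \<Longrightarrow> T f \<in> feichtinger"
    and T_diff: "\<And>f g. f \<in> feichtinger \<Longrightarrow> g \<in> feichtinger \<Longrightarrow> T (f - g) = T f - T g"
    and half: "\<And>f. f \<in> feichtinger \<Longrightarrow> feichtinger_norm (T f) \<le> feichtinger_norm f / 2"
  shows "bij_betw (\<lambda>f. f - T f) feichtinger feichtinger"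
  unfolding bij_betw_def
proof
  let ?F = "feichtinger :: 'n L2 set"
  show "inj_on (\<lambda>f. f - T f) ?F"
  proof (rule inj_onI)
    fix f g assume fg: "f \<in> ?F" "g \<in> ?F" "f - T f = g - T g"
    then have "f - g = T (f - g)" by (simp add: T_diff algebra_simps)
    then have "feichtinger_norm (f - g) \<le> feichtinger_norm (f - g) / 2"
      using half[OF feichtinger_diff[OF fg(1,2)]] by simp
    then have "f - g = 0" by (intro eq_zero_if_feichtinger_norm_zero feichtinger_diff fg) simp
    then show "f = g" by simp
  qed
  show "(\<lambda>f. f - T f) ` ?F = ?F"
  proof (intro equalityI subsetI)
    fix h assume h: "h \<in> ?F"
    define u where "u j = (T ^^ j) h" for j
    have uF: "u j \<in> ?F" for j by (induct j) (auto simp: u_def h T)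
    have uN: "feichtinger_norm (u j) \<le> feichtinger_norm h * (1/2) ^ j" for j
    proof (induct j)
      case (Suc j)
      then show ?case using half[OF uF[of j]] by (simp add: u_def)
    qed (simp add: u_def)
    define g where "g = suminf u"
    have su: "summable u" "g \<in> ?F" unfolding g_def using feichtinger_complete[OF uF uN] by blast+
    define p where "p k = (\<Sum>j<k. u j)" for k
    have pF: "p k \<in> ?F" for k by (induct k) (auto simp: p_def zero_mem_feichtinger feichtinger_add uF)
    have T0: "T 0 = 0" using T_diff[OF zero_mem_feichtinger zero_mem_feichtinger] by simp
    have T_add: "T (f + f') = T f + T f'" if "f \<in> ?F" "f' \<in> ?F" for f f'
    proof -
      have "T (f - (0 - f')) = T f - (T 0 - T f')"
        using that by (simp only: T_diff feichtinger_diff zero_mem_feichtinger)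
      then show ?thesis using T0 by simp
    qed
    have pT: "p k - T (p k) = h - u k" for k
    proof (induct k)
      case 0
      then show ?case using T0 by (simp add: p_def u_def)
    next
      case (Suc k)
      have "p (Suc k) = p k + u k" by (simp add: p_def)
      moreover have "T (p k + u k) = T (p k) + u (Suc k)" using T_add[OF pF uF] by (simp add: u_def)
      ultimately show ?case using Suc by (simp add: algebra_simps)
    qed
    have tail: "feichtinger_norm (g - p k) \<le> 2 * (feichtinger_norm h * (1/2) ^ k)" for k
    proof -
      have "g - p k = (\<Sum>j. u (j + k))"
        using suminf_split_initial_segment[OF su(1), of k] by (simp add: g_def p_def)
      moreover have "feichtinger_norm (u (j + k)) \<le> feichtinger_norm h * (1/2) ^ k * (1/2) ^ j" for j
        using uN[of "j + k"] by (simp add: power_add mult_ac)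
      ultimately show ?thesis using feichtinger_complete(3)[of "\<lambda>j. u (j + k)", OF uF] by simp
    qed
    define d where "d = (g - T g) - h"
    have dF: "d \<in> ?F" unfolding d_def by (intro feichtinger_diff T su h)
    \<comment> \<open>The 4 is 2 from the tail g - p k, 1 from its image under \<open>T\<close> and
      1 from u k.\<close>
    have "feichtinger_norm d \<le> 4 * feichtinger_norm h * (1/2) ^ k" for k
    proof -
      have "d = ((g - p k) - T (g - p k)) - u k"
        using pT[of k] by (simp add: d_def T_diff[OF su(2) pF] algebra_simps)
      then have "feichtinger_norm d \<le> (feichtinger_norm (g - p k) + feichtinger_norm (T (g - p k))) + feichtinger_norm (u k)"
        using feichtinger_norm_diff_le[of "(g - p k) - T (g - p k)" "u k"] feichtinger_norm_diff_le[of "g - p k" "T (g - p k)"]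
        by (simp add: feichtinger_diff T su(2) pF uF)
      also have "\<dots> \<le> 4 * feichtinger_norm h * (1/2) ^ k"
        using tail[of k] half[OF feichtinger_diff[OF su(2) pF[of k]]] uN[of k] by simp
      finally show ?thesis .
    qed
    moreover have "(\<lambda>k. 4 * feichtinger_norm h * (1/2) ^ k) \<longlonglongrightarrow> 4 * feichtinger_norm h * 0"
      by (intro tendsto_intros LIMSEQ_power_zero) simp
    ultimately have "feichtinger_norm d \<le> 0"
      using LIMSEQ_le_const[of "\<lambda>k. 4 * feichtinger_norm h * (1/2) ^ k" 0 "feichtinger_norm d"] by auto
    then have "d = 0" by (rule eq_zero_if_feichtinger_norm_zero[OF dF])
    then show "h \<in> (\<lambda>f. f - T f) ` ?F"
      using su(2) by (intro image_eqI[of _ _ g]) (simp_all add: d_def)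
  qed (auto intro: feichtinger_diff T)
qed

section \<open>Gabor coefficients as module maps\<close>

lemma gaussian_mem_feichtinger: "tf_shift x gaussian \<in> (feichtinger :: 'n::finite L2 set)"
proof -
  have "integrable lborel (stft (tf_shift x gaussian :: 'n L2))"
  proof (rule Bochner_Integration.integrable_bound)
    have "integrable lborel (\<lambda>z. psi (x + (- 1) *\<^sub>R z))"
      by (rule lborel_integrable_affine[OF _ integrable_psi]) simp
    then show "integrable lborel (\<lambda>z. gnorm TYPE('n) * exp (pi / 2) * psi (x - z))" by simp
    show "AE z in lborel. norm (stft (tf_shift x gaussian :: 'n L2) z) \<le> norm (gnorm TYPE('n) * exp (pi / 2) * psi (x - z))"
      using cmod_gker_le[of z z x for z :: "'n phase_space"] by (auto simp: stft_tf_shift_gaussian abs_mult)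
  qed simp
  then show ?thesis by (simp add: mem_feichtinger_iff)
qed

text \<open>The value at Y of an algebra-valued pairing of \<open>f\<close> with \<pi>(x)\<phi>. The
  shift stands on \<open>f\<close>, so that the action on \<open>f\<close> becomes right
  multiplication; the value 0 off \<open>\<Gamma>\<close> matches the encoding of
  \<open>l1\<close>.\<close>

definition gabor_coeff :: "'n::finite phase_space set \<Rightarrow> 'n phase_space \<Rightarrow> 'n L2 \<Rightarrow> 'n phase_space \<Rightarrow> complex" where
  "gabor_coeff \<Gamma> x f Y = (if Y \<in> \<Gamma> then cinner (tf_shift Y f) (tf_shift x gaussian) else 0)"

lemma cmod_gabor_coeff: "Y \<in> \<Gamma> \<Longrightarrow> cmod (gabor_coeff \<Gamma> x f Y) = cmod (stft f (x - Y))"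
proof -
  assume "Y \<in> \<Gamma>"
  obtain \<theta> where "cmod \<theta> = 1" "tf_adj Y (tf_shift x gaussian) = cscale \<theta> (tf_shift (x - Y) gaussian)"
    by (rule tf_adj_tf_shift_gaussian)
  then show ?thesis using \<open>Y \<in> \<Gamma>\<close>
    by (simp add: gabor_coeff_def cinner_tf_adj_right[symmetric] norm_mult stft_def)
qed

text \<open>The phase \<theta> enters the synthesis once and the coefficient once as its conjugate,
  so it cancels; the sums of the frame operator therefore contain only V f and the kernel.\<close>

lemma gabor_coeff_mult_stft:
  "Y \<in> \<Gamma> \<Longrightarrow> gabor_coeff \<Gamma> x f Y * stft (tf_adj Y (tf_shift x gaussian)) w = stft f (x - Y) * gker (x - Y) w"
proof -
  assume "Y \<in> \<Gamma>"
  obtain \<theta> where \<theta>: "cmod \<theta> = 1" "tf_adj Y (tf_shift x gaussian) = cscale \<theta> (tf_shift (x - Y) gaussian)"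
    by (rule tf_adj_tf_shift_gaussian)
  have "cnj \<theta> * \<theta> = 1" using complex_norm_square[of \<theta>] \<theta>(1) by (simp add: mult.commute)
  then have "cnj \<theta> * a * (\<theta> * b) = a * b" for a b by (metis mult.assoc mult.commute mult_1)
  then show ?thesis using \<open>Y \<in> \<Gamma>\<close>
    by (simp add: gabor_coeff_def cinner_tf_adj_right[symmetric] \<theta>(2) stft_cscale stft_tf_shift_gaussian)
      (simp add: stft_def)
qed

lemma gabor_coeff_add: "gabor_coeff \<Gamma> x (f + g) = (\<lambda>Y. gabor_coeff \<Gamma> x f Y + gabor_coeff \<Gamma> x g Y)"
  by (auto simp: gabor_coeff_def tf_shift_add cinner_add_left)

context tf_group
begin

text \<open>\<pi>(Y) times the adjoint of \<pi>(Z) is a phase times \<pi>(Y - Z); the substitution W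
  = Y - Z then yields exactly the twisted convolution.\<close>

lemma gabor_coeff_act:
  assumes b: "b \<in> l1 \<Gamma>"
  shows "gabor_coeff \<Gamma> x (act \<Gamma> f b) = tconv \<Gamma> (gabor_coeff \<Gamma> x f) b"
proof
  fix Y
  show "gabor_coeff \<Gamma> x (act \<Gamma> f b) Y = tconv \<Gamma> (gabor_coeff \<Gamma> x f) b Y"
  proof (cases "Y \<in> \<Gamma>")
    case Y: True
    have "gabor_coeff \<Gamma> x (act \<Gamma> f b) Y = (\<Sum>\<^sub>\<infinity>Z\<in>\<Gamma>. cinner (tf_shift Y (cscale (b Z) (tf_adj Z f))) (tf_shift x gaussian))"
      using Y act_bounded_linear[OF b bounded_linear_compose[OF bounded_linear_cinner_left bounded_linear_tf_shift]]
      by (simp add: gabor_coeff_def)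
    also have "\<dots> = (\<Sum>\<^sub>\<infinity>Z\<in>\<Gamma>. gabor_coeff \<Gamma> x f (Y - Z) * b (Y - (Y - Z)) * cnj (beta (Y - Z) (Y - (Y - Z))))"
      using diff_mem[OF Y]
      by (intro infsum_cong) (simp add: gabor_coeff_def tf_shift_cscale tf_shift_tf_adj cinner_cscale_left mult_ac)
    also have "\<dots> = (\<Sum>\<^sub>\<infinity>W\<in>\<Gamma>. gabor_coeff \<Gamma> x f W * b (Y - W) * cnj (beta W (Y - W)))"
      by (rule infsum_reindex_bij_betw[OF bij_shift[OF Y]])
    finally show ?thesis using Y by (simp add: tconv_def)
  qed (simp add: gabor_coeff_def tconv_def)
qed

end

section \<open>The frame operator of a fine partition\<close>

theorem theorem5p12:
  fixes \<Lambda> :: "((real^'n) \<times> (real^'n)) set"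
  assumes "tf_lattice \<Lambda>"
  shows "fin_gen_projective (twisted_l1 (adjoint_lattice \<Lambda>)) (feichtinger_module (adjoint_lattice \<Lambda>))"
proof -
  define \<Gamma> where "\<Gamma> = adjoint_lattice \<Lambda>"
  obtain e R where e: "e > 0" "\<And>Y. Y \<in> \<Gamma> \<Longrightarrow> norm Y < e \<Longrightarrow> Y = 0"
    and R: "\<And>z. \<exists>Y\<in>\<Gamma>. dist z Y \<le> R"
    using adjoint_lattice_geometry[OF assms] unfolding \<Gamma>_def by metis
  interpret subgroup_set \<Gamma> unfolding \<Gamma>_def by (rule adjoint_lattice_subgroup)
  have "uniform_discrete \<Gamma>" using e by (rule uniform_discrete_if_separated)
  then have "countable \<Gamma>" by (rule uniform_discrete_imp_countable)
  then interpret tf_group \<Gamma> by unfold_locales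
  define c where "c = gnorm TYPE('n)"
  have c: "c > 0" unfolding c_def by (rule gnorm_pos)
  define J where "J = (LINT a|lborel. psi (a :: 'n phase_space))"
  have J: "J \<ge> 0" unfolding J_def by simp
  \<comment> \<open>Chosen for the bound \<delta> exp(34 \<pi>) J^2 \<le> 1/2 that makes
    \<open>T\<close> contract by 1/2; the + 1 keeps the denominator positive, and the minimum with 1
    serves the Lipschitz bound, which is local.\<close>
  define \<delta> where "\<delta> = min 1 (1 / (2 * exp (34 * pi) * (J * J + 1)))"
  have \<delta>: "\<delta> > 0" "\<delta> \<le> 1" using J by (auto simp: \<delta>_def add_nonneg_pos)
  have \<delta>J: "\<delta> * exp (34 * pi) * (J * J) \<le> 1 / 2"
  proof -
    have "\<delta> * (exp (34 * pi) * (J * J)) \<le> 1 / (2 * exp (34 * pi) * (J * J + 1)) * (exp (34 * pi) * (J * J))"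
      by (rule mult_right_mono) (simp_all add: \<delta>_def)
    also have "\<dots> = (J * J / (J * J + 1)) / 2" by simp
    also have "\<dots> \<le> 1 / 2" using J by (simp add: divide_le_eq_1 add_nonneg_pos)
    finally show ?thesis by (simp add: mult.assoc)
  qed
  obtain n :: nat and X :: "nat \<Rightarrow> 'n phase_space" and D :: "nat \<Rightarrow> 'n phase_space set" where D: "\<And>i. D i \<in> sets borel" "\<And>i. D i \<subseteq> ball (X i) \<delta>"
      "\<And>z. \<exists>i<n. \<exists>l\<in>\<Gamma>. z - l \<in> D i"
      "\<And>z i j l m. \<lbrakk>l \<in> \<Gamma>; m \<in> \<Gamma>; z - l \<in> D i; z - m \<in> D j\<rbrakk> \<Longrightarrow> i = j \<and> l = m"
  proof (rule rounding_cells[OF e R \<delta>(1)], assumption, assumption)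
    fix n :: nat and X :: "nat \<Rightarrow> 'n phase_space" and D
    assume "\<And>i. D i \<in> sets borel" "\<And>i. D i \<subseteq> ball (X i) \<delta>"
      "\<And>z. \<exists>i<n. \<exists>l\<in>\<Gamma>. z - l \<in> D i"
      "\<And>z i j l m. \<lbrakk>l \<in> \<Gamma>; m \<in> \<Gamma>; z - l \<in> D i; z - m \<in> D j\<rbrakk> \<Longrightarrow> i = j \<and> l = m"
    then show thesis by (rule that)
  qed
  define w where "w i = complex_of_real (measure lborel (D i))" for i
  define C where "C i = gabor_coeff \<Gamma> (X i)" for i :: nat
  define E where "E v = (\<Sum>i<n. cscale (w i) (act \<Gamma> (tf_shift (X i) gaussian) (v i)))" for v :: "nat \<Rightarrow> 'n phase_space \<Rightarrow> complex"
  have Cl1: "C i f \<in> l1 \<Gamma>" if "f \<in> feichtinger" for i f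
  proof -
    have "(\<lambda>Y. cmod (stft f (X i - Y))) summable_on \<Gamma>"
      by (rule sampling_summable[OF that subgroup_set_axioms e])
    then have "(\<lambda>Y. cmod (C i f Y)) summable_on \<Gamma>"
      by (rule summable_on_cong[THEN iffD1, rotated]) (simp add: C_def cmod_gabor_coeff)
    then show ?thesis by (simp add: l1_def C_def gabor_coeff_def)
  qed
  have sumF: "sum f I \<in> feichtinger" if "\<And>i. i \<in> I \<Longrightarrow> f i \<in> feichtinger" for f :: "nat \<Rightarrow> 'n L2" and I
    using that by (induct I rule: infinite_finite_induct) (auto simp: zero_mem_feichtinger feichtinger_add)
  have EF: "E v \<in> feichtinger" if "\<And>i. i < n \<Longrightarrow> v i \<in> l1 \<Gamma>" for v
    unfolding E_def using that by (intro sumF feichtinger_cscale act_closed gaussian_mem_feichtinger) auto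
  define S where "S f = E (\<lambda>i. C i f)" for f
  have SF: "S f \<in> feichtinger" if "f \<in> feichtinger" for f
    unfolding S_def by (intro EF Cl1 that)
  have S_add: "S (f + g) = S f + S g" if "f \<in> feichtinger" "g \<in> feichtinger" for f g
    by (simp add: S_def E_def C_def gabor_coeff_add act_add_right[OF Cl1[OF that(1), unfolded C_def] Cl1[OF that(2), unfolded C_def]]
        cscale_add_right sum.distrib)
  have S_diff: "S (f - g) = S f - S g" if fg: "f \<in> feichtinger" "g \<in> feichtinger" for f g
    using S_add[OF feichtinger_diff[OF fg] fg(2)] by simp
  have stft_S: "stft (S f) z = (\<Sum>i<n. w i * (\<Sum>\<^sub>\<infinity>Y\<in>\<Gamma>. stft f (X i - Y) * gker (X i - Y) z))" if f: "f \<in> feichtinger" for f z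
  proof -
    have "stft (S f) z = (\<Sum>i<n. w i * stft (act \<Gamma> (tf_shift (X i) gaussian) (C i f)) z)"
      unfolding S_def E_def by (simp add: stft_sum stft_cscale)
    also have "\<dots> = (\<Sum>i<n. w i * (\<Sum>\<^sub>\<infinity>Y\<in>\<Gamma>. stft f (X i - Y) * gker (X i - Y) z))"
    proof (intro sum.cong refl arg_cong[where f = "(*) _"])
      fix i
      show "stft (act \<Gamma> (tf_shift (X i) gaussian) (C i f)) z = (\<Sum>\<^sub>\<infinity>Y\<in>\<Gamma>. stft f (X i - Y) * gker (X i - Y) z)"
        unfolding stft_act[OF Cl1[OF f]] by (intro infsum_cong) (simp add: C_def gabor_coeff_mult_stft)
    qed
    finally show ?thesis .
  qed
  \<comment> \<open>Since f - T f = S f / c, the Neumann series for \<open>T\<close> gives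
    bijectivity of \<open>S\<close> up to a nonzero scalar.\<close>
  define T where "T f = f - cscale (complex_of_real (1 / c)) (S f)" for f
  have "bij_betw (\<lambda>f. f - T f) feichtinger feichtinger"
  proof (rule neumann_bij)
    fix f :: "'n L2" assume f: "f \<in> feichtinger"
    show TF: "T f \<in> feichtinger"
      unfolding T_def by (intro feichtinger_diff feichtinger_cscale SF f)
    have sm: "integrable lborel (smear f)" "(LINT z|lborel. smear f z) = feichtinger_norm f * J"
      using smear_integrable[OF f] by (simp_all add: J_def feichtinger_norm_def)
    \<comment> \<open>One factor J comes from \<open>smear\<close>, the other from convolving with
      \<open>psi\<close> once more in the evaluation point y.\<close>
    have sm2: "integrable lborel (\<lambda>y. LINT z|lborel. smear f z * psi (z - y))"
      "(LINT y|lborel. LINT z|lborel. smear f z * psi (z - y)) = feichtinger_norm f * J * J"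
      using convolution_integrable(2,3)[OF sm(1) integrable_psi] by (simp_all add: psi_le_1 sm(2) J_def)
    have "cmod (stft (T f) y) \<le> \<delta> * exp (34 * pi) * (LINT z|lborel. smear f z * psi (z - y))" for y
    proof -
      have "stft (T f) y = - complex_of_real (1 / c) * (stft (S f) y - complex_of_real c * stft f y)"
        using c by (simp add: T_def stft_diff stft_cscale field_simps)
      then have "cmod (stft (T f) y) = 1 / c * cmod (stft (S f) y - complex_of_real c * stft f y)"
        using c by (simp add: norm_mult norm_divide)
      also have "\<dots> \<le> 1 / c * (\<delta> * (c * exp (34 * pi)) * (LINT z|lborel. smear f z * psi (z - y)))"
      proof (rule mult_left_mono)
        show "cmod (stft (S f) y - complex_of_real c * stft f y) \<le> \<delta> * (c * exp (34 * pi)) * (LINT z|lborel. smear f z * psi (z - y))"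
          unfolding stft_S[OF f] w_def c_def by (rule riemann_sum_bound[OF f subgroup_set_axioms e \<delta>(2) D])
      qed (use c in simp)
      finally show ?thesis using c by simp
    qed
    then have "feichtinger_norm (T f) \<le> (LINT y|lborel. \<delta> * exp (34 * pi) * (LINT z|lborel. smear f z * psi (z - y)))"
      unfolding feichtinger_norm_def using sm2(1)
      by (intro integral_mono' integrable_mult_right) (simp_all add: \<delta>(1) less_imp_le)
    also have "\<dots> = \<delta> * exp (34 * pi) * (J * J) * feichtinger_norm f"
      by (simp add: sm2(2) mult_ac)
    also have "\<dots> \<le> 1 / 2 * feichtinger_norm f"
      by (intro mult_right_mono \<delta>J) simp
    finally show "feichtinger_norm (T f) \<le> feichtinger_norm f / 2" by simp
  next
    fix f g :: "'n L2" assume "f \<in> feichtinger" "g \<in> feichtinger"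
    then show "T (f - g) = T f - T g" by (simp add: T_def S_diff cscale_diff_right)
  qed
  then have bij1: "bij_betw (\<lambda>f. cscale (complex_of_real (1 / c)) (S f)) feichtinger feichtinger"
    by (simp add: T_def)
  have bij2: "bij_betw (cscale (complex_of_real c)) feichtinger (feichtinger :: 'n L2 set)"
    by (rule bij_betwI[where g = "cscale (complex_of_real (1 / c))"]) (use c in \<open>auto simp: feichtinger_cscale simp flip: of_real_mult\<close>)
  have bij: "bij_betw S feichtinger feichtinger"
    using bij_betw_trans[OF bij1 bij2] c by (simp add: comp_def flip: of_real_mult)
  show ?thesis
    unfolding \<Gamma>_def[symmetric]
  proof (rule fin_gen_projectiveI[where n = n and C = C and D = E])
    show "right_module (twisted_l1 \<Gamma>) (feichtinger_module \<Gamma>)" by (rule right_module_feichtinger)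
    \<comment> \<open>Elements of the free module are \<open>undefined\<close> from index n on,
      while \<open>E\<close> reads only the first n entries.\<close>
    have "E (\<lambda>i\<in>{..<n}. C i f) = S f" for f
      unfolding E_def S_def by (intro sum.cong) auto
    then show "bij_betw (\<lambda>x. E (\<lambda>i\<in>{..<n}. C i x)) (carrier (feichtinger_module \<Gamma>)) (carrier (feichtinger_module \<Gamma>))"
      using bij by simp
    fix v assume v: "v \<in> {..<n} \<rightarrow>\<^sub>E carrier (twisted_l1 \<Gamma>)"
    then have vl: "v i \<in> l1 \<Gamma>" if "i < n" for i using that by (auto simp: PiE_iff)
    then show "E v \<in> carrier (feichtinger_module \<Gamma>)" by (simp add: EF)
    show "E (\<lambda>i\<in>{..<n}. v i \<oplus>\<^bsub>twisted_l1 \<Gamma>\<^esub> u i) = E v \<oplus>\<^bsub>feichtinger_module \<Gamma>\<^esub> E u"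
      if "u \<in> {..<n} \<rightarrow>\<^sub>E carrier (twisted_l1 \<Gamma>)" for u
    proof -
      have "u i \<in> l1 \<Gamma>" if "i < n" for i using that \<open>u \<in> _\<close> by (auto simp: PiE_iff)
      then show ?thesis
        using vl by (simp add: E_def act_add_right cscale_add_right sum.distrib[symmetric])
    qed
    show "E (\<lambda>i\<in>{..<n}. v i \<otimes>\<^bsub>twisted_l1 \<Gamma>\<^esub> a) = ract (feichtinger_module \<Gamma>) (E v) a"
      if "a \<in> carrier (twisted_l1 \<Gamma>)" for a
    proof -
      have a: "a \<in> l1 \<Gamma>" using that by simp
      have act_sum: "act \<Gamma> (sum h I) a = (\<Sum>i\<in>I. act \<Gamma> (h i) a)" if "finite I" for h :: "nat \<Rightarrow> 'n L2" and I
        using that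
      proof (induct I rule: finite_induct)
        case empty
        show ?case using act_cscale[OF a, of 0 0] by simp
      qed (simp add: act_add_left[OF a])
      show ?thesis
        using vl by (simp add: E_def act_sum act_cscale[OF a] act_assoc[OF _ a])
    qed
  qed (simp_all add: Cl1, simp_all add: C_def gabor_coeff_add gabor_coeff_act)
qed

end
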